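(* Let $k\ge1$ and let $\underline{\mathbb S^k}$ be the string of $k$-spheres. The $k$-th proper homology group $\underline H_k(\underline{\mathbb S^k})$ (at the unique end of $\underline{\mathbb S^k}$) is a torsion-free, algebraically compact abelian group. Its maximal divisible subgroup is isomorphic to $\bigoplus^{\mathfrak c}\mathbb Q$ (the direct sum of $\mathfrak c$ copies of $\mathbb Q$), and its $p$-th torsion-free number is $\mathfrak c$ for every prime $p$. Consequently, $\underline H_k(\underline{\mathbb S^k})$ is isomorphic to $\prod_{n\ge0}\mathbb Z\big/\bigoplus_{n\ge0}\mathbb Z$.
   Context: $\mathfrak c$ is the cardinality of the continuum. The string of $k$-spheres $\underline{\mathbb S^k}$ is the ray $[0,\infty)$ with a distinct $k$-sphere attached at each integer point $n\ge0$; it has exactly one end. Ends. An efficient exhaustion of a space $X$ is a sequence $K_0\subseteq K_1\subseteq\cdots$ of compact connected subsets with $\bigcup_iK_i=X$, $K_i\subseteq\operatorname{int}(K_{i+1})$, and every connected component of $X\setminus K_i$ having non-compact closure. Fix one. An end of $X$ is a sequence $e=(U^{(0)}\supseteq U^{(1)}\supseteq\cdots)$ with $U^{(i)}$ a connected component of $X\setminus K_i$. A sequence $\{Z_n\}$ of subsets of $X$ converges to $e$ if for every $i$ there is $n_i$ with $Z_n\subseteq U^{(i)}$ for all $n\ge n_i$. Proper homology. $C_k(X)$ is the group of integral singular $k$-chains with boundary $\partial_k$; $\operatorname{supp}(c)$ is the union of the images of the singular simplices occurring with non-zero coefficient in the reduced form of $c$ ($\operatorname{supp}(0)=\varnothing$).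 Let $\underline C_k(X,e)$ be the group of sequences $\{c_n\}_{n\ge0}\in\prod_{n\ge0}C_k(X)$ with $\{\operatorname{supp}(c_n)\}$ converging to $e$; $\underline Z_k(X,e)$ the subgroup of those with $\partial_kc_n=0$ for all sufficiently large $n$; $\underline B_k(X,e)$ the subgroup of those for which there is $\{b_n\}\in\underline C_{k+1}(X,e)$ with $c_n=\partial_{k+1}b_n$ for all sufficiently large $n$. Then $\underline H_k(X,e)=\underline Z_k(X,e)/\underline B_k(X,e)$, written $\underline H_k(X)$ when $X$ has only one end. Abelian groups. A subgroup $B$ of an abelian group $A$ is pure if $nB=nA\cap B$ for all integers $n\ge1$. $A$ is algebraically compact if $A$ is a direct summand of $X$ whenever $A$ is a pure subgroup of an abelian group $X$. The maximal divisible subgroup of $A$ is the unique divisible subgroup containing all divisible subgroups. For a prime $p$, the $p$-th torsion-free number of $A$ is $\dim_{\mathbb F_p}A/(pA+A_t)$, where $A_t$ is the torsion subgroup of $A$. *)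

theory Defs
  imports "HOL-Homology.Homology" "HOL-Number_Theory.Residues"
    "HOL-Library.Equipollence"
begin

section \<open>Ends of a space\<close>

definition efficient_exhaustion :: "'a topology \<Rightarrow> (nat \<Rightarrow> 'a set) \<Rightarrow> bool" where
  "efficient_exhaustion X K \<longleftrightarrow>
     (\<forall>i. compactin X (K i) \<and> connectedin X (K i) \<and> K i \<subseteq> K (Suc i)
        \<and> K i \<subseteq> X interior_of K (Suc i)
        \<and> (\<forall>C \<in> connected_components_of (subtopology X (topspace X - K i)).
              \<not> compactin X (X closure_of C)))
     \<and> (\<Union>i. K i) = topspace X"

definition is_end :: "'a topology \<Rightarrow> (nat \<Rightarrow> 'a set) \<Rightarrow> (nat \<Rightarrow> 'a set) \<Rightarrow> bool" where
  "is_end X K U \<longleftrightarrow>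
     (\<forall>i. U i \<in> connected_components_of (subtopology X (topspace X - K i)) \<and> U (Suc i) \<subseteq> U i)"

definition converges_to_end :: "(nat \<Rightarrow> 'a set) \<Rightarrow> (nat \<Rightarrow> 'a set) \<Rightarrow> bool" where
  "converges_to_end Z U \<longleftrightarrow> (\<forall>i. \<exists>m. \<forall>n\<ge>m. Z n \<subseteq> U i)"


section \<open>Proper homology\<close>

text \<open>Chains are finitely supported integer combinations of singular simplices, so
  \<^const>\<open>Poly_Mapping.keys\<close> gives the simplices of the reduced form.\<close>

definition chain_supp :: "nat \<Rightarrow> 'a chain \<Rightarrow> 'a set" where
  "chain_supp k c = (\<Union>f \<in> Poly_Mapping.keys c. f ` standard_simplex k)"

definition proper_chains :: "nat \<Rightarrow> 'a topology \<Rightarrow> (nat \<Rightarrow> 'a set) \<Rightarrow> (nat \<Rightarrow> 'a chain) set" where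
  "proper_chains k X e =
     {c. (\<forall>n. singular_chain k X (c n)) \<and> converges_to_end (\<lambda>n. chain_supp k (c n)) e}"

definition proper_cycles :: "nat \<Rightarrow> 'a topology \<Rightarrow> (nat \<Rightarrow> 'a set) \<Rightarrow> (nat \<Rightarrow> 'a chain) set" where
  "proper_cycles k X e =
     {c \<in> proper_chains k X e. \<exists>m. \<forall>n\<ge>m. chain_boundary k (c n) = 0}"

definition proper_boundaries :: "nat \<Rightarrow> 'a topology \<Rightarrow> (nat \<Rightarrow> 'a set) \<Rightarrow> (nat \<Rightarrow> 'a chain) set" where
  "proper_boundaries k X e =
     {c \<in> proper_chains k X e.
        \<exists>b \<in> proper_chains (Suc k) X e. \<exists>m. \<forall>n\<ge>m. c n = chain_boundary (Suc k) (b n)}"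

definition proper_homology_group ::
    "nat \<Rightarrow> 'a topology \<Rightarrow> (nat \<Rightarrow> 'a set) \<Rightarrow> (nat \<Rightarrow> 'a chain) set monoid" where
  "proper_homology_group k X e =
     (product_group UNIV (\<lambda>n::nat. chain_group k X))\<lparr>carrier := proper_cycles k X e\<rparr>
       Mod proper_boundaries k X e"


section \<open>The string of spheres\<close>

definition sphere_basepoint :: "nat \<Rightarrow> real" where
  "sphere_basepoint = (\<lambda>i. if i = 0 then 1 else 0)"

text \<open>Realised inside \<open>\<real> \<times> S\<^sup>k\<close> as the ray \<open>[0,\<infinity>) \<times> {\<ast>}\<close> together with the spheres
  \<open>{n} \<times> S\<^sup>k\<close>, the \<open>n\<close>-th of which meets the ray only in \<open>(n, \<ast>)\<close>. The spheres form a
  locally finite family, so the subspace topology is the topology of the attachment.\<close>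

definition string_of_spheres :: "nat \<Rightarrow> (real \<times> (nat \<Rightarrow> real)) topology" where
  "string_of_spheres k =
     subtopology (prod_topology euclideanreal (nsphere k))
       ({0..} \<times> {sphere_basepoint} \<union> (\<Union>n::nat. {real n} \<times> topspace (nsphere k)))"


section \<open>Abelian groups\<close>

text \<open>Abelian groups are written multiplicatively: \<open>x [^] n\<close> is the multiple \<open>n x\<close>, and
  \<open><#>\<close> is the sum of two subgroups.\<close>

definition torsion_subgroup :: "('a, 'c) monoid_scheme \<Rightarrow> 'a set" where
  "torsion_subgroup A = {x \<in> carrier A. \<exists>n::nat. n \<ge> 1 \<and> x [^]\<^bsub>A\<^esub> n = \<one>\<^bsub>A\<^esub>}"

definition torsion_free_group :: "('a, 'c) monoid_scheme \<Rightarrow> bool" where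
  "torsion_free_group A \<longleftrightarrow> torsion_subgroup A = {\<one>\<^bsub>A\<^esub>}"

definition multiples :: "('a, 'c) monoid_scheme \<Rightarrow> nat \<Rightarrow> 'a set \<Rightarrow> 'a set" where
  "multiples A n S = (\<lambda>x. x [^]\<^bsub>A\<^esub> n) ` S"

definition pure_subgroup :: "'a set \<Rightarrow> ('a, 'c) monoid_scheme \<Rightarrow> bool" where
  "pure_subgroup B A \<longleftrightarrow>
     subgroup B A \<and> (\<forall>n\<ge>1. multiples A n B = multiples A n (carrier A) \<inter> B)"

definition direct_summand :: "'a set \<Rightarrow> ('a, 'c) monoid_scheme \<Rightarrow> bool" where
  "direct_summand B A \<longleftrightarrow>
     subgroup B A \<and> (\<exists>C. subgroup C A \<and> B \<inter> C = {\<one>\<^bsub>A\<^esub>} \<and> B <#>\<^bsub>A\<^esub> C = carrier A)"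

text \<open>HOL cannot quantify over all abelian groups inside a formula, so the groups in which
  \<open>A\<close> is to split are those with elements in a type \<open>'b\<close>, a parameter. A theorem that
  leaves \<open>'b\<close> free covers all of them. As \<open>A\<close> need not have type \<open>'b\<close>, the copies of \<open>A\<close>
  in \<open>X\<close> are considered.\<close>

definition algebraically_compact :: "'b itself \<Rightarrow> ('a, 'c) monoid_scheme \<Rightarrow> bool" where
  "algebraically_compact (T :: 'b itself) A \<longleftrightarrow>
     comm_group A \<and>
     (\<forall>(X :: 'b monoid) B.
        comm_group X \<and> pure_subgroup B X \<and> A \<cong> X\<lparr>carrier := B\<rparr> \<longrightarrow> direct_summand B X)"

definition divisible_subgroup :: "'a set \<Rightarrow> ('a, 'c) monoid_scheme \<Rightarrow> bool" where
  "divisible_subgroup D A \<longleftrightarrow> subgroup D A \<and> (\<forall>n\<ge>1. multiples A n D = D)"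

definition maximal_divisible_subgroup :: "'a set \<Rightarrow> ('a, 'c) monoid_scheme \<Rightarrow> bool" where
  "maximal_divisible_subgroup D A \<longleftrightarrow>
     divisible_subgroup D A \<and> (\<forall>E. divisible_subgroup E A \<longrightarrow> E \<subseteq> D)"

definition rational_group :: "rat monoid" where
  "rational_group = \<lparr>carrier = UNIV, monoid.mult = (+), one = 0\<rparr>"

definition module_basis :: "('r, 'm) ring_scheme \<Rightarrow> ('r, 'a, 'c) module_scheme \<Rightarrow> 'a set \<Rightarrow> bool" where
  "module_basis R M B \<longleftrightarrow>
     B \<subseteq> carrier M \<and>
     (\<forall>x \<in> carrier M. \<exists>F a. finite F \<and> F \<subseteq> B \<and> a \<in> F \<rightarrow> carrier R
         \<and> x = (\<Oplus>\<^bsub>M\<^esub>b\<in>F. a b \<odot>\<^bsub>M\<^esub> b)) \<and>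
     (\<forall>F a. finite F \<and> F \<subseteq> B \<and> a \<in> F \<rightarrow> carrier R \<and> (\<Oplus>\<^bsub>M\<^esub>b\<in>F. a b \<odot>\<^bsub>M\<^esub> b) = \<zero>\<^bsub>M\<^esub>
         \<longrightarrow> (\<forall>b\<in>F. a b = \<zero>\<^bsub>R\<^esub>))"

text \<open>The dimension, as a cardinal number represented by the set \<open>S\<close>.\<close>

definition has_dimension ::
    "('r, 'm) ring_scheme \<Rightarrow> ('r, 'a, 'c) module_scheme \<Rightarrow> 's set \<Rightarrow> bool" where
  "has_dimension R M S \<longleftrightarrow> (\<exists>B. module_basis R M B \<and> B \<approx> S)"

text \<open>An abelian group killed by \<open>p\<close> as a vector space over \<open>residue_ring p\<close>. The
  fields \<open>mult\<close> and \<open>one\<close>, which modules inherit from the record of rings, play no role.\<close>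

definition vector_space_mod :: "('a, 'c) monoid_scheme \<Rightarrow> (int, 'a) module" where
  "vector_space_mod V =
     \<lparr>carrier = carrier V, monoid.mult = monoid.mult V, one = one V,
      zero = one V, add = monoid.mult V, smult = (\<lambda>a x. x [^]\<^bsub>V\<^esub> a)\<rparr>"

definition has_torsion_free_number :: "nat \<Rightarrow> ('a, 'c) monoid_scheme \<Rightarrow> 's set \<Rightarrow> bool" where
  "has_torsion_free_number p A S \<longleftrightarrow>
     has_dimension (residue_ring (int p))
       (vector_space_mod (A Mod (multiples A p (carrier A) <#>\<^bsub>A\<^esub> torsion_subgroup A))) S"


section \<open>Existence and uniqueness of the end of the string of spheres\<close>

lemma compact_space_nsphere: "compact_space (nsphere k)"
proof -
  let ?P = "powertop_real UNIV"
  let ?S = "{x. (\<Sum>i\<le>k. x i ^ 2) = 1 \<and> (\<forall>i>k. x i = 0)} :: (nat \<Rightarrow> real) set"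
  have proj: "continuous_map ?P euclideanreal (\<lambda>x. x i)" for i :: nat
    by (rule continuous_map_product_projection) simp
  have "continuous_map ?P euclideanreal (\<lambda>x. \<Sum>i\<le>k. x i ^ 2)"
    by (intro continuous_intros continuous_map_real_pow proj) auto
  then have c1: "closedin ?P {x \<in> topspace ?P. (\<Sum>i\<le>k. x i ^ 2) \<in> {1}}"
    by (rule closedin_continuous_map_preimage) auto
  have c2: "closedin ?P {x \<in> topspace ?P. x i \<in> {0 :: real}}" for i :: nat
    by (rule closedin_continuous_map_preimage[OF proj]) simp
  have "closedin ?P (\<Inter>(insert {x \<in> topspace ?P. (\<Sum>i\<le>k. x i ^ 2) \<in> {1}}
           ((\<lambda>i. {x \<in> topspace ?P. x i \<in> {0}}) ` {k<..})))"
    by (rule closedin_Inter) (use c1 c2 in auto)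
  also have "\<Inter>(insert {x \<in> topspace ?P. (\<Sum>i\<le>k. x i ^ 2) \<in> {1}}
           ((\<lambda>i. {x \<in> topspace ?P. x i \<in> {0}}) ` {k<..})) = ?S"
    by auto
  finally have cl: "closedin ?P ?S" .
  have "compactin ?P (PiE UNIV (\<lambda>_. {-1..1}))"
    by (subst compactin_PiE) auto
  moreover have "?S \<subseteq> PiE UNIV (\<lambda>_. {-1..1})"
  proof
    fix x :: "nat \<Rightarrow> real" assume x: "x \<in> ?S"
    have "x i \<in> {-1..1}" for i
    proof (cases "i \<le> k")
      case True
      then have "x i ^ 2 \<le> (\<Sum>i\<le>k. x i ^ 2)"
        by (intro member_le_sum) auto
      then have "x i ^ 2 \<le> 1" using x by auto
      then show ?thesis using abs_square_le_1[of "x i"] by (simp add: abs_le_iff)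
    qed (use x in auto)
    then show "x \<in> PiE UNIV (\<lambda>_. {-1..1})" by auto
  qed
  ultimately have "compactin ?P ?S" using closed_compactin cl by blast
  then show ?thesis by (simp add: nsphere compact_space_subtopology)
qed

lemma connected_space_nsphere:
  assumes "k \<ge> 1" shows "connected_space (nsphere k)"
proof -
  let ?T = "topspace (nsphere k)"
  have "connectedin (nsphere k) (?T \<inter> {x. x k \<ge> 0})"
    using contractible_imp_connected_space[OF contractible_space_upper_hemisphere[of k k]]
    by (simp add: connectedin_def subtopology_restrict)
  moreover have "connectedin (nsphere k) (?T \<inter> {x. x k \<le> 0})"
    using contractible_imp_connected_space[OF contractible_space_lower_hemisphere[of k k]]
    by (simp add: connectedin_def subtopology_restrict)
  moreover have "sphere_basepoint \<in> (?T \<inter> {x. x k \<ge> 0}) \<inter> (?T \<inter> {x. x k \<le> 0})"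
    using in_topspace_nsphere[of k] assms by (auto simp: sphere_basepoint_def)
  ultimately have "connectedin (nsphere k) ((?T \<inter> {x. x k \<ge> 0}) \<union> (?T \<inter> {x. x k \<le> 0}))"
    by (intro connectedin_Un) auto
  moreover have "(?T \<inter> {x. x k \<ge> 0}) \<union> (?T \<inter> {x. x k \<le> 0}) = ?T" by auto
  ultimately show ?thesis by (simp add: connectedin_topspace)
qed

abbreviation string_part :: "nat \<Rightarrow> real set \<Rightarrow> (real \<times> (nat \<Rightarrow> real)) set" where
  "string_part k I \<equiv> {x \<in> topspace (string_of_spheres k). fst x \<in> I}"

lemma topspace_string_of_spheres:
  "topspace (string_of_spheres k) =
     {0..} \<times> {sphere_basepoint} \<union> (\<Union>n::nat. {real n} \<times> topspace (nsphere k))"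
  using in_topspace_nsphere[of k] by (auto simp: string_of_spheres_def sphere_basepoint_def)

lemma continuous_map_string_fst: "continuous_map (string_of_spheres k) euclideanreal fst"
  unfolding string_of_spheres_def by (intro continuous_map_from_subtopology continuous_map_fst)

lemma connectedin_string_part:
  assumes k: "k \<ge> 1" and I: "is_interval I" "I \<subseteq> {0..}"
  shows "connectedin (string_of_spheres k) (string_part k I)"
proof (cases "I = {}")
  case False
  let ?X = "string_of_spheres k" and ?P = "prod_topology euclideanreal (nsphere k)"
  let ?R = "I \<times> {sphere_basepoint}"
  have b: "sphere_basepoint \<in> topspace (nsphere k)"
    using in_topspace_nsphere[of k] by (simp add: sphere_basepoint_def)
  have R: "connectedin ?X ?R"
    using I b unfolding string_of_spheres_def connectedin_subtopology
    by (auto simp: connectedin_Times is_interval_connected connectedin_sing)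
  have S: "connectedin ?X ({real n} \<times> topspace (nsphere k))" for n
    using connected_space_nsphere[OF k] unfolding string_of_spheres_def connectedin_subtopology
    by (auto simp: connectedin_Times connectedin_topspace connectedin_sing)
  define \<U> where "\<U> = insert ?R ((\<lambda>n. ?R \<union> {real n} \<times> topspace (nsphere k)) ` {n. real n \<in> I})"
  have "connectedin ?X (\<Union>\<U>)"
  proof (rule connectedin_Union)
    show "connectedin ?X S" if "S \<in> \<U>" for S
      using that R S b unfolding \<U>_def by (auto intro!: connectedin_Un)
    show "\<Inter>\<U> \<noteq> {}" using False unfolding \<U>_def by auto
  qed
  moreover have "\<Union>\<U> = string_part k I"
    using I b by (auto simp: \<U>_def topspace_string_of_spheres)
  ultimately show ?thesis by simp
qed auto

lemma closedin_string_of_spheres: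
  "closedin (prod_topology euclideanreal (nsphere k)) (topspace (string_of_spheres k))"
proof -
  let ?P = "prod_topology euclideanreal (nsphere k)"
  have b: "sphere_basepoint \<in> topspace (nsphere k)"
    using in_topspace_nsphere[of k] by (simp add: sphere_basepoint_def)
  have "Hausdorff_space (nsphere k)"
    by (auto simp: nsphere Hausdorff_space_subtopology Hausdorff_space_product_topology)
  then have "closedin (nsphere k) {sphere_basepoint}"
    using b by (simp add: closedin_Hausdorff_singleton)
  then have "closedin ?P ({0..} \<times> {sphere_basepoint})"
    by (simp add: closedin_prod_Times_iff)
  moreover have "closed (real ` UNIV)"
    by (rule closed_of_nat_image)
  then have "closedin ?P (real ` UNIV \<times> topspace (nsphere k))"
    by (simp add: closedin_prod_Times_iff)
  moreover have "topspace (string_of_spheres k) =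
      {0..} \<times> {sphere_basepoint} \<union> real ` UNIV \<times> topspace (nsphere k)"
    unfolding topspace_string_of_spheres by auto
  ultimately show ?thesis by (metis closedin_Un)
qed

lemma compactin_string_part: "compactin (string_of_spheres k) (string_part k {..c})"
proof -
  let ?P = "prod_topology euclideanreal (nsphere k)"
  have "compactin ?P ({0..c} \<times> topspace (nsphere k))"
    using compact_space_nsphere[of k] by (auto simp: compactin_Times compact_space_def)
  then have "compactin ?P ({0..c} \<times> topspace (nsphere k) \<inter> topspace (string_of_spheres k))"
    by (rule compact_Int_closedin[OF _ closedin_string_of_spheres])
  moreover have "{0..c} \<times> topspace (nsphere k) \<inter> topspace (string_of_spheres k) = string_part k {..c}"
    using in_topspace_nsphere[of k]
    by (auto simp: topspace_string_of_spheres sphere_basepoint_def)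
  ultimately show ?thesis
    unfolding string_of_spheres_def compactin_subtopology
    by (auto simp: string_of_spheres_def)
qed

lemma compactin_string_bounded:
  assumes "compactin (string_of_spheres k) C"
  shows "\<exists>c\<ge>0. C \<subseteq> string_part k {..c}"
proof -
  have "compact (fst ` C)"
    using image_compactin[OF assms continuous_map_string_fst] by simp
  then obtain c where "\<forall>x \<in> fst ` C. norm x \<le> c"
    using compact_imp_bounded bounded_iff by metis
  then have "C \<subseteq> string_part k {..max c 0}"
    using compactin_subset_topspace[OF assms] by fastforce
  then show ?thesis by (meson max.cobounded2)
qed

lemma string_part_unbounded:
  assumes "c \<ge> 0" shows "\<not> string_part k {c<..} \<subseteq> string_part k {..d}"
proof -
  have "(max c d + 1, sphere_basepoint) \<in> string_part k {c<..} - string_part k {..d}"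
    using assms by (auto simp: topspace_string_of_spheres)
  then show ?thesis by blast
qed

lemma string_part_nonempty:
  assumes "c \<ge> 0" shows "string_part k {c<..} \<noteq> {}"
proof -
  have "(c + 1, sphere_basepoint) \<in> string_part k {c<..}"
    using assms by (auto simp: topspace_string_of_spheres)
  then show ?thesis by (metis (no_types, lifting) empty_iff)
qed

lemma component_of_connected:
  assumes "connectedin X S" "S \<noteq> {}" "C \<in> connected_components_of (subtopology X S)"
  shows "C = S"
proof
  let ?Y = "subtopology X S"
  have S: "topspace ?Y = S" "connectedin ?Y S"
    using assms(1) connectedin_subset_topspace by (auto simp: connectedin_subtopology)
  show "C \<subseteq> S" using connected_components_of_subset[OF assms(3)] S(1) by simp
  moreover have "C \<noteq> {}" using nonempty_connected_components_of[OF assms(3)] .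
  ultimately show "S \<subseteq> C"
    by (intro connected_components_of_maximal[OF assms(3) S(2)]) (auto simp: disjnt_def)
qed

lemma efficient_exhaustion_string_of_spheres:
  assumes "k \<ge> 1"
  shows "efficient_exhaustion (string_of_spheres k) (\<lambda>i. string_part k {..real i})"
  unfolding efficient_exhaustion_def
proof (intro conjI allI ballI)
  let ?X = "string_of_spheres k"
  fix i :: nat
  show "compactin ?X (string_part k {..real i})" by (rule compactin_string_part)
  have "string_part k {..real i} = string_part k {0..real i}"
    by (auto simp: topspace_string_of_spheres)
  then show "connectedin ?X (string_part k {..real i})"
    using connectedin_string_part[OF assms, of "{0..real i}"] by (auto simp: is_interval_1)
  show "string_part k {..real i} \<subseteq> string_part k {..real (Suc i)}" by auto
  have "openin ?X (string_part k {..<real (Suc i)})"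
    by (rule openin_continuous_map_preimage[OF continuous_map_string_fst]) auto
  then have "string_part k {..<real (Suc i)} \<subseteq> ?X interior_of string_part k {..real (Suc i)}"
    by (intro interior_of_maximal) auto
  then show "string_part k {..real i} \<subseteq> ?X interior_of string_part k {..real (Suc i)}"
    by fastforce
  fix C assume C: "C \<in> connected_components_of (subtopology ?X (topspace ?X - string_part k {..real i}))"
  have eq: "topspace ?X - string_part k {..real i} = string_part k {real i<..}" by auto
  have "connectedin ?X (string_part k {real i<..})"
    by (rule connectedin_string_part[OF assms]) (auto simp: is_interval_def)
  moreover have "string_part k {real i<..} \<noteq> {}"
    by (rule string_part_nonempty) simp
  ultimately have C_eq: "C = string_part k {real i<..}"
    using C unfolding eq by (rule component_of_connected)
  show "\<not> compactin ?X (?X closure_of C)"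
  proof
    assume "compactin ?X (?X closure_of C)"
    then obtain d where "?X closure_of C \<subseteq> string_part k {..d}"
      using compactin_string_bounded by blast
    moreover have "C \<subseteq> ?X closure_of C"
      by (rule closure_of_subset) (auto simp: C_eq)
    ultimately have "C \<subseteq> string_part k {..d}" by (rule order_trans[rotated])
    then show False using string_part_unbounded[of "real i" k d] by (simp add: C_eq)
  qed
next
  show "(\<Union>i. string_part k {..real i}) = topspace (string_of_spheres k)"
    by (auto simp: real_arch_simple)
qed

lemma ex1_end_string_of_spheres:
  assumes k: "k \<ge> 1" and K: "efficient_exhaustion (string_of_spheres k) K"
  shows "\<exists>!e. is_end (string_of_spheres k) K e"
proof -
  let ?X = "string_of_spheres k"
  let ?Y = "\<lambda>i. subtopology ?X (topspace ?X - K i)"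
  have comp: "compactin ?X (K i)" and sub: "K i \<subseteq> K (Suc i)"
    and nc: "\<And>C. C \<in> connected_components_of (?Y i) \<Longrightarrow> \<not> compactin ?X (?X closure_of C)" for i
    using K by (auto simp: efficient_exhaustion_def)
  have "\<forall>i. \<exists>c. c \<ge> 0 \<and> K i \<subseteq> string_part k {..c}"
    by (rule allI) (rule compactin_string_bounded[OF comp])
  from choice[OF this] obtain c where "\<forall>i. c i \<ge> 0 \<and> K i \<subseteq> string_part k {..c i}" ..
  then have c: "\<And>i. c i \<ge> 0" "\<And>i. K i \<subseteq> string_part k {..c i}"
    by simp_all
  have subset_nonempty: "B \<noteq> {}" if "A \<subseteq> B" "A \<noteq> {}" for A B :: "(real \<times> (nat \<Rightarrow> real)) set"
    using that by blast
  have T: "connectedin (?Y i) (string_part k {d<..})" if "d \<ge> c i" for i d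
    unfolding connectedin_subtopology
  proof
    show "connectedin ?X (string_part k {d<..})"
      using c(1)[of i] that by (intro connectedin_string_part[OF k]) (auto simp: is_interval_1)
    show "string_part k {d<..} \<subseteq> topspace ?X - K i"
      using c(2)[of i] that by force
  qed
  have meets: "\<not> disjnt C (string_part k {d<..})"
    if "C \<in> connected_components_of (?Y i)" for C i d
  proof
    assume "disjnt C (string_part k {d<..})"
    moreover have "C \<subseteq> topspace ?X"
      using connected_components_of_subset[OF that] by auto
    ultimately have "C \<subseteq> string_part k {..d}" by (fastforce simp: disjnt_def)
    moreover have "closedin ?X (string_part k {..d})"
      by (rule closedin_continuous_map_preimage[OF continuous_map_string_fst]) auto
    ultimately have "?X closure_of C \<subseteq> string_part k {..d}" by (simp add: closure_of_minimal)
    then have "compactin ?X (?X closure_of C)"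
      by (rule closed_compactin[OF compactin_string_part _ closedin_closure_of])
    with nc[OF that] show False by (rule notE)
  qed
  have contains: "string_part k {d<..} \<subseteq> C"
    if "C \<in> connected_components_of (?Y i)" "d \<ge> c i" for C i d
    using connected_components_of_maximal[OF that(1) T[OF that(2)] meets[OF that(1)]] .
  have uniq: "C = C'" if "C \<in> connected_components_of (?Y i)" "C' \<in> connected_components_of (?Y i)"
    for C C' i
  proof (rule ccontr)
    assume "C \<noteq> C'"
    then have "disjnt C C'"
      using pairwise_disjoint_connected_components_of[of "?Y i"] that by (auto simp: pairwise_def)
    then have "string_part k {c i<..} = {}"
      using contains[OF that(1), of "c i"] contains[OF that(2), of "c i"] unfolding disjnt_def by blast
    with string_part_nonempty[OF c(1)] show False by (rule notE)
  qed
  have "\<exists>C. C \<in> connected_components_of (?Y i)" for i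
  proof -
    have "string_part k {c i<..} \<subseteq> topspace (?Y i)"
      by (rule connectedin_subset_topspace[OF T]) simp
    then have "topspace (?Y i) \<noteq> {}"
      by (rule subset_nonempty) (rule string_part_nonempty[OF c(1)])
    then show ?thesis using Union_connected_components_of[of "?Y i"] by (metis Sup_empty ex_in_conv)
  qed
  then obtain U where U: "\<And>i. U i \<in> connected_components_of (?Y i)" by metis
  have "U (Suc i) \<subseteq> U i" for i
  proof (rule connected_components_of_maximal[OF U])
    have "connectedin ?X (U (Suc i))" "U (Suc i) \<subseteq> topspace ?X - K (Suc i)"
      using connectedin_connected_components_of[OF U[of "Suc i"]]
      by (auto simp: connectedin_subtopology)
    then show "connectedin (?Y i) (U (Suc i))"
      using sub[of i] by (auto simp: connectedin_subtopology)
    show "\<not> disjnt (U i) (U (Suc i))"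
    proof
      let ?d = "max (c i) (c (Suc i))"
      assume "disjnt (U i) (U (Suc i))"
      moreover have "string_part k {?d<..} \<subseteq> U i" "string_part k {?d<..} \<subseteq> U (Suc i)"
        by (rule contains[OF U], simp)+
      ultimately have "string_part k {?d<..} = {}" unfolding disjnt_def by blast
      moreover have "string_part k {?d<..} \<noteq> {}"
        by (rule string_part_nonempty) (use c(1)[of i] in simp)
      ultimately show False by (rule notE[rotated])
    qed
  qed
  then have "is_end ?X K U" using U by (simp add: is_end_def)
  moreover have "e = U" if "is_end ?X K e" for e
  proof
    fix i
    show "e i = U i" using that U[of i] by (intro uniq[of _ i]) (auto simp: is_end_def)
  qed
  ultimately show ?thesis by (rule ex1I)
qed

end

theory Submission
  imports Defs
begin

text \<open>Beyond a point \<open>t\<close> of the ray, a cycle of dimension \<open>k\<close> is homologous to an integral combination of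
  the fundamental cycles of the spheres beyond \<open>t\<close> (\<open>cycle_homologous_to_string_cycle\<close>), and the
  coefficients of such a combination are determined by its class in the whole string
  (\<open>string_cycle_boundary_imp_zero\<close>). A proper cycle \<open>{c n}\<close> therefore amounts to an integer matrix whose
  \<open>n\<close>-th row lists the coefficients of \<open>c n\<close>. Its rows are finite because each combination is, its
  columns are finite because the \<open>c n\<close> run off to the end, and finitely many rows do not matter. So
  the proper homology group is the group of integer matrices with finite rows and columns modulo
  the matrices with finite support.

  This group and \<open>\<Prod>\<int> / \<Oplus>\<int>\<close> have a common form: functions \<open>f :: 's \<Rightarrow> int\<close> for which every set
  \<open>{i. f i \<noteq> 0 \<and> r i \<le> m}\<close> is finite, modulo the finitely supported ones. For \<open>\<Prod>\<int> / \<Oplus>\<int>\<close> the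
  index set is \<open>\<nat>\<close> and \<open>r\<close> is the identity, for matrices it is \<open>\<nat> \<times> \<nat>\<close> and \<open>r\<close> is the minimum.
  All that is needed follows from this form (\<open>proper_function_quotient\<close>) and is collected in the
  locale \<open>saturated_group\<close>. Such a group \<open>A\<close> is torsion-free, and a countable system of congruences in
  one unknown is solvable in \<open>A\<close> if its finite subsystems are: a diagonal function glues the
  solutions of the finite subsystems. Moreover \<open>A\<close> has at most continuum many elements, and the almost disjoint
  family of the branches of the binary tree provides continuum many elements of \<open>A\<close> that are independent modulo
  every \<open>n\<close> and, after multiplication by factorials, continuum many independent elements divisible by every
  \<open>n \<noteq> 0\<close>.

  The algebra rests on one extension theorem (\<open>extend_height_graph\<close>). Let \<open>A\<close> be torsion-free with
  solvable countable systems. A homomorphism into \<open>A\<close> from a subgroup \<open>Y\<close> of any abelian group \<open>X\<close>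
  extends to \<open>X\<close> if it maps \<open>Y \<inter> nX\<close> into \<open>nA\<close> for every \<open>n\<close>. It has three applications.

  \<^item> A copy of \<open>A\<close> that is pure in \<open>X\<close> is a retract of \<open>X\<close>, so \<open>A\<close> is algebraically compact.

  \<^item> The free group on a maximal independent family of the divisible part \<open>D = \<Inter>nA\<close> maps to \<open>D\<close>; the
    map extends to \<open>\<Oplus>\<rat>\<close>, and the extension is an isomorphism onto \<open>D\<close>.

  \<^item> Saturated groups \<open>A\<close> and \<open>B\<close> are isomorphic (\<open>saturated_groups_isomorphic\<close>). By the Chinese remainder
    theorem some family in \<open>A\<close>, indexed by \<open>\<real>\<close>, is a basis of \<open>A/pA\<close> for all primes \<open>p\<close> at once. Sending
    it to such a family in \<open>B\<close> and the divisible part of \<open>A\<close> isomorphically onto that of \<open>B\<close> extends to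
    a homomorphism \<open>A \<rightarrow> B\<close>. It is an isomorphism modulo every \<open>n \<noteq> 0\<close> and on the divisible parts,
    hence injective, and the solvability of congruences in \<open>A\<close> makes it surjective.\<close>


section \<open>Extending homomorphisms that do not lower divisibility\<close>

text \<open>Integer multipliers include \<open>0\<close>, and \<open>0G\<close> is trivial. A statement about membership in all \<open>nG\<close> thus
  contains a statement about being neutral.\<close>

definition int_multiples :: "('a, 'c) monoid_scheme \<Rightarrow> int \<Rightarrow> 'a set" where
  "int_multiples G n = (\<lambda>x. x [^]\<^bsub>G\<^esub> n) ` carrier G"

text \<open>A countable form of algebraic compactness. The extension theorem adjoins one element at a time, and only
  countably many pairs of a multiplier \<open>m j\<close> and a modulus \<open>q j\<close> restrict the choice of its image.\<close>

definition solves_congruences :: "('a, 'c) monoid_scheme \<Rightarrow> bool" where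
  "solves_congruences A \<longleftrightarrow>
     (\<forall>(m :: nat \<Rightarrow> int) b q. (\<forall>j. b j \<in> carrier A \<and> q j \<noteq> 0)
        \<and> (\<forall>N. \<exists>x \<in> carrier A. \<forall>j\<le>N. b j \<otimes>\<^bsub>A\<^esub> x [^]\<^bsub>A\<^esub> m j \<in> int_multiples A (q j))
        \<longrightarrow> (\<exists>x \<in> carrier A. \<forall>j. b j \<otimes>\<^bsub>A\<^esub> x [^]\<^bsub>A\<^esub> m j \<in> int_multiples A (q j)))"

lemma solves_congruencesD:
  assumes "solves_congruences A" "\<And>j. b j \<in> carrier A" "\<And>j. q j \<noteq> 0"
    "\<And>N. \<exists>x \<in> carrier A. \<forall>j\<le>N. b j \<otimes>\<^bsub>A\<^esub> x [^]\<^bsub>A\<^esub> m j \<in> int_multiples A (q j)"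
  shows "\<exists>x \<in> carrier A. \<forall>j::nat. b j \<otimes>\<^bsub>A\<^esub> x [^]\<^bsub>A\<^esub> (m j :: int) \<in> int_multiples A (q j)"
  using assms unfolding solves_congruences_def by blast

context comm_group
begin

lemma int_multiplesI: "y \<in> carrier G \<Longrightarrow> y [^] (n::int) \<in> int_multiples G n"
  by (simp add: int_multiples_def)

lemma int_multiplesE:
  assumes "x \<in> int_multiples G n" obtains y where "y \<in> carrier G" "x = y [^] (n::int)"
  using assms by (auto simp: int_multiples_def)

lemma int_multiples_closed: "x \<in> int_multiples G n \<Longrightarrow> x \<in> carrier G"
  by (auto simp: int_multiples_def)

lemma int_multiples_0 [simp]: "int_multiples G 0 = {\<one>}"
  by (auto simp: int_multiples_def)

lemma int_multiples_1 [simp]: "int_multiples G 1 = carrier G"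
  by (auto simp: int_multiples_def)

lemma int_multiples_one: "\<one> \<in> int_multiples G n"
  using int_multiplesI[of \<one> n] by simp

lemma int_multiples_mult:
  assumes "x \<in> int_multiples G n" "y \<in> int_multiples G n" shows "x \<otimes> y \<in> int_multiples G n"
proof -
  obtain u v where "u \<in> carrier G" "x = u [^] n" "v \<in> carrier G" "y = v [^] n"
    using assms by (auto simp: int_multiples_def)
  then have "x \<otimes> y = (u \<otimes> v) [^] n" "u \<otimes> v \<in> carrier G" by (simp_all add: int_pow_distrib)
  then show ?thesis using int_multiplesI by metis
qed

lemma int_multiples_pow:
  assumes "x \<in> int_multiples G n" shows "x [^] (m::int) \<in> int_multiples G (n * m)"
  using assms int_pow_pow by (auto simp: int_multiples_def)

lemma int_multiples_dvd: "n dvd m \<Longrightarrow> int_multiples G m \<subseteq> int_multiples G n"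
proof
  fix x assume "n dvd m" "x \<in> int_multiples G m"
  then obtain k y where "m = n * k" "y \<in> carrier G" "x = y [^] m" by (auto simp: int_multiples_def dvd_def)
  then have "x = (y [^] k) [^] n" "y [^] k \<in> carrier G" by (simp_all add: int_pow_pow mult.commute)
  then show "x \<in> int_multiples G n" using int_multiplesI by metis
qed

lemma int_multiples_minus [simp]: "int_multiples G (- n) = int_multiples G n"
  using int_multiples_dvd[of n "-n"] int_multiples_dvd[of "-n" n] by auto

lemma int_multiples_pow': "x \<in> int_multiples G n \<Longrightarrow> x [^] (m::int) \<in> int_multiples G n"
  using int_multiples_pow[of x n m] int_multiples_dvd[of n "n * m"] by auto

lemma int_multiples_inv: "x \<in> int_multiples G n \<Longrightarrow> inv x \<in> int_multiples G n"
  using int_multiples_pow'[of x n "-1"] int_multiples_closed[of x n] by (simp add: int_pow_neg)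

lemma int_multiples_div: 
  assumes "x \<otimes> y \<in> int_multiples G n" "y \<in> int_multiples G n" "x \<in> carrier G"
  shows "x \<in> int_multiples G n"
proof -
  have y: "y \<in> carrier G" using assms int_multiples_closed by blast
  have "x = (x \<otimes> y) \<otimes> inv y" using assms y by (simp add: m_assoc)
  then show ?thesis using int_multiples_mult[OF assms(1) int_multiples_inv[OF assms(2)]] by simp
qed

lemma torsion_free_int_pow:
  assumes "torsion_free_group G" "x \<in> carrier G" "x [^] (n::int) = \<one>" "n \<noteq> 0"
  shows "x = \<one>"
proof -
  have "x [^] nat \<bar>n\<bar> = \<one>"
  proof (cases "n \<ge> 0")
    case True
    then show ?thesis using assms(3) by (metis abs_of_nonneg int_nat_eq int_pow_int)
  next
    case False
    then have "x [^] int (nat \<bar>n\<bar>) = inv (x [^] n)"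
      using int_pow_neg[OF assms(2), of n] by (simp add: abs_of_neg)
    then show ?thesis using assms(3) by (simp add: int_pow_int)
  qed
  moreover have "nat \<bar>n\<bar> \<ge> 1" using assms(4) by simp
  ultimately have "x \<in> torsion_subgroup G"
    using assms(2) unfolding torsion_subgroup_def by blast
  then show ?thesis using assms(1) by (simp add: torsion_free_group_def)
qed

lemma torsion_free_pow_eq:
  assumes "torsion_free_group G" "x \<in> carrier G" "y \<in> carrier G" "x [^] (n::int) = y [^] n" "n \<noteq> 0"
  shows "x = y"
proof -
  have "(x \<otimes> inv y) [^] n = \<one>" using assms by (simp add: int_pow_distrib int_pow_inv)
  then have "x \<otimes> inv y = \<one>" using torsion_free_int_pow[OF assms(1) _ _ assms(5)] assms by simp
  then show ?thesis using assms by (metis inv_closed inv_inv inv_equality)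
qed

text \<open>If \<open>x\<^sup>m = y\<^sup>n\<^sup>m\<close>, then \<open>x = y\<^sup>n\<close>, as roots are unique in the absence of torsion.\<close>

lemma int_multiples_cancel:
  assumes "torsion_free_group G" "x [^] m \<in> int_multiples G (n * m)" "x \<in> carrier G" "m \<noteq> 0"
  shows "x \<in> int_multiples G n"
proof -
  obtain y where y: "y \<in> carrier G" "x [^] m = y [^] (n * m)" using assms(2) by (rule int_multiplesE)
  then have "x [^] m = (y [^] n) [^] m" by (simp add: int_pow_pow)
  then have "x = y [^] n" using torsion_free_pow_eq[OF assms(1,3) _ _ assms(4)] y(1) by simp
  then show ?thesis using y int_multiplesI by simp
qed

end

text \<open>The graph of a homomorphism from a subgroup of \<open>X\<close> to \<open>A\<close> that does not lower divisibility. Taking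
  \<open>n = 0\<close> in the last clause shows that only \<open>\<one>\<close> is related to \<open>\<one>\<close>, so the relation is a function.\<close>

definition height_graph ::
    "('x, 'c) monoid_scheme \<Rightarrow> ('a, 'd) monoid_scheme \<Rightarrow> ('x \<times> 'a) set \<Rightarrow> bool" where
  "height_graph X A \<Gamma> \<longleftrightarrow>
     \<Gamma> \<subseteq> carrier X \<times> carrier A \<and> (\<one>\<^bsub>X\<^esub>, \<one>\<^bsub>A\<^esub>) \<in> \<Gamma>
     \<and> (\<forall>y b y' b'. (y, b) \<in> \<Gamma> \<and> (y', b') \<in> \<Gamma>
          \<longrightarrow> (y \<otimes>\<^bsub>X\<^esub> inv\<^bsub>X\<^esub> y', b \<otimes>\<^bsub>A\<^esub> inv\<^bsub>A\<^esub> b') \<in> \<Gamma>)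
     \<and> (\<forall>y b n. (y, b) \<in> \<Gamma> \<and> y \<in> int_multiples X n \<longrightarrow> b \<in> int_multiples A n)"

locale height_graph_ext = X: comm_group X + A: comm_group A
  for X :: "('x, 'c) monoid_scheme" and A :: "('a, 'd) monoid_scheme" +
  fixes \<Gamma>
  assumes graph: "height_graph X A \<Gamma>" and tf: "torsion_free_group A" and sat: "solves_congruences A"
begin

lemma carr: "(y, b) \<in> \<Gamma> \<Longrightarrow> y \<in> carrier X" "(y, b) \<in> \<Gamma> \<Longrightarrow> b \<in> carrier A"
  and one: "(\<one>\<^bsub>X\<^esub>, \<one>\<^bsub>A\<^esub>) \<in> \<Gamma>"
  and height: "(y, b) \<in> \<Gamma> \<Longrightarrow> y \<in> int_multiples X n \<Longrightarrow> b \<in> int_multiples A n"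
  and diff: "(y, b) \<in> \<Gamma> \<Longrightarrow> (y', b') \<in> \<Gamma> \<Longrightarrow> (y \<otimes>\<^bsub>X\<^esub> inv\<^bsub>X\<^esub> y', b \<otimes>\<^bsub>A\<^esub> inv\<^bsub>A\<^esub> b') \<in> \<Gamma>"
  using graph unfolding height_graph_def by blast+

lemma inv: "(y, b) \<in> \<Gamma> \<Longrightarrow> (inv\<^bsub>X\<^esub> y, inv\<^bsub>A\<^esub> b) \<in> \<Gamma>"
  using diff[OF one] carr by fastforce

lemma mult: "(y, b) \<in> \<Gamma> \<Longrightarrow> (y', b') \<in> \<Gamma> \<Longrightarrow> (y \<otimes>\<^bsub>X\<^esub> y', b \<otimes>\<^bsub>A\<^esub> b') \<in> \<Gamma>"
  using diff[OF _ inv] carr by fastforce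

lemma pow: assumes "(y, b) \<in> \<Gamma>" shows "(y [^]\<^bsub>X\<^esub> (m::int), b [^]\<^bsub>A\<^esub> m) \<in> \<Gamma>"
proof -
  have *: "(y [^]\<^bsub>X\<^esub> int n, b [^]\<^bsub>A\<^esub> int n) \<in> \<Gamma>" for n :: nat
    using mult assms one by (induction n) (simp_all add: int_pow_int del: of_nat_Suc)
  then show ?thesis
  proof (cases m rule: int_cases)
    case (neg n)
    show ?thesis unfolding neg
      using inv[OF *[of "Suc n"]] carr[OF assms] by (simp add: X.int_pow_neg A.int_pow_neg del: of_nat_Suc)
  qed (use * in auto)
qed

text \<open>Modulo a fixed \<open>M\<close>, the exponents \<open>m\<close> with \<open>x\<^sup>m \<in> Y + MX\<close> form a nonzero ideal of the integers, so all
  conditions on the image \<open>a\<close> of \<open>x\<close> follow from the one for its generator \<open>m0\<close>. The element \<open>y0\<close> of \<open>Y\<close>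
  that occurs there is a multiple of \<open>m0\<close> in \<open>X\<close> because \<open>m0\<close> divides \<open>M\<close>; hence so is its image in \<open>A\<close>,
  and this yields \<open>a\<close>.\<close>

lemma extend_by_element_at_level:
  assumes x: "x \<in> carrier X" and "M \<noteq> 0"
  shows "\<exists>a \<in> carrier A. \<forall>y b (m::int). (y, b) \<in> \<Gamma> \<and> y \<otimes>\<^bsub>X\<^esub> x [^]\<^bsub>X\<^esub> m \<in> int_multiples X M
           \<longrightarrow> b \<otimes>\<^bsub>A\<^esub> a [^]\<^bsub>A\<^esub> m \<in> int_multiples A M"
proof -
  define I where "I = {m :: int. \<exists>y b. (y, b) \<in> \<Gamma> \<and> y \<otimes>\<^bsub>X\<^esub> x [^]\<^bsub>X\<^esub> m \<in> int_multiples X M}"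
  have I_abs: "\<bar>M\<bar> \<in> I"
  proof -
    have "x [^]\<^bsub>X\<^esub> \<bar>M\<bar> \<in> int_multiples X M"
      using X.int_multiplesI[OF x, of M] X.int_multiplesI[OF x, of "-M"] by (cases "M \<ge> 0") auto
    then show ?thesis unfolding I_def using one x by fastforce
  qed
  have I_diff: "m - t * m' \<in> I" if m: "m \<in> I" "m' \<in> I" for m m' t
  proof -
    obtain y b y' b' where *: "(y, b) \<in> \<Gamma>" "y \<otimes>\<^bsub>X\<^esub> x [^]\<^bsub>X\<^esub> m \<in> int_multiples X M"
        "(y', b') \<in> \<Gamma>" "y' \<otimes>\<^bsub>X\<^esub> x [^]\<^bsub>X\<^esub> m' \<in> int_multiples X M"
      using m by (auto simp: I_def)
    let ?y = "y \<otimes>\<^bsub>X\<^esub> y' [^]\<^bsub>X\<^esub> (-t)"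
    have c: "y \<in> carrier X" "y' \<in> carrier X" using * carr by auto
    have "(y \<otimes>\<^bsub>X\<^esub> x [^]\<^bsub>X\<^esub> m) \<otimes>\<^bsub>X\<^esub> (y' \<otimes>\<^bsub>X\<^esub> x [^]\<^bsub>X\<^esub> m') [^]\<^bsub>X\<^esub> (-t) \<in> int_multiples X M"
      by (rule X.int_multiples_mult[OF *(2) X.int_multiples_pow'[OF *(4)]])
    also have "(y \<otimes>\<^bsub>X\<^esub> x [^]\<^bsub>X\<^esub> m) \<otimes>\<^bsub>X\<^esub> (y' \<otimes>\<^bsub>X\<^esub> x [^]\<^bsub>X\<^esub> m') [^]\<^bsub>X\<^esub> (-t)
        = (y \<otimes>\<^bsub>X\<^esub> y' [^]\<^bsub>X\<^esub> (-t)) \<otimes>\<^bsub>X\<^esub> (x [^]\<^bsub>X\<^esub> m \<otimes>\<^bsub>X\<^esub> x [^]\<^bsub>X\<^esub> (m' * (-t)))"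
      using c x by (simp add: X.int_pow_distrib X.int_pow_pow X.m_ac)
    also have "\<dots> = ?y \<otimes>\<^bsub>X\<^esub> x [^]\<^bsub>X\<^esub> (m - t * m')"
      using c x by (simp flip: X.int_pow_mult add: mult.commute)
    finally show ?thesis unfolding I_def using mult[OF *(1) pow[OF *(3)]] by blast
  qed
  define m0 where "m0 = int (LEAST n. n > 0 \<and> int n \<in> I)"
  have ex: "\<exists>n. n > 0 \<and> int n \<in> I" using I_abs assms(2) by (intro exI[of _ "nat \<bar>M\<bar>"]) auto
  have m0: "m0 > 0" "m0 \<in> I" using LeastI_ex[OF ex] by (auto simp: m0_def)
  have m0_min: "m0 \<le> m" if "m > 0" "m \<in> I" for m
  proof -
    have "(LEAST n. n > 0 \<and> int n \<in> I) \<le> nat m" by (rule Least_le) (use that in auto)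
    then show ?thesis using that by (simp add: m0_def)
  qed
  have m0_dvd: "m0 dvd m" if "m \<in> I" for m
  proof -
    have "m mod m0 = m - (m div m0) * m0" by (simp add: minus_div_mult_eq_mod)
    then have "m mod m0 \<in> I" using I_diff[OF that m0(2)] by simp
    moreover have "m mod m0 < m0" "m mod m0 \<ge> 0" using m0 by simp_all
    ultimately show ?thesis using m0_min[of "m mod m0"] by (cases "m mod m0 = 0") auto
  qed
  obtain y0 b0 where 0: "(y0, b0) \<in> \<Gamma>" "y0 \<otimes>\<^bsub>X\<^esub> x [^]\<^bsub>X\<^esub> m0 \<in> int_multiples X M"
    using m0(2) by (auto simp: I_def)
  have c0: "y0 \<in> carrier X" "b0 \<in> carrier A" using carr 0 by auto
  obtain l where l: "M = m0 * l" using m0_dvd[OF I_abs] by (auto elim: dvdE)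
  have "y0 \<in> int_multiples X m0"
    by (rule X.int_multiples_div[OF _ X.int_multiplesI[OF x] c0(1)])
       (use 0(2) l X.int_multiples_dvd[of m0 M] in auto)
  then have "b0 \<in> int_multiples A m0" using height 0 by blast
  then obtain a' where a': "a' \<in> carrier A" "b0 = a' [^]\<^bsub>A\<^esub> m0" by (rule A.int_multiplesE)
  let ?a = "inv\<^bsub>A\<^esub> a'"
  have "b \<otimes>\<^bsub>A\<^esub> ?a [^]\<^bsub>A\<^esub> m \<in> int_multiples A M"
    if *: "(y, b) \<in> \<Gamma>" "y \<otimes>\<^bsub>X\<^esub> x [^]\<^bsub>X\<^esub> m \<in> int_multiples X M" for y b and m :: int
  proof -
    have "m \<in> I" using * by (auto simp: I_def)
    then obtain t where t: "m = m0 * t" using m0_dvd by (auto elim: dvdE)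
    have c: "y \<in> carrier X" "b \<in> carrier A" using * carr by auto
    have "(y \<otimes>\<^bsub>X\<^esub> x [^]\<^bsub>X\<^esub> m) \<otimes>\<^bsub>X\<^esub> (y0 \<otimes>\<^bsub>X\<^esub> x [^]\<^bsub>X\<^esub> m0) [^]\<^bsub>X\<^esub> (-t) \<in> int_multiples X M"
      by (rule X.int_multiples_mult[OF *(2) X.int_multiples_pow'[OF 0(2)]])
    also have "(y \<otimes>\<^bsub>X\<^esub> x [^]\<^bsub>X\<^esub> m) \<otimes>\<^bsub>X\<^esub> (y0 \<otimes>\<^bsub>X\<^esub> x [^]\<^bsub>X\<^esub> m0) [^]\<^bsub>X\<^esub> (-t)
        = (y \<otimes>\<^bsub>X\<^esub> y0 [^]\<^bsub>X\<^esub> (-t)) \<otimes>\<^bsub>X\<^esub> (x [^]\<^bsub>X\<^esub> m \<otimes>\<^bsub>X\<^esub> x [^]\<^bsub>X\<^esub> (m0 * (-t)))"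
      using c c0 x by (simp add: X.int_pow_distrib X.int_pow_pow X.m_ac)
    also have "\<dots> = y \<otimes>\<^bsub>X\<^esub> y0 [^]\<^bsub>X\<^esub> (-t)"
      using c c0 x by (simp flip: X.int_pow_mult add: t)
    finally have "b \<otimes>\<^bsub>A\<^esub> b0 [^]\<^bsub>A\<^esub> (-t) \<in> int_multiples A M"
      using height[OF mult[OF *(1) pow[OF 0(1)]]] by blast
    also have "b0 [^]\<^bsub>A\<^esub> (-t) = ?a [^]\<^bsub>A\<^esub> m"
      using a' by (simp add: t A.int_pow_pow A.int_pow_inv A.int_pow_neg)
    finally show ?thesis .
  qed
  then show ?thesis using A.inv_closed[OF a'(1)] by (intro bexI[of _ ?a] allI impI) (elim conjE)
qed

text \<open>If a nonzero multiple of \<open>x\<close> lies in the domain, division by \<open>m0\<close> in the torsion-free \<open>A\<close> dictates the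
  image of \<open>x\<close>, and its heights are right because heights in \<open>A\<close> can be cancelled. Otherwise the image
  has to satisfy one congruence for each pair \<open>(m, n)\<close> with \<open>x\<^sup>m \<in> Y + nX\<close>, since the choice of
  the element of \<open>Y\<close> changes the condition only by a consequence of the height condition on \<open>Y\<close>. These are countably
  many congruences, and finitely many of them follow from the single level given by the product
  of their moduli.\<close>

lemma extend_by_element:
  assumes x: "x \<in> carrier X"
  shows "\<exists>a \<in> carrier A. \<forall>y b (m::int) n. (y, b) \<in> \<Gamma> \<and> y \<otimes>\<^bsub>X\<^esub> x [^]\<^bsub>X\<^esub> m \<in> int_multiples X n
           \<longrightarrow> b \<otimes>\<^bsub>A\<^esub> a [^]\<^bsub>A\<^esub> m \<in> int_multiples A n"
proof (cases "\<exists>y b (m::int). (y, b) \<in> \<Gamma> \<and> m \<noteq> 0 \<and> y \<otimes>\<^bsub>X\<^esub> x [^]\<^bsub>X\<^esub> m = \<one>\<^bsub>X\<^esub>")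
  case True
  then obtain y0 b0 and m0 :: int where 0: "(y0, b0) \<in> \<Gamma>" "m0 \<noteq> 0" "y0 \<otimes>\<^bsub>X\<^esub> x [^]\<^bsub>X\<^esub> m0 = \<one>\<^bsub>X\<^esub>" by blast
  have c0: "y0 \<in> carrier X" "b0 \<in> carrier A" using carr 0 by auto
  have "y0 \<in> int_multiples X m0"
    by (rule X.int_multiples_div[OF _ X.int_multiplesI[OF x] c0(1)])
       (simp add: 0(3) X.int_multiples_one)
  then have "b0 \<in> int_multiples A m0" using height 0 by blast
  then obtain a' where a': "a' \<in> carrier A" "b0 = a' [^]\<^bsub>A\<^esub> m0" by (rule A.int_multiplesE)
  let ?a = "inv\<^bsub>A\<^esub> a'"
  have "b \<otimes>\<^bsub>A\<^esub> ?a [^]\<^bsub>A\<^esub> m \<in> int_multiples A n"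
    if *: "(y, b) \<in> \<Gamma>" "y \<otimes>\<^bsub>X\<^esub> x [^]\<^bsub>X\<^esub> m \<in> int_multiples X n" for y b n and m :: int
  proof -
    have c: "y \<in> carrier X" "b \<in> carrier A" using * carr by auto
    have "(y \<otimes>\<^bsub>X\<^esub> x [^]\<^bsub>X\<^esub> m) [^]\<^bsub>X\<^esub> m0 \<in> int_multiples X (n * m0)"
      by (rule X.int_multiples_pow[OF *(2)])
    also have "(y \<otimes>\<^bsub>X\<^esub> x [^]\<^bsub>X\<^esub> m) [^]\<^bsub>X\<^esub> m0
       = y [^]\<^bsub>X\<^esub> m0 \<otimes>\<^bsub>X\<^esub> (x [^]\<^bsub>X\<^esub> m0) [^]\<^bsub>X\<^esub> m"
      using c x by (simp add: X.int_pow_distrib X.int_pow_pow mult.commute)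
    also have "x [^]\<^bsub>X\<^esub> m0 = inv\<^bsub>X\<^esub> y0"
      using c0 x 0(3) by (metis X.inv_equality X.m_comm X.int_pow_closed)
    also have "(inv\<^bsub>X\<^esub> y0) [^]\<^bsub>X\<^esub> m = y0 [^]\<^bsub>X\<^esub> (-m)"
      using c0 by (simp add: X.int_pow_inv X.int_pow_neg)
    finally have "b [^]\<^bsub>A\<^esub> m0 \<otimes>\<^bsub>A\<^esub> b0 [^]\<^bsub>A\<^esub> (-m) \<in> int_multiples A (n * m0)"
      using height[OF mult[OF pow[OF *(1)] pow[OF 0(1)]]] by blast
    also have "b [^]\<^bsub>A\<^esub> m0 \<otimes>\<^bsub>A\<^esub> b0 [^]\<^bsub>A\<^esub> (-m) = (b \<otimes>\<^bsub>A\<^esub> ?a [^]\<^bsub>A\<^esub> m) [^]\<^bsub>A\<^esub> m0"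
      using a' c by (simp add: A.int_pow_distrib A.int_pow_pow A.int_pow_inv A.int_pow_neg mult.commute)
    finally show ?thesis
      by (rule A.int_multiples_cancel[OF tf]) (use a' c 0 in auto)
  qed
  then show ?thesis using A.inv_closed[OF a'(1)] by (intro bexI[of _ ?a] allI impI) (elim conjE)
next
  case False
  define good where "good = (\<lambda>(mn :: int \<times> int) y b. (y, b) \<in> \<Gamma>
      \<and> y \<otimes>\<^bsub>X\<^esub> x [^]\<^bsub>X\<^esub> fst mn \<in> int_multiples X (snd mn) \<and> snd mn \<noteq> 0)"
  define mn :: "nat \<Rightarrow> int \<times> int" where "mn = from_nat"
  define c where "c = (\<lambda>j. SOME yb. good (mn j) (fst yb) (snd yb))"
  define ok where "ok = (\<lambda>j. \<exists>y b. good (mn j) y b)"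
  have c: "good (mn j) (fst (c j)) (snd (c j))" if "ok j" for j
  proof -
    have "\<exists>yb. good (mn j) (fst yb) (snd yb)" using that by (auto simp: ok_def)
    from someI_ex[OF this] show ?thesis unfolding c_def .
  qed
  \<comment> \<open>a pair \<open>(m, n)\<close> from which no congruence arises is given the trivial one\<close>
  define b where "b = (\<lambda>j. if ok j then snd (c j) else \<one>\<^bsub>A\<^esub>)"
  define m where "m = (\<lambda>j. if ok j then fst (mn j) else 0)"
  define q where "q = (\<lambda>j. if ok j then snd (mn j) else 1)"
  have b_in: "b j \<in> carrier A" and q0: "q j \<noteq> 0" for j
    using c[of j] carr(2)[of "fst (c j)" "snd (c j)"] by (auto simp: b_def q_def good_def)
  have "\<exists>a \<in> carrier A. \<forall>j. b j \<otimes>\<^bsub>A\<^esub> a [^]\<^bsub>A\<^esub> m j \<in> int_multiples A (q j)"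
  proof (rule solves_congruencesD[OF sat b_in q0])
    fix N
    define M where "M = (\<Prod>j\<le>N. q j)"
    have M0: "M \<noteq> 0" using q0 by (simp add: M_def)
    obtain a where a: "a \<in> carrier A"
      "\<And>y b (m :: int). (y, b) \<in> \<Gamma> \<Longrightarrow> y \<otimes>\<^bsub>X\<^esub> x [^]\<^bsub>X\<^esub> m \<in> int_multiples X M
           \<Longrightarrow> b \<otimes>\<^bsub>A\<^esub> a [^]\<^bsub>A\<^esub> m \<in> int_multiples A M"
      using extend_by_element_at_level[OF x M0] by blast
    have "b j \<otimes>\<^bsub>A\<^esub> a [^]\<^bsub>A\<^esub> m j \<in> int_multiples A (q j)" if "j \<le> N" for j
    proof (cases "ok j")
      case True
      have "q j dvd M" unfolding M_def by (rule dvd_prodI) (use that in auto)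
      then obtain l where l: "M = q j * l" by (auto elim: dvdE)
      have l0: "l \<noteq> 0" using M0 l by auto
      define y where "y = fst (c j)"
      have y: "(y, b j) \<in> \<Gamma>" "y \<otimes>\<^bsub>X\<^esub> x [^]\<^bsub>X\<^esub> m j \<in> int_multiples X (q j)"
        using c[OF True] True by (auto simp: good_def y_def b_def m_def q_def)
      have yc: "y \<in> carrier X" using carr y by auto
      have "(y \<otimes>\<^bsub>X\<^esub> x [^]\<^bsub>X\<^esub> m j) [^]\<^bsub>X\<^esub> l \<in> int_multiples X M"
        unfolding l by (rule X.int_multiples_pow[OF y(2)])
      then have "y [^]\<^bsub>X\<^esub> l \<otimes>\<^bsub>X\<^esub> x [^]\<^bsub>X\<^esub> (m j * l) \<in> int_multiples X M"
        using yc x by (simp add: X.int_pow_distrib X.int_pow_pow)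
      then have "b j [^]\<^bsub>A\<^esub> l \<otimes>\<^bsub>A\<^esub> a [^]\<^bsub>A\<^esub> (m j * l) \<in> int_multiples A M"
        using a(2) pow[OF y(1)] by blast
      then have "(b j \<otimes>\<^bsub>A\<^esub> a [^]\<^bsub>A\<^esub> m j) [^]\<^bsub>A\<^esub> l \<in> int_multiples A (q j * l)"
        using a(1) b_in by (simp add: A.int_pow_distrib A.int_pow_pow l)
      then show ?thesis by (rule A.int_multiples_cancel[OF tf]) (use a b_in l0 in auto)
    qed (use a in \<open>simp add: b_def m_def q_def\<close>)
    then show "\<exists>x\<in>carrier A. \<forall>j\<le>N. b j \<otimes>\<^bsub>A\<^esub> x [^]\<^bsub>A\<^esub> m j \<in> int_multiples A (q j)"
      using a(1) by blast
  qed
  then obtain a where a: "a \<in> carrier A"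
    "\<And>j. b j \<otimes>\<^bsub>A\<^esub> a [^]\<^bsub>A\<^esub> m j \<in> int_multiples A (q j)" by blast
  have "b' \<otimes>\<^bsub>A\<^esub> a [^]\<^bsub>A\<^esub> m' \<in> int_multiples A n"
    if *: "(y', b') \<in> \<Gamma>" "y' \<otimes>\<^bsub>X\<^esub> x [^]\<^bsub>X\<^esub> m' \<in> int_multiples X n" for y' b' n and m' :: int
  proof (cases "n = 0")
    case True
    then have y: "y' \<otimes>\<^bsub>X\<^esub> x [^]\<^bsub>X\<^esub> m' = \<one>\<^bsub>X\<^esub>" using *(2) by simp
    with False *(1) have "m' = 0" by blast
    then show ?thesis using height[OF *(1), of n] * carr[OF *(1)] True by simp
  next
    case n: False
    obtain j where j: "mn j = (m', n)" unfolding mn_def by (metis from_nat_to_nat)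
    have ok: "ok j" unfolding ok_def using * n j by (auto simp: good_def)
    define y where "y = fst (c j)"
    have y: "(y, b j) \<in> \<Gamma>" "y \<otimes>\<^bsub>X\<^esub> x [^]\<^bsub>X\<^esub> m' \<in> int_multiples X n" and mq: "m j = m'" "q j = n"
      using c[OF ok] ok j by (auto simp: good_def y_def b_def m_def q_def)
    have cc: "y \<in> carrier X" "y' \<in> carrier X" "b' \<in> carrier A" using carr y * by auto
    have "(y' \<otimes>\<^bsub>X\<^esub> x [^]\<^bsub>X\<^esub> m') \<otimes>\<^bsub>X\<^esub> inv\<^bsub>X\<^esub> (y \<otimes>\<^bsub>X\<^esub> x [^]\<^bsub>X\<^esub> m') \<in> int_multiples X n"
      by (rule X.int_multiples_mult[OF *(2) X.int_multiples_inv[OF y(2)]])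
    also have "(y' \<otimes>\<^bsub>X\<^esub> x [^]\<^bsub>X\<^esub> m') \<otimes>\<^bsub>X\<^esub> inv\<^bsub>X\<^esub> (y \<otimes>\<^bsub>X\<^esub> x [^]\<^bsub>X\<^esub> m')
       = (y' \<otimes>\<^bsub>X\<^esub> inv\<^bsub>X\<^esub> y) \<otimes>\<^bsub>X\<^esub> (x [^]\<^bsub>X\<^esub> m' \<otimes>\<^bsub>X\<^esub> inv\<^bsub>X\<^esub> (x [^]\<^bsub>X\<^esub> m'))"
      using cc x by (simp add: X.inv_mult X.m_ac del: X.r_inv X.l_inv)
    also have "\<dots> = y' \<otimes>\<^bsub>X\<^esub> inv\<^bsub>X\<^esub> y" using cc x by simp
    finally have d: "b' \<otimes>\<^bsub>A\<^esub> inv\<^bsub>A\<^esub> b j \<in> int_multiples A n"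
      using height[OF diff[OF *(1) y(1)]] by blast
    have "(b' \<otimes>\<^bsub>A\<^esub> inv\<^bsub>A\<^esub> b j) \<otimes>\<^bsub>A\<^esub> (b j \<otimes>\<^bsub>A\<^esub> a [^]\<^bsub>A\<^esub> m') \<in> int_multiples A n"
      by (rule A.int_multiples_mult[OF d]) (use a(2)[of j] mq in simp)
    also have "(b' \<otimes>\<^bsub>A\<^esub> inv\<^bsub>A\<^esub> b j) \<otimes>\<^bsub>A\<^esub> (b j \<otimes>\<^bsub>A\<^esub> a [^]\<^bsub>A\<^esub> m')
        = b' \<otimes>\<^bsub>A\<^esub> (inv\<^bsub>A\<^esub> b j \<otimes>\<^bsub>A\<^esub> (b j \<otimes>\<^bsub>A\<^esub> a [^]\<^bsub>A\<^esub> m'))"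
      using cc a(1) b_in by (simp add: A.m_assoc)
    also have "inv\<^bsub>A\<^esub> b j \<otimes>\<^bsub>A\<^esub> (b j \<otimes>\<^bsub>A\<^esub> a [^]\<^bsub>A\<^esub> m') = a [^]\<^bsub>A\<^esub> m'"
      using a(1) b_in by (simp flip: A.m_assoc)
    finally show ?thesis .
  qed
  then show ?thesis using a(1) by blast
qed

end

text \<open>A maximal height graph is total by \<open>extend_by_element\<close>, and Zorn's lemma provides one.\<close>

theorem extend_height_graph:
  assumes X: "comm_group X" and A: "comm_group A"
    and tf: "torsion_free_group A" and sat: "solves_congruences A" and graph: "height_graph X A \<Gamma>"
  shows "\<exists>h \<in> hom X A. \<forall>(y, b) \<in> \<Gamma>. h y = b"
proof -
  interpret X: comm_group X by fact
  interpret A: comm_group A by fact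
  define \<G> where "\<G> = {\<Delta>. height_graph X A \<Delta> \<and> \<Gamma> \<subseteq> \<Delta>}"
  have "\<exists>M\<in>\<G>. \<forall>\<Delta>\<in>\<G>. M \<subseteq> \<Delta> \<longrightarrow> \<Delta> = M"
  proof (rule subset_Zorn_nonempty)
    show "\<G> \<noteq> {}" using graph by (auto simp: \<G>_def)
    fix \<C> assume C: "\<C> \<noteq> {}" "subset.chain \<G> \<C>"
    then have hg: "height_graph X A \<Delta>" "\<Gamma> \<subseteq> \<Delta>" if "\<Delta> \<in> \<C>" for \<Delta>
      using that unfolding subset_chain_def \<G>_def by auto
    have common: "\<exists>\<Delta>\<in>\<C>. u \<in> \<Delta> \<and> v \<in> \<Delta>" if uv: "u \<in> \<Union>\<C>" "v \<in> \<Union>\<C>" for u v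
    proof -
      obtain D E where DE: "D \<in> \<C>" "E \<in> \<C>" "u \<in> D" "v \<in> E" using uv by auto
      then have "D \<subseteq> E \<or> E \<subseteq> D" using C(2) unfolding subset_chain_def by blast
      then show ?thesis using DE by auto
    qed
    have "height_graph X A (\<Union>\<C>)"
      unfolding height_graph_def
    proof (intro conjI allI impI)
      show "\<Union>\<C> \<subseteq> carrier X \<times> carrier A"
        using hg(1) unfolding height_graph_def by (meson Union_least)
      obtain \<Delta> where D: "\<Delta> \<in> \<C>" using C(1) by auto
      then have "(\<one>\<^bsub>X\<^esub>, \<one>\<^bsub>A\<^esub>) \<in> \<Delta>" using hg(1) unfolding height_graph_def by simp
      then show "(\<one>\<^bsub>X\<^esub>, \<one>\<^bsub>A\<^esub>) \<in> \<Union>\<C>" using D by auto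
    next
      fix y b y' b' assume *: "(y, b) \<in> \<Union>\<C> \<and> (y', b') \<in> \<Union>\<C>"
      then obtain \<Delta> where D: "\<Delta> \<in> \<C>" "(y, b) \<in> \<Delta>" "(y', b') \<in> \<Delta>" using common by meson
      then have "(y \<otimes>\<^bsub>X\<^esub> inv\<^bsub>X\<^esub> y', b \<otimes>\<^bsub>A\<^esub> inv\<^bsub>A\<^esub> b') \<in> \<Delta>"
        using hg(1)[OF D(1)] unfolding height_graph_def by simp
      then show "(y \<otimes>\<^bsub>X\<^esub> inv\<^bsub>X\<^esub> y', b \<otimes>\<^bsub>A\<^esub> inv\<^bsub>A\<^esub> b') \<in> \<Union>\<C>" using D by auto
    next
      fix y b n assume *: "(y, b) \<in> \<Union>\<C> \<and> y \<in> int_multiples X n"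
      then obtain \<Delta> where D: "\<Delta> \<in> \<C>" "(y, b) \<in> \<Delta>" by auto
      then show "b \<in> int_multiples A n"
        using hg(1)[OF D(1)] * unfolding height_graph_def by meson
    qed
    then show "\<Union>\<C> \<in> \<G>" using hg(2) C(1) by (auto simp: \<G>_def)
  qed
  then obtain M where MG: "M \<in> \<G>" and M_max: "\<forall>\<Delta>\<in>\<G>. M \<subseteq> \<Delta> \<longrightarrow> \<Delta> = M" ..
  have M: "height_graph X A M" "\<Gamma> \<subseteq> M" using MG by (simp_all add: \<G>_def)
  have max: "\<Delta> = M" if "height_graph X A \<Delta>" "M \<subseteq> \<Delta>" for \<Delta>
    using M_max that M(2) by (simp add: \<G>_def)
  interpret M: height_graph_ext X A M by unfold_locales (use M tf sat in auto)
  have total: "\<exists>a. (x, a) \<in> M" if x: "x \<in> carrier X" for x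
  proof -
    obtain a where a: "a \<in> carrier A" "\<And>y b (m::int) n. (y, b) \<in> M \<Longrightarrow>
        y \<otimes>\<^bsub>X\<^esub> x [^]\<^bsub>X\<^esub> m \<in> int_multiples X n \<Longrightarrow> b \<otimes>\<^bsub>A\<^esub> a [^]\<^bsub>A\<^esub> m \<in> int_multiples A n"
      using M.extend_by_element[OF x] by blast
    define \<Delta> where "\<Delta> = {(y \<otimes>\<^bsub>X\<^esub> x [^]\<^bsub>X\<^esub> m, b \<otimes>\<^bsub>A\<^esub> a [^]\<^bsub>A\<^esub> m) | y b (m::int). (y, b) \<in> M}"
    have \<Delta>I: "(y \<otimes>\<^bsub>X\<^esub> x [^]\<^bsub>X\<^esub> m, b \<otimes>\<^bsub>A\<^esub> a [^]\<^bsub>A\<^esub> m) \<in> \<Delta>" if "(y, b) \<in> M" for y b and m :: int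
      using that unfolding \<Delta>_def by blast
    have \<Delta>E: "\<exists>y b (m::int). (y, b) \<in> M \<and> u = y \<otimes>\<^bsub>X\<^esub> x [^]\<^bsub>X\<^esub> m \<and> v = b \<otimes>\<^bsub>A\<^esub> a [^]\<^bsub>A\<^esub> m"
      if "(u, v) \<in> \<Delta>" for u v using that unfolding \<Delta>_def by blast
    have sub: "M \<subseteq> \<Delta>"
    proof
      fix z assume "z \<in> M"
      then show "z \<in> \<Delta>" using \<Delta>I[of "fst z" "snd z" 0] M.carr[of "fst z" "snd z"] by simp
    qed
    have "height_graph X A \<Delta>"
      unfolding height_graph_def
    proof (intro conjI allI impI)
      show "\<Delta> \<subseteq> carrier X \<times> carrier A"
        using x a(1) M.carr unfolding \<Delta>_def by auto
      show "(\<one>\<^bsub>X\<^esub>, \<one>\<^bsub>A\<^esub>) \<in> \<Delta>" using sub M.one by auto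
    next
      fix u v u' v' assume *: "(u, v) \<in> \<Delta> \<and> (u', v') \<in> \<Delta>"
      obtain y b and m :: int where 1: "(y, b) \<in> M" "u = y \<otimes>\<^bsub>X\<^esub> x [^]\<^bsub>X\<^esub> m" "v = b \<otimes>\<^bsub>A\<^esub> a [^]\<^bsub>A\<^esub> m"
        using \<Delta>E * by meson
      obtain y' b' and m' :: int where 2: "(y', b') \<in> M" "u' = y' \<otimes>\<^bsub>X\<^esub> x [^]\<^bsub>X\<^esub> m'" "v' = b' \<otimes>\<^bsub>A\<^esub> a [^]\<^bsub>A\<^esub> m'"
        using \<Delta>E * by meson
      have c: "y \<in> carrier X" "y' \<in> carrier X" "b \<in> carrier A" "b' \<in> carrier A"
        using 1 2 M.carr by auto
      have "u \<otimes>\<^bsub>X\<^esub> inv\<^bsub>X\<^esub> u' = (y \<otimes>\<^bsub>X\<^esub> inv\<^bsub>X\<^esub> y') \<otimes>\<^bsub>X\<^esub> x [^]\<^bsub>X\<^esub> (m - m')"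
        using c x 1 2 by (simp add: X.int_pow_diff X.inv_mult X.m_ac)
      moreover have "v \<otimes>\<^bsub>A\<^esub> inv\<^bsub>A\<^esub> v' = (b \<otimes>\<^bsub>A\<^esub> inv\<^bsub>A\<^esub> b') \<otimes>\<^bsub>A\<^esub> a [^]\<^bsub>A\<^esub> (m - m')"
        using c a(1) 1 2 by (simp add: A.int_pow_diff A.inv_mult A.m_ac)
      ultimately show "(u \<otimes>\<^bsub>X\<^esub> inv\<^bsub>X\<^esub> u', v \<otimes>\<^bsub>A\<^esub> inv\<^bsub>A\<^esub> v') \<in> \<Delta>"
        using \<Delta>I[OF M.diff[OF 1(1) 2(1)]] by simp
    next
      fix u v n assume *: "(u, v) \<in> \<Delta> \<and> u \<in> int_multiples X n"
      obtain y b and m :: int where 1: "(y, b) \<in> M" "u = y \<otimes>\<^bsub>X\<^esub> x [^]\<^bsub>X\<^esub> m" "v = b \<otimes>\<^bsub>A\<^esub> a [^]\<^bsub>A\<^esub> m"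
        using \<Delta>E * by meson
      then show "v \<in> int_multiples A n" using a(2)[OF 1(1)] * by simp
    qed
    then have "\<Delta> = M" using max sub by blast
    moreover have "(x, a) \<in> \<Delta>" using \<Delta>I[OF M.one, of 1] x a(1) by simp
    ultimately show ?thesis by blast
  qed
  have unique: "a = a'" if a: "(x, a) \<in> M" "(x, a') \<in> M" for x a a'
  proof -
    have c: "x \<in> carrier X" "a \<in> carrier A" "a' \<in> carrier A" using a M.carr by auto
    have "a \<otimes>\<^bsub>A\<^esub> inv\<^bsub>A\<^esub> a' \<in> int_multiples A 0"
      by (rule M.height[OF M.diff[OF a]]) (simp add: c)
    then show ?thesis using c by (metis A.inv_equality A.inv_inv A.int_multiples_0 A.inv_closed singletonD)
  qed
  define h where "h x = (THE a. (x, a) \<in> M)" for x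
  have h_eq: "h x = a" if "(x, a) \<in> M" for x a
    unfolding h_def using that unique by blast
  have h: "(x, h x) \<in> M" if "x \<in> carrier X" for x
    using total[OF that] h_eq by auto
  have "h \<in> hom X A"
    using M.carr(2)[OF h] h_eq[OF M.mult[OF h h]] by (intro homI) auto
  moreover have "\<forall>(y, b) \<in> \<Gamma>. h y = b" using M(2) h_eq by auto
  ultimately show ?thesis by blast
qed


section \<open>Integral combinations and independence modulo n\<close>

text \<open>The group is written multiplicatively, so this is the integral combination of the \<open>x i\<close> with
  coefficients \<open>c i\<close>. If infinitely many of them are nonzero, the value is the default \<open>\<one>\<close>.\<close>

definition int_comb :: "('a, 'c) monoid_scheme \<Rightarrow> ('i \<Rightarrow> 'a) \<Rightarrow> ('i \<Rightarrow> int) \<Rightarrow> 'a" where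
  "int_comb G x c = finprod G (\<lambda>i. x i [^]\<^bsub>G\<^esub> c i) {i. c i \<noteq> 0}"

text \<open>For \<open>n = 0\<close> this is linear independence over the integers; for prime \<open>n\<close> it is linear independence of
  the images in the vector space \<open>G/nG\<close>.\<close>

definition independent_mod :: "('a, 'c) monoid_scheme \<Rightarrow> int \<Rightarrow> ('i \<Rightarrow> 'a) \<Rightarrow> 'i set \<Rightarrow> bool" where
  "independent_mod G n x I \<longleftrightarrow> x \<in> I \<rightarrow> carrier G
     \<and> (\<forall>c. finite {i. c i \<noteq> 0} \<and> {i. c i \<noteq> 0} \<subseteq> I \<and> int_comb G x c \<in> int_multiples G n
           \<longrightarrow> (\<forall>i. n dvd c i))"

definition spans_mod :: "('a, 'c) monoid_scheme \<Rightarrow> int \<Rightarrow> ('i \<Rightarrow> 'a) \<Rightarrow> bool" where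
  "spans_mod G n x \<longleftrightarrow> (\<forall>v \<in> carrier G. \<exists>c. finite {i. c i \<noteq> 0}
     \<and> v \<otimes>\<^bsub>G\<^esub> int_comb G x c \<in> int_multiples G n)"

lemma independent_modD:
  assumes "independent_mod G n x I" "finite {i. c i \<noteq> 0}" "{i. c i \<noteq> 0} \<subseteq> I"
    "int_comb G x c \<in> int_multiples G n"
  shows "n dvd c i"
  using assms unfolding independent_mod_def by blast

context comm_group
begin

lemma finprod_pow:
  assumes "f \<in> F \<rightarrow> carrier G"
  shows "finprod G f F [^] (n::int) = finprod G (\<lambda>i. f i [^] n) F"
  using assms
proof (induction F rule: infinite_finite_induct)
  case (insert a F)
  then have "f a \<in> carrier G" "f \<in> F \<rightarrow> carrier G" by auto
  with insert show ?case by (simp add: int_pow_distrib Pi_iff)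
qed auto

lemma finprod_int_multiples:
  assumes "\<And>i. i \<in> F \<Longrightarrow> f i \<in> int_multiples G n"
  shows "finprod G f F \<in> int_multiples G n"
  using assms
proof (induction F rule: infinite_finite_induct)
  case (insert a F)
  have "f a \<in> carrier G" "f \<in> F \<rightarrow> carrier G" using insert int_multiples_closed by auto
  with insert show ?case by (simp add: int_multiples_mult)
qed (auto simp: int_multiples_one)

lemma hom_finprod:
  assumes h: "h \<in> hom G H" and H: "comm_group H" and f: "f \<in> F \<rightarrow> carrier G"
  shows "h (finprod G f F) = finprod H (\<lambda>i. h (f i)) F"
proof -
  interpret H: comm_group H by fact
  have c: "h x \<in> carrier H" if "x \<in> carrier G" for x using h that by (auto simp: hom_def)
  have 1: "h \<one> = \<one>\<^bsub>H\<^esub>" using hom_one[OF h] by (simp add: H.is_group)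
  show ?thesis using f
  proof (induction F rule: infinite_finite_induct)
    case (insert a F)
    then have "f a \<in> carrier G" "f \<in> F \<rightarrow> carrier G" by auto
    with insert show ?case using c hom_mult[OF h] by (simp add: Pi_iff)
  qed (auto simp: 1)
qed

lemma int_comb_superset:
  assumes "finite F" "{i. c i \<noteq> 0} \<subseteq> F" "x \<in> F \<rightarrow> carrier G"
  shows "int_comb G x c = finprod G (\<lambda>i. x i [^] c i) F"
  unfolding int_comb_def
  by (rule finprod_mono_neutral_cong_left) (use assms in \<open>auto intro!: int_pow_closed\<close>)

lemma int_comb_closed: "x \<in> {i. c i \<noteq> 0} \<rightarrow> carrier G \<Longrightarrow> int_comb G x c \<in> carrier G"
  unfolding int_comb_def by (intro finprod_closed) (auto intro!: int_pow_closed)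

lemma int_comb_zero [simp]: "int_comb G x (\<lambda>i. 0) = \<one>"
  by (simp add: int_comb_def)

lemma int_comb_add:
  assumes "finite {i. c i \<noteq> 0}" "finite {i. d i \<noteq> 0}" "x \<in> {i. c i \<noteq> 0} \<union> {i. d i \<noteq> 0} \<rightarrow> carrier G"
  shows "int_comb G x (\<lambda>i. c i + d i) = int_comb G x c \<otimes> int_comb G x d"
proof -
  let ?F = "{i. c i \<noteq> 0} \<union> {i. d i \<noteq> 0}"
  have F: "finite ?F" using assms by simp
  have xc: "x i \<in> carrier G" if "c i \<noteq> 0 \<or> d i \<noteq> 0" for i
    using assms(3) that by (auto dest: funcset_mem)
  have "int_comb G x (\<lambda>i. c i + d i) = finprod G (\<lambda>i. x i [^] (c i + d i)) ?F"
    by (rule int_comb_superset[OF F]) (use xc in auto)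
  also have "\<dots> = finprod G (\<lambda>i. x i [^] c i \<otimes> x i [^] d i) ?F"
    by (rule finprod_cong') (use xc in \<open>auto simp: int_pow_mult\<close>)
  also have "\<dots> = finprod G (\<lambda>i. x i [^] c i) ?F \<otimes> finprod G (\<lambda>i. x i [^] d i) ?F"
    using xc by (intro finprod_multf) auto
  also have "\<dots> = int_comb G x c \<otimes> int_comb G x d"
    using assms(3) by (simp add: int_comb_superset[OF F])
  finally show ?thesis .
qed

lemma int_comb_scale:
  assumes "finite {i. c i \<noteq> 0}" "x \<in> {i. c i \<noteq> 0} \<rightarrow> carrier G"
  shows "int_comb G x (\<lambda>i. c i * n) = int_comb G x c [^] n"
proof -
  have xc: "x i \<in> carrier G" if "c i \<noteq> 0" for i
    using assms(2) that by (auto dest: funcset_mem)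
  have "int_comb G x (\<lambda>i. c i * n) = finprod G (\<lambda>i. x i [^] (c i * n)) {i. c i \<noteq> 0}"
    by (rule int_comb_superset) (use assms in auto)
  also have "\<dots> = finprod G (\<lambda>i. (x i [^] c i) [^] n) {i. c i \<noteq> 0}"
    by (intro finprod_cong') (use xc in \<open>auto simp: int_pow_pow\<close>)
  also have "\<dots> = int_comb G x c [^] n"
    unfolding int_comb_def by (rule finprod_pow[symmetric]) (use assms in auto)
  finally show ?thesis .
qed

lemma int_comb_diff:
  assumes "finite {i. c i \<noteq> 0}" "finite {i. d i \<noteq> 0}" "range x \<subseteq> carrier G"
  shows "int_comb G x (\<lambda>i. c i - d i) = int_comb G x c \<otimes> inv (int_comb G x d)"
proof -
  have x: "x \<in> F \<rightarrow> carrier G" for F using assms(3) by auto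
  have "{i. d i * - 1 \<noteq> 0} = {i. d i \<noteq> 0}" by auto
  then have "int_comb G x (\<lambda>i. c i + d i * - 1) = int_comb G x c \<otimes> int_comb G x d [^] (- 1 :: int)"
    using assms by (subst int_comb_add) (auto simp: int_comb_scale[of d x "-1", OF _ x] x simp del: mult_minus_right mult_minus1_right)
  then show ?thesis using int_comb_closed[OF x] by (simp add: int_pow_neg)
qed

lemma int_comb_dvd:
  assumes "\<And>i. n dvd c i" "range x \<subseteq> carrier G"
  shows "int_comb G x c \<in> int_multiples G n"
  unfolding int_comb_def
proof (rule finprod_int_multiples)
  fix i
  have "x i \<in> carrier G" using assms(2) by auto
  then show "x i [^] c i \<in> int_multiples G n"
    using int_multiplesI int_multiples_dvd assms(1) by blast
qed

lemma int_comb_reindex: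
  assumes "finite {i. d i \<noteq> 0}" "{i. d i \<noteq> 0} \<subseteq> x ` I" "inj_on x I" "x ` I \<subseteq> carrier G"
  shows "int_comb G x (\<lambda>i. if i \<in> I then d (x i) else 0) = int_comb G (\<lambda>b. b) d"
proof -
  let ?F = "{i \<in> I. d (x i) \<noteq> 0}"
  have im: "{b. d b \<noteq> 0} = x ` ?F" using assms(2) by auto
  have "int_comb G (\<lambda>b. b) d = finprod G (\<lambda>b. b [^] d b) (x ` ?F)"
    unfolding int_comb_def im[symmetric] ..
  also have "\<dots> = finprod G (\<lambda>i. x i [^] d (x i)) ?F"
    by (rule finprod_reindex) (use assms in \<open>auto intro: inj_on_subset\<close>)
  also have "\<dots> = int_comb G x (\<lambda>i. if i \<in> I then d (x i) else 0)"
    unfolding int_comb_def by (rule finprod_cong') (use assms(4) in auto)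
  finally show ?thesis by simp
qed

text \<open>Families are convenient for comparing two groups, sets for Zorn's lemma.\<close>

lemma independent_mod_image_iff:
  assumes "inj_on x I" 
  shows "independent_mod G n (\<lambda>b. b) (x ` I) \<longleftrightarrow> independent_mod G n x I"
proof
  assume L: "independent_mod G n (\<lambda>b. b) (x ` I)"
  then have sub: "x ` I \<subseteq> carrier G" by (auto simp: independent_mod_def)
  show "independent_mod G n x I"
    unfolding independent_mod_def
  proof (intro conjI allI impI; (elim conjE)?)
    show "x \<in> I \<rightarrow> carrier G" using sub by auto
    fix c i assume c: "finite {i. c i \<noteq> 0}" "{i. c i \<noteq> 0} \<subseteq> I" "int_comb G x c \<in> int_multiples G n"
    define d where "d b = (if b \<in> x ` I then c (inv_into I x b) else 0)" for b
    have dx: "(if i \<in> I then d (x i) else 0) = c i" for i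
      using assms c(2) by (auto simp: d_def)
    have supp: "{b. d b \<noteq> 0} \<subseteq> x ` {i. c i \<noteq> 0}"
    proof
      fix b assume "b \<in> {b. d b \<noteq> 0}"
      then have "b \<in> x ` I" "c (inv_into I x b) \<noteq> 0" by (auto simp: d_def split: if_splits)
      then show "b \<in> x ` {i. c i \<noteq> 0}" by (metis (mono_tags, lifting) f_inv_into_f image_eqI mem_Collect_eq)
    qed
    have fin: "finite {b. d b \<noteq> 0}" using supp c(1) finite_surj by blast
    have supp': "{b. d b \<noteq> 0} \<subseteq> x ` I" using supp c(2) by blast
    have "int_comb G (\<lambda>b. b) d = int_comb G x c"
      using int_comb_reindex[OF fin supp' assms sub] dx by simp
    then have *: "n dvd d b" for b using independent_modD[OF L fin supp'] c(3) by simp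
    show "n dvd c i" using *[of "x i"] dx[of i] by (metis dvd_0_right)
  qed
next
  assume R: "independent_mod G n x I"
  then have sub: "x ` I \<subseteq> carrier G" by (auto simp: independent_mod_def)
  show "independent_mod G n (\<lambda>b. b) (x ` I)"
    unfolding independent_mod_def
  proof (intro conjI allI impI; (elim conjE)?)
    show "(\<lambda>b. b) \<in> x ` I \<rightarrow> carrier G" using sub by auto
    fix d b assume d: "finite {b. d b \<noteq> 0}" "{b. d b \<noteq> 0} \<subseteq> x ` I"
      "int_comb G (\<lambda>b. b) d \<in> int_multiples G n"
    let ?c = "\<lambda>i. if i \<in> I then d (x i) else 0"
    have "{i. ?c i \<noteq> 0} = x -` {b. d b \<noteq> 0} \<inter> I" by auto
    then have fin: "finite {i. ?c i \<noteq> 0}" using finite_vimage_IntI[OF d(1) assms] by simp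
    have *: "n dvd ?c i" for i
      by (rule independent_modD[OF R fin])
         (use d int_comb_reindex[OF d(1,2) assms sub] in \<open>auto split: if_splits\<close>)
    show "n dvd d b"
    proof (cases "d b = 0")
      case False
      then obtain i where "i \<in> I" "b = x i" using d(2) by auto
      then show ?thesis using *[of i] by simp
    qed simp
  qed
qed

text \<open>By maximality, adding any further \<open>v \<in> V\<close> to the family creates a relation whose coefficient at \<open>v\<close> is not
  divisible by \<open>n\<close>. This treats the torsion-free case \<open>n = 0\<close> and the case of prime \<open>n\<close> alike.\<close>

lemma exists_maximal_independent:
  assumes B0: "independent_mod G n (\<lambda>b. b) B0" "B0 \<subseteq> V" and V: "V \<subseteq> carrier G" and n1: "\<not> is_unit n"
  shows "\<exists>B. B0 \<subseteq> B \<and> B \<subseteq> V \<and> independent_mod G n (\<lambda>b. b) B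
     \<and> (\<forall>v\<in>V. \<exists>e c. \<not> n dvd e \<and> finite {b. c b \<noteq> 0} \<and> {b. c b \<noteq> 0} \<subseteq> B
           \<and> v [^] e \<otimes> int_comb G (\<lambda>b. b) c \<in> int_multiples G n)"
proof -
  let ?ind = "independent_mod G n (\<lambda>b. b)"
  define \<G> where "\<G> = {B. ?ind B \<and> B0 \<subseteq> B \<and> B \<subseteq> V}"
  have "\<exists>M\<in>\<G>. \<forall>\<Delta>\<in>\<G>. M \<subseteq> \<Delta> \<longrightarrow> \<Delta> = M"
  proof (rule subset_Zorn_nonempty)
    show "\<G> \<noteq> {}" using B0 by (auto simp: \<G>_def)
    fix \<C> assume C: "\<C> \<noteq> {}" "subset.chain \<G> \<C>"
    then have hg: "?ind B" "B0 \<subseteq> B" "B \<subseteq> V" if "B \<in> \<C>" for B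
      using that unfolding subset_chain_def \<G>_def by auto
    have "?ind (\<Union>\<C>)"
      unfolding independent_mod_def
    proof (intro conjI allI impI; (elim conjE)?)
      show "(\<lambda>b. b) \<in> \<Union>\<C> \<rightarrow> carrier G" using hg(3) V by auto
      fix c b assume c: "finite {i. c i \<noteq> 0}" "{i. c i \<noteq> 0} \<subseteq> \<Union>\<C>"
        "int_comb G (\<lambda>b. b) c \<in> int_multiples G n"
      obtain B where B: "B \<in> \<C>" "{i. c i \<noteq> 0} \<subseteq> B"
        using finite_subset_Union_chain[OF c(1,2) C] by blast
      show "n dvd c b" by (rule independent_modD[OF hg(1)[OF B(1)] c(1) B(2) c(3)])
    qed
    then show "\<Union>\<C> \<in> \<G>" using hg(2,3) C(1) by (auto simp: \<G>_def)
  qed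
  then obtain B where BG: "B \<in> \<G>" and max: "\<forall>\<Delta>\<in>\<G>. B \<subseteq> \<Delta> \<longrightarrow> \<Delta> = B" ..
  then have B: "?ind B" "B0 \<subseteq> B" "B \<subseteq> V" by (simp_all add: \<G>_def)
  have "\<exists>e c. \<not> n dvd e \<and> finite {b. c b \<noteq> 0} \<and> {b. c b \<noteq> 0} \<subseteq> B
           \<and> v [^] e \<otimes> int_comb G (\<lambda>b. b) c \<in> int_multiples G n" if v: "v \<in> V" for v
  proof (cases "v \<in> B")
    case True
    let ?c = "\<lambda>b. if b = v then -1 else 0 :: int"
    have supp: "{b. ?c b \<noteq> 0} = {v}" by auto
    have vc: "v \<in> carrier G" using v V by auto
    have "v [^] (1::int) \<otimes> int_comb G (\<lambda>b. b) ?c = \<one>"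
      using vc unfolding int_comb_def supp by (simp add: int_pow_neg)
    then show ?thesis using True supp n1 int_multiples_one
      by (intro exI[of _ 1] exI[of _ ?c]) simp
  next
    case False
    have vc: "v \<in> carrier G" using v V by auto
    have "\<not> ?ind (insert v B)"
    proof
      assume "?ind (insert v B)"
      then have "insert v B \<in> \<G>" using B v by (auto simp: \<G>_def)
      then have "insert v B = B" using max by blast
      then show False using False by blast
    qed
    then obtain c b where c: "finite {i. c i \<noteq> 0}" "{i. c i \<noteq> 0} \<subseteq> insert v B"
        "int_comb G (\<lambda>b. b) c \<in> int_multiples G n" "\<not> n dvd c b"
      unfolding independent_mod_def using B(3) v V by auto
    let ?c = "\<lambda>i. if i = v then 0 else c i" and ?v = "\<lambda>i. if i = v then c v else 0"
    have fin: "finite {i. ?c i \<noteq> 0}" "finite {i. ?v i \<noteq> 0}" 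
      by (auto intro: finite_subset[OF _ c(1)])
    have supp: "{i. ?c i \<noteq> 0} \<subseteq> B" using c(2) by auto
    have "c = (\<lambda>i. ?v i + ?c i)" by auto
    then have "int_comb G (\<lambda>b. b) c = int_comb G (\<lambda>b. b) ?v \<otimes> int_comb G (\<lambda>b. b) ?c"
    proof (rule ssubst[of c _ "\<lambda>z. int_comb G (\<lambda>b. b) z = _"])
      show "int_comb G (\<lambda>b. b) (\<lambda>i. ?v i + ?c i) = int_comb G (\<lambda>b. b) ?v \<otimes> int_comb G (\<lambda>b. b) ?c"
        by (rule int_comb_add[OF fin(2,1)]) (use vc supp B(3) V in \<open>auto split: if_splits\<close>)
    qed
    moreover have "int_comb G (\<lambda>b. b) ?v = v [^] c v"
      by (subst int_comb_superset[of "{v}"]) (use vc in auto)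
    ultimately have eq: "v [^] c v \<otimes> int_comb G (\<lambda>b. b) ?c \<in> int_multiples G n" using c(3) by simp
    have cc: "int_comb G (\<lambda>b. b) ?c \<in> carrier G" 
      by (rule int_comb_closed) (use supp B(3) V in blast)
    have "\<not> n dvd c v"
    proof
      assume d: "n dvd c v"
      then have "v [^] c v \<in> int_multiples G n" using int_multiplesI[OF vc] int_multiples_dvd by blast
      then have "int_comb G (\<lambda>b. b) ?c \<in> int_multiples G n"
        using int_multiples_div[of "int_comb G (\<lambda>b. b) ?c" "v [^] c v"] eq cc vc by (simp add: m_comm)
      then have "n dvd ?c i" for i using independent_modD[OF B(1) fin(1) supp] by blast
      then show False using c(4) d by (metis)
    qed
    then show ?thesis using eq fin(1) supp by (intro exI[of _ "c v"] exI[of _ ?c]) simp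
  qed
  then show ?thesis using B by blast
qed

end


section \<open>Bases modulo all primes\<close>

definition divisible_part :: "('a, 'c) monoid_scheme \<Rightarrow> 'a set" where
  "divisible_part A = (\<Inter>n \<in> {n. n \<noteq> 0}. int_multiples A n)"

text \<open>These properties determine the group up to isomorphism. The cardinality of the continuum is expressed
  by the index type \<open>real\<close>.\<close>

locale saturated_group = comm_group A for A (structure) +
  assumes tf: "torsion_free_group A" and sat: "solves_congruences A"
    and card_le: "carrier A \<lesssim> (UNIV :: real set)"
    and ex_independent: "\<exists>x :: real \<Rightarrow> 'a. \<forall>n. independent_mod A n x UNIV"
    and ex_divisible_independent: "\<exists>y :: real \<Rightarrow> 'a. range y \<subseteq> divisible_part A \<and> independent_mod A 0 y UNIV"

context comm_group
begin

text \<open>Two equal members with coefficients \<open>1\<close> and \<open>-1\<close> would give a relation.\<close>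

lemma independent_mod_inj:
  assumes "independent_mod G n x I" "\<not> is_unit n"
  shows "inj_on x I"
proof (rule inj_onI, rule ccontr)
  fix i j assume ij: "i \<in> I" "j \<in> I" "x i = x j" "i \<noteq> j"
  let ?c = "\<lambda>l. if l = i then 1 else if l = j then -1 else 0 :: int"
  have xi: "x i \<in> carrier G" "x j \<in> carrier G" using assms ij by (auto simp: independent_mod_def)
  have supp: "{l. ?c l \<noteq> 0} \<subseteq> {i, j}" by auto
  have "int_comb G x ?c = finprod G (\<lambda>l. x l [^] ?c l) {i, j}"
    by (rule int_comb_superset[OF _ supp]) (use xi in auto)
  also have "\<dots> = x i [^] ?c i \<otimes> x j [^] ?c j"
    using xi ij(4) by simp
  also have "\<dots> = \<one>" using xi ij by (simp add: int_pow_neg)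
  finally have "int_comb G x ?c \<in> int_multiples G n" by (simp add: int_multiples_one)
  then have "n dvd ?c i"
    using supp ij finite_subset[OF supp] by (intro independent_modD[OF assms(1)]) auto
  then show False using assms(2) by simp
qed

lemma divisible_part_subset: "divisible_part G \<subseteq> carrier G"
proof
  fix v assume "v \<in> divisible_part G"
  then have "v \<in> int_multiples G 1" unfolding divisible_part_def by (rule INT_D) simp
  then show "v \<in> carrier G" by simp
qed

lemma divisible_partD: "v \<in> divisible_part G \<Longrightarrow> n \<noteq> 0 \<Longrightarrow> v \<in> int_multiples G n"
  unfolding divisible_part_def by blast

text \<open>A maximal independent set that contains an independent family of size \<open>'i\<close> has exactly that size when
  the group is no larger.\<close>

lemma exists_independent_family:
  assumes x: "independent_mod G n (x :: 'i \<Rightarrow> 'a) UNIV" and xV: "range x \<subseteq> V" and V: "V \<subseteq> carrier G"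
    and n1: "\<not> is_unit n" and card: "carrier G \<lesssim> (UNIV :: 'i set)"
  shows "\<exists>y :: 'i \<Rightarrow> 'a. independent_mod G n y UNIV \<and> range y \<subseteq> V \<and>
     (\<forall>v\<in>V. \<exists>e c. \<not> n dvd e \<and> finite {i. c i \<noteq> 0} \<and> v [^] e \<otimes> int_comb G y c \<in> int_multiples G n)"
proof -
  have inj: "inj_on x UNIV" by (rule independent_mod_inj[OF x n1])
  have "independent_mod G n (\<lambda>b. b) (range x)"
    using independent_mod_image_iff[OF inj] x by simp
  from exists_maximal_independent[OF this xV V n1] obtain B where B: "range x \<subseteq> B" "B \<subseteq> V"
    "independent_mod G n (\<lambda>b. b) B"
    and span: "\<And>v. v \<in> V \<Longrightarrow> \<exists>e c. \<not> n dvd e \<and> finite {b. c b \<noteq> 0} \<and> {b. c b \<noteq> 0} \<subseteq> B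
           \<and> v [^] e \<otimes> int_comb G (\<lambda>b. b) c \<in> int_multiples G n" by blast
  have "(UNIV :: 'i set) \<lesssim> B" using inj B(1) unfolding lepoll_def by blast
  moreover have "B \<lesssim> (UNIV :: 'i set)"
    using B(2) V card lepoll_trans subset_imp_lepoll by (metis subset_trans)
  ultimately obtain y :: "'i \<Rightarrow> 'a" where y: "bij_betw y UNIV B"
    using lepoll_antisym eqpoll_def by metis
  have yi: "inj_on y UNIV" and yB: "y ` UNIV = B" using y by (auto simp: bij_betw_def)
  have "independent_mod G n y UNIV"
    using independent_mod_image_iff[OF yi] B(3) yB by simp
  moreover have "\<exists>e c. \<not> n dvd e \<and> finite {i. c i \<noteq> 0} \<and> v [^] e \<otimes> int_comb G y c \<in> int_multiples G n"
    if v: "v \<in> V" for v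
  proof -
    obtain e c where c: "\<not> n dvd e" "finite {b. c b \<noteq> 0}" "{b. c b \<noteq> 0} \<subseteq> B"
       "v [^] e \<otimes> int_comb G (\<lambda>b. b) c \<in> int_multiples G n" using span[OF v] by blast
    have "int_comb G y (\<lambda>i. if i \<in> UNIV then c (y i) else 0) = int_comb G (\<lambda>b. b) c"
      by (rule int_comb_reindex[OF c(2) _ yi]) (use c(3) yB B V in auto)
    moreover have "finite {i. c (y i) \<noteq> 0}"
      using finite_vimageI[OF c(2), of y] yi by (simp add: vimage_def)
    ultimately show ?thesis using c(1,4) by (intro exI[of _ e] exI[of _ "\<lambda>i. c (y i)"]) simp
  qed
  moreover have "range y \<subseteq> V" using yB B(2) by simp
  ultimately show ?thesis by blast
qed

lemma int_comb_cong_mod: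
  assumes "range x \<subseteq> carrier G" "range y \<subseteq> carrier G" "\<And>i. x i \<otimes> inv (y i) \<in> int_multiples G n"
    "finite {i. c i \<noteq> 0}"
  shows "int_comb G x c \<otimes> inv (int_comb G y c) \<in> int_multiples G n"
proof -
  have xy: "x i \<in> carrier G" "y i \<in> carrier G" for i using assms(1,2) by auto
  have "int_comb G x c = int_comb G (\<lambda>i. x i \<otimes> inv (y i)) c \<otimes> int_comb G y c"
    unfolding int_comb_def using xy
    by (subst finprod_multf[symmetric]) (auto simp: int_pow_distrib[symmetric] m_assoc intro!: finprod_cong')
  moreover have "int_comb G y c \<in> carrier G" "int_comb G (\<lambda>i. x i \<otimes> inv (y i)) c \<in> carrier G"
    using xy by (intro int_comb_closed; auto)+
  ultimately have "int_comb G x c \<otimes> inv (int_comb G y c) = int_comb G (\<lambda>i. x i \<otimes> inv (y i)) c"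
    by (simp add: m_assoc)
  also have "\<dots> \<in> int_multiples G n"
    unfolding int_comb_def by (intro finprod_int_multiples int_multiples_pow' assms(3))
  finally show ?thesis .
qed

lemma independent_mod_cong:
  assumes "independent_mod G n y UNIV" "range x \<subseteq> carrier G" "\<And>i. x i \<otimes> inv (y i) \<in> int_multiples G n"
  shows "independent_mod G n x UNIV"
  unfolding independent_mod_def
proof (intro conjI allI impI; (elim conjE)?)
  show "x \<in> UNIV \<rightarrow> carrier G" using assms(2) by auto
  have y: "range y \<subseteq> carrier G" using assms(1) by (auto simp: independent_mod_def)
  fix c i assume c: "finite {i. c i \<noteq> 0}" "int_comb G x c \<in> int_multiples G n"
  have cx: "int_comb G x c \<in> carrier G" "int_comb G y c \<in> carrier G"
    using assms(2) y by (intro int_comb_closed; auto)+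
  have "inv (int_comb G y c) \<in> int_multiples G n"
    using int_multiples_div[of "inv (int_comb G y c)" "int_comb G x c"]
      int_comb_cong_mod[OF assms(2) y assms(3) c(1)] c(2) cx by (simp add: m_comm)
  then have "int_comb G y c \<in> int_multiples G n" using int_multiples_inv cx by fastforce
  then show "n dvd c i" using independent_modD[OF assms(1) c(1)] by simp
qed

lemma spans_mod_cong:
  assumes "spans_mod G n y" "range y \<subseteq> carrier G" "range x \<subseteq> carrier G" "\<And>i. x i \<otimes> inv (y i) \<in> int_multiples G n"
  shows "spans_mod G n x"
  unfolding spans_mod_def
proof
  fix v assume v: "v \<in> carrier G"
  then obtain c where c: "finite {i. c i \<noteq> 0}" "v \<otimes> int_comb G y c \<in> int_multiples G n"
    using assms(1) unfolding spans_mod_def by blast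
  have cx: "int_comb G x c \<in> carrier G" "int_comb G y c \<in> carrier G"
    using assms(2,3) by (intro int_comb_closed; auto)+
  have "(v \<otimes> int_comb G y c) \<otimes> (int_comb G x c \<otimes> inv (int_comb G y c)) \<in> int_multiples G n"
    by (rule int_multiples_mult[OF c(2) int_comb_cong_mod[OF assms(3,2,4) c(1)]])
  also have "(v \<otimes> int_comb G y c) \<otimes> (int_comb G x c \<otimes> inv (int_comb G y c))
    = (v \<otimes> int_comb G x c) \<otimes> (int_comb G y c \<otimes> inv (int_comb G y c))"
    using cx v by (simp add: m_ac del: r_inv)
  also have "\<dots> = v \<otimes> int_comb G x c" using cx v by simp
  finally show "\<exists>c. finite {i. c i \<noteq> 0} \<and> v \<otimes> int_comb G x c \<in> int_multiples G n"
    using c(1) by blast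
qed

text \<open>A combination divisible by \<open>qn\<close> with \<open>q\<close> prime has coefficients divisible by \<open>q\<close>. Cancelling \<open>q\<close>, which
  torsion-freeness allows, leaves a combination divisible by \<open>n\<close>.\<close>

lemma independent_mod_all:
  assumes tf: "torsion_free_group G" and p: "\<And>p. prime p \<Longrightarrow> independent_mod G p x UNIV"
    and n: "n \<noteq> 0" and x: "range x \<subseteq> carrier G"
  shows "independent_mod G n x UNIV"
  using n
proof (induction n rule: prime_divisors_induct)
  case (unit n)
  have "n dvd a" for a using unit(1) by (rule unit_imp_dvd)
  then show ?case using x by (simp add: independent_mod_def Pi_iff image_subset_iff)
next
  case (factor q n)
  show ?case
    unfolding independent_mod_def
  proof (intro conjI allI impI; (elim conjE)?)
    show "x \<in> UNIV \<rightarrow> carrier G" using x by auto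
    fix c i assume c: "finite {i. c i \<noteq> 0}" "int_comb G x c \<in> int_multiples G (q * n)"
    have q: "q \<noteq> 0" using factor by auto
    have "q dvd c j" for j
      by (rule independent_modD[OF p[OF factor(1)] c(1)])
         (use c(2) int_multiples_dvd[of q "q * n"] in auto)
    then have c': "c = (\<lambda>j. (c j div q) * q)" by auto
    let ?d = "\<lambda>j. c j div q"
    have "{j. ?d j \<noteq> 0} \<subseteq> {i. c i \<noteq> 0}" by auto
    then have fin: "finite {j. ?d j \<noteq> 0}" using c(1) finite_subset by blast
    have "int_comb G x c = int_comb G x ?d [^] q"
      using int_comb_scale[OF fin, of x q] c' x by (auto simp: image_subset_iff)
    then have "int_comb G x ?d [^] q \<in> int_multiples G (n * q)" using c(2) by (simp add: mult.commute)
    then have "int_comb G x ?d \<in> int_multiples G n"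
      by (rule int_multiples_cancel[OF tf]) (use q x in \<open>auto intro!: int_comb_closed\<close>)
    moreover have "independent_mod G n x UNIV" using factor(2,3) by simp
    ultimately have "n dvd ?d i" using independent_modD[OF _ fin subset_UNIV] by blast
    then have "q * n dvd q * ?d i" by (rule mult_dvd_mono[OF dvd_refl])
    then show "q * n dvd c i" using fun_cong[OF c', of i] by (metis mult.commute)
  qed
qed simp

text \<open>Approximate \<open>v\<close> modulo \<open>q\<close>; the error is a \<open>q\<close>-th power, whose root is approximated modulo \<open>n\<close>.\<close>

lemma spans_mod_all:
  assumes p: "\<And>p. prime p \<Longrightarrow> spans_mod G p x" and n: "n \<noteq> 0" and x: "range x \<subseteq> carrier G"
  shows "spans_mod G n x"
  using n
proof (induction n rule: prime_divisors_induct)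
  case (unit n)
  have "int_multiples G 1 \<subseteq> int_multiples G n"
    by (rule int_multiples_dvd) (rule unit_imp_dvd[OF unit(1)])
  then have sub: "v \<otimes> int_comb G x (\<lambda>_. 0) \<in> int_multiples G n" if "v \<in> carrier G" for v
    using that by (simp add: subset_iff)
  show ?case unfolding spans_mod_def
  proof
    fix v assume "v \<in> carrier G"
    from sub[OF this] show "\<exists>c. finite {i. c i \<noteq> 0} \<and> v \<otimes> int_comb G x c \<in> int_multiples G n"
      by (intro exI[of _ "\<lambda>_. 0"]) simp
  qed
next
  case (factor q n)
  show ?case unfolding spans_mod_def
  proof
    fix v assume v: "v \<in> carrier G"
    obtain c where c: "finite {i. c i \<noteq> 0}" "v \<otimes> int_comb G x c \<in> int_multiples G q"
      using p[OF factor(1)] v unfolding spans_mod_def by blast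
    then obtain w where w: "w \<in> carrier G" "v \<otimes> int_comb G x c = w [^] q" by (auto elim: int_multiplesE)
    have n0: "n \<noteq> 0" using factor by auto
    obtain d where d: "finite {i. d i \<noteq> 0}" "w \<otimes> int_comb G x d \<in> int_multiples G n"
      using factor(2)[OF n0] w(1) unfolding spans_mod_def by blast
    have x': "x \<in> F \<rightarrow> carrier G" for F using x by auto
    have fin: "finite {i. d i * q \<noteq> 0}" by (rule finite_subset[OF _ d(1)]) auto
    have cl: "int_comb G x c \<in> carrier G" "int_comb G x d \<in> carrier G"
      by (rule int_comb_closed[OF x'])+
    have "v \<otimes> int_comb G x (\<lambda>i. c i + d i * q) = (v \<otimes> int_comb G x c) \<otimes> int_comb G x d [^] q"
      using v cl by (simp add: int_comb_add[OF c(1) fin x'] int_comb_scale[OF d(1) x'] m_assoc)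
    also have "\<dots> = (w \<otimes> int_comb G x d) [^] q" using w cl by (simp add: int_pow_distrib)
    also have "\<dots> \<in> int_multiples G (n * q)" by (rule int_multiples_pow[OF d(2)])
    finally have "v \<otimes> int_comb G x (\<lambda>i. c i + d i * q) \<in> int_multiples G (q * n)"
      by (simp add: mult.commute)
    moreover have "finite {i. c i + d i * q \<noteq> 0}"
      by (rule finite_subset[of _ "{i. c i \<noteq> 0} \<union> {i. d i \<noteq> 0}"]) (use c(1) d(1) in auto)
    ultimately show "\<exists>c. finite {i. c i \<noteq> 0} \<and> v \<otimes> int_comb G x c \<in> int_multiples G (q * n)"
      by (intro exI[of _ "\<lambda>i. c i + d i * q"]) simp
  qed
qed simp

text \<open>A Chinese remainder theorem for all primes at once. Finitely many primes are handled by the usual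
  induction, and solvability of countable systems does the rest.\<close>

lemma simultaneous_congruences:
  assumes sat: "solves_congruences G" and b: "\<And>p. prime p \<Longrightarrow> b p \<in> carrier G"
  shows "\<exists>x \<in> carrier G. \<forall>p::nat. prime p \<longrightarrow> x \<otimes> inv (b p) \<in> int_multiples G (int p)"
proof -
  define q where "q p = (if prime p then int p else 1)" for p :: nat
  define d where "d p = (if prime p then inv (b p) else \<one>)" for p
  have "\<exists>x \<in> carrier G. \<forall>j. d j \<otimes> x [^] (1::int) \<in> int_multiples G (q j)"
  proof (rule solves_congruencesD[OF sat])
    show "d j \<in> carrier G" for j using b by (auto simp: d_def)
    show "q j \<noteq> 0" for j by (auto simp: q_def)
    fix N
    show "\<exists>x \<in> carrier G. \<forall>j\<le>N. d j \<otimes> x [^] (1::int) \<in> int_multiples G (q j)"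
    proof (induction N)
      case 0
      then show ?case by (auto simp: d_def q_def intro!: bexI[of _ \<one>])
    next
      case (Suc N)
      then obtain x where x: "x \<in> carrier G" "\<And>j. j \<le> N \<Longrightarrow> d j \<otimes> x \<in> int_multiples G (q j)" by auto
      show ?case
      proof (cases "prime (Suc N)")
        case False
        then have "d (Suc N) \<otimes> x [^] (1::int) \<in> int_multiples G (q (Suc N))"
          using x(1) by (simp add: d_def q_def)
        then show ?thesis using x by (metis int_pow_1 le_Suc_eq)
      next
        case True
        define Q where "Q = (\<Prod>j\<in>{j. j \<le> N \<and> prime j}. int j)"
        have "coprime Q (int (Suc N))"
          unfolding Q_def
        proof (rule prod_coprime_left)
          fix j assume "j \<in> {j. j \<le> N \<and> prime j}"
          then have "coprime j (Suc N)" using True by (intro primes_coprime) auto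
          then show "coprime (int j) (int (Suc N))" by (simp del: of_nat_Suc)
        qed
        then obtain u v where uv: "u * Q + v * int (Suc N) = 1"
          using bezout_int[of Q "int (Suc N)"] by (metis coprime_imp_gcd_eq_1)
        let ?b = "b (Suc N)" 
        let ?t = "?b \<otimes> inv x"
        let ?y = "x \<otimes> ?t [^] (u * Q)"
        have bc: "?b \<in> carrier G" using b True by simp
        have tc: "?t \<in> carrier G" using bc x by simp
        have "d j \<otimes> ?y \<in> int_multiples G (q j)" if "j \<le> Suc N" for j
        proof (cases "j = Suc N")
          case j: True
          have "u * Q = 1 - v * int (Suc N)" using uv by linarith
          then have "?t [^] (u * Q) = ?t [^] (1 - v * int (Suc N))" by (rule arg_cong)
          also have "\<dots> = ?t \<otimes> inv (?t [^] (v * int (Suc N)))"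
            using tc by (simp add: int_pow_diff del: of_nat_Suc)
          finally have "d j \<otimes> ?y = inv ?b \<otimes> (x \<otimes> (?t \<otimes> inv (?t [^] (v * int (Suc N)))))"
            using j True by (simp add: d_def del: of_nat_Suc)
          also have "\<dots> = (inv ?b \<otimes> (x \<otimes> ?t)) \<otimes> inv (?t [^] (v * int (Suc N)))"
            using bc x(1) by (simp add: m_assoc del: of_nat_Suc)
          also have "x \<otimes> ?t = ?b" using bc x(1) by (simp add: m_comm[of ?b] flip: m_assoc)
          also have "inv ?b \<otimes> ?b = \<one>" using bc by simp
          also have "\<one> \<otimes> inv (?t [^] (v * int (Suc N))) = inv ((?t [^] v) [^] int (Suc N))"
            using tc by (simp add: int_pow_pow del: of_nat_Suc)
          also have "\<dots> \<in> int_multiples G (q j)"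
            using tc True j by (auto simp: q_def simp del: of_nat_Suc intro!: int_multiples_inv int_multiplesI)
          finally show ?thesis .
        next
          case False
          then have jN: "j \<le> N" using that by simp
          have qd: "q j dvd u * Q"
            using jN unfolding q_def Q_def by (auto intro!: dvd_mult dvd_prodI)
          have "d j \<otimes> ?y = (d j \<otimes> x) \<otimes> ?t [^] (u * Q)"
            using bc x(1) b by (simp add: d_def m_assoc)
          also have "\<dots> \<in> int_multiples G (q j)"
            using int_multiples_mult[OF x(2)[OF jN]] int_multiplesI[OF tc, of "u * Q"] int_multiples_dvd[OF qd] by blast
          finally show ?thesis .
        qed
        then show ?thesis using x(1) tc by (intro bexI[of _ ?y]) auto
      qed
    qed
  qed
  then obtain x where x: "x \<in> carrier G" "\<And>j. d j \<otimes> x [^] (1::int) \<in> int_multiples G (q j)" by blast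
  have "x \<otimes> inv (b p) \<in> int_multiples G (int p)" if "prime p" for p
    using x(2)[of p] x(1) b[OF that] that by (simp add: d_def q_def m_comm)
  then show ?thesis using x(1) by blast
qed

end

context saturated_group
begin

text \<open>A maximal independent family spans modulo a prime because a coefficient not divisible by \<open>p\<close> can be
  inverted modulo \<open>p\<close>.\<close>

lemma exists_basis_mod_prime:
  assumes "prime p"
  shows "\<exists>x :: real \<Rightarrow> 'a. independent_mod A p x UNIV \<and> spans_mod A p x"
proof -
  have n1: "\<not> is_unit p" using assms not_prime_unit by blast
  obtain x0 :: "real \<Rightarrow> 'a" where x0: "\<And>n. independent_mod A n x0 UNIV" using ex_independent by blast
  have "range x0 \<subseteq> carrier A" using x0[of p] by (auto simp: independent_mod_def)
  from exists_independent_family[OF x0 this subset_refl n1 card_le]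
  obtain y :: "real \<Rightarrow> 'a" where y: "independent_mod A p y UNIV" "range y \<subseteq> carrier A"
    and span: "\<And>v. v \<in> carrier A \<Longrightarrow>
      \<exists>e c. \<not> p dvd e \<and> finite {i. c i \<noteq> 0} \<and> v [^] e \<otimes> int_comb A y c \<in> int_multiples A p" by blast
  have y': "y \<in> F \<rightarrow> carrier A" for F using y(2) by auto
  have "spans_mod A p y"
    unfolding spans_mod_def
  proof
    fix v assume v: "v \<in> carrier A"
    then obtain e c where c: "\<not> p dvd e" "finite {i. c i \<noteq> 0}" "v [^] e \<otimes> int_comb A y c \<in> int_multiples A p"
      using span by blast
    have "coprime e p" using prime_imp_coprime[OF assms c(1)] by (simp add: coprime_commute)
    then obtain u w where uw: "u * e + w * p = 1"
      using bezout_int[of e p] by (metis coprime_imp_gcd_eq_1)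
    have cl: "int_comb A y c \<in> carrier A" by (rule int_comb_closed[OF y'])
    have "(v [^] e \<otimes> int_comb A y c) [^] u \<otimes> (v [^] w) [^] p \<in> int_multiples A p"
      using v by (intro int_multiples_mult int_multiples_pow' c(3) int_multiplesI) auto
    also have "(v [^] e \<otimes> int_comb A y c) [^] u \<otimes> (v [^] w) [^] p
       = (v [^] (u * e) \<otimes> v [^] (w * p)) \<otimes> int_comb A y c [^] u"
      using v cl by (simp add: int_pow_distrib int_pow_pow m_ac mult.commute)
    also have "\<dots> = v \<otimes> int_comb A y (\<lambda>i. c i * u)"
      using v int_comb_scale[OF c(2) y', of u] by (simp flip: int_pow_mult add: uw)
    finally have "v \<otimes> int_comb A y (\<lambda>i. c i * u) \<in> int_multiples A p" .
    moreover have "finite {i. c i * u \<noteq> 0}" by (rule finite_subset[OF _ c(2)]) auto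
    ultimately show "\<exists>c. finite {i. c i \<noteq> 0} \<and> v \<otimes> int_comb A y c \<in> int_multiples A p"
      by (intro exI[of _ "\<lambda>i. c i * u"]) simp
  qed
  then show ?thesis using y(1) by blast
qed

text \<open>Bases modulo the single primes have the same index type, so one family can be chosen that is
  congruent to all of them.\<close>

lemma exists_basis_mod_all:
  "\<exists>x :: real \<Rightarrow> 'a. range x \<subseteq> carrier A \<and> (\<forall>n. n \<noteq> 0 \<longrightarrow> independent_mod A n x UNIV \<and> spans_mod A n x)"
proof -
  have "\<exists>b :: real \<Rightarrow> 'a. prime p \<longrightarrow> independent_mod A (int p) b UNIV \<and> spans_mod A (int p) b" for p :: nat
    using exists_basis_mod_prime[of "int p"] by auto
  then obtain b :: "nat \<Rightarrow> real \<Rightarrow> 'a" where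
    b: "\<And>p. prime p \<Longrightarrow> independent_mod A (int p) (b p) UNIV \<and> spans_mod A (int p) (b p)" by metis
  have bc: "range (b p) \<subseteq> carrier A" if "prime p" for p
    using b[OF that] by (auto simp: independent_mod_def)
  have "\<forall>i. \<exists>x \<in> carrier A. \<forall>p::nat. prime p \<longrightarrow> x \<otimes> inv (b p i) \<in> int_multiples A (int p)"
    using bc by (intro allI simultaneous_congruences[OF sat]) auto
  then obtain x where x: "\<And>i. x i \<in> carrier A"
    "\<And>i p. prime p \<Longrightarrow> x i \<otimes> inv (b p i) \<in> int_multiples A (int p)" by metis
  have xr: "range x \<subseteq> carrier A" using x(1) by auto
  have *: "independent_mod A p x UNIV \<and> spans_mod A p x" if p: "prime p" for p :: int
  proof -
    have "p = int (nat p)" "prime (nat p)" using p prime_ge_0_int[OF p] by (simp_all add: prime_int_iff')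
    then obtain p' where p': "p = int p'" "prime p'" by blast
    have bp: "independent_mod A p (b p') UNIV" "spans_mod A p (b p')" using b[OF p'(2)] p'(1) by simp_all
    have xp: "x i \<otimes> inv (b p' i) \<in> int_multiples A p" for i using x(2)[OF p'(2)] p'(1) by simp
    show ?thesis
      using independent_mod_cong[OF bp(1) xr xp] spans_mod_cong[OF bp(2) bc[OF p'(2)] xr xp] by (rule conjI)
  qed
  have "independent_mod A n x UNIV \<and> spans_mod A n x" if n: "n \<noteq> 0" for n :: int
    using independent_mod_all[OF tf _ n xr] spans_mod_all[OF _ n xr] * by blast
  then show ?thesis using xr by blast
qed

lemma exists_divisible_basis:
  "\<exists>y :: real \<Rightarrow> 'a. independent_mod A 0 y UNIV \<and> range y \<subseteq> divisible_part A \<and>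
     (\<forall>v\<in>divisible_part A. \<exists>(e::int) c. e \<noteq> 0 \<and> finite {i. c i \<noteq> 0} \<and> v [^] (e::int) = int_comb A y c)"
proof -
  obtain x where "independent_mod A 0 (x :: real \<Rightarrow> 'a) UNIV" "range x \<subseteq> divisible_part A"
    using ex_divisible_independent by blast
  from exists_independent_family[OF this divisible_part_subset _ card_le]
  obtain y :: "real \<Rightarrow> 'a" where y: "independent_mod A 0 y UNIV" "range y \<subseteq> divisible_part A"
    and span: "\<And>v. v \<in> divisible_part A \<Longrightarrow>
      \<exists>e c. \<not> (0::int) dvd e \<and> finite {i. c i \<noteq> 0} \<and> v [^] e \<otimes> int_comb A y c \<in> int_multiples A 0" by auto
  have y': "y \<in> F \<rightarrow> carrier A" for F using y(2) divisible_part_subset by auto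
  have "\<exists>(e::int) c. e \<noteq> 0 \<and> finite {i. c i \<noteq> 0} \<and> v [^] e = int_comb A y c"
    if v: "v \<in> divisible_part A" for v
  proof -
    have vc: "v \<in> carrier A" using v divisible_part_subset by auto
    obtain e :: int and c where c: "e \<noteq> 0" "finite {i. c i \<noteq> 0}" "v [^] e \<otimes> int_comb A y c = \<one>"
      using span[OF v] by auto
    have cl: "int_comb A y c \<in> carrier A" by (rule int_comb_closed[OF y'])
    have "int_comb A y (\<lambda>i. c i * -1) = inv (int_comb A y c)"
      using int_comb_scale[OF c(2) y', of "-1"] cl by (simp add: int_pow_neg)
    also have "\<dots> = v [^] e" using c(3) vc cl by (simp add: inv_equality)
    finally have "v [^] e = int_comb A y (\<lambda>i. - c i)" by simp
    moreover have "finite {i. - c i \<noteq> 0}" using c(2) by simp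
    ultimately show ?thesis using c(1) by (intro exI[of _ e] exI[of _ "\<lambda>i. - c i"]) simp
  qed
  then show ?thesis using y by blast
qed

end


section \<open>Algebraic compactness and the divisible part\<close>

lemma finite_support_diff:
  fixes c d :: "'i \<Rightarrow> 'b::group_add"
  assumes "finite {i. c i \<noteq> 0}" "finite {i. d i \<noteq> 0}"
  shows "finite {i. c i - d i \<noteq> 0}"
proof (rule finite_subset)
  show "{i. c i - d i \<noteq> 0} \<subseteq> {i. c i \<noteq> 0} \<union> {i. d i \<noteq> 0}" by auto
qed (use assms in simp)

lemma int_multiples_of_nat: "int_multiples G (int n) = multiples G n (carrier G)"
  by (simp add: int_multiples_def multiples_def int_pow_int)

text \<open>Purity of \<open>B\<close> in \<open>X\<close> says exactly that the inverse of \<open>f :: A \<cong> B\<close> does not lower divisibility in \<open>X\<close>.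
  Its extension to \<open>X\<close> retracts \<open>X\<close> onto \<open>B\<close>, and the kernel is a complement.\<close>

theorem algebraically_compactI:
  assumes A: "comm_group A" and tf: "torsion_free_group A" and sat: "solves_congruences A"
  shows "algebraically_compact TYPE('b) A"
  unfolding algebraically_compact_def
proof (intro conjI allI impI; (elim conjE)?)
  show "comm_group A" by fact
  interpret A: comm_group A by fact
  fix X :: "'b monoid" and B
  assume X: "comm_group X" and pure: "pure_subgroup B X" and AB: "A \<cong> X\<lparr>carrier := B\<rparr>"
  interpret X: comm_group X by fact
  have sB: "subgroup B X" using pure by (simp add: pure_subgroup_def)
  interpret B: subgroup B X by fact
  obtain f where f: "f \<in> hom A (X\<lparr>carrier := B\<rparr>)" "bij_betw f (carrier A) B"
    using AB by (auto simp: is_iso_def iso_def)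
  have f_mult: "f (a \<otimes>\<^bsub>A\<^esub> b) = f a \<otimes>\<^bsub>X\<^esub> f b" if "a \<in> carrier A" "b \<in> carrier A" for a b
    using hom_mult[OF f(1) that] by simp
  have fB: "f a \<in> B" if "a \<in> carrier A" for a using f(2) that by (auto simp: bij_betw_def)
  have f_hom: "f \<in> hom A X" by (rule homI) (use f_mult fB B.mem_carrier in auto)
  interpret f: group_hom A X f using f_hom by unfold_locales
  have inj: "a = b" if "f a = f b" "a \<in> carrier A" "b \<in> carrier A" for a b
    using f(2) that by (auto simp: bij_betw_def inj_on_def)
  have surj: "\<exists>a \<in> carrier A. y = f a" if "y \<in> B" for y
    using f(2) that by (auto simp: bij_betw_def)
  define \<Gamma> where "\<Gamma> = (\<lambda>a. (f a, a)) ` carrier A"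
  have pos: "a \<in> int_multiples A (int n)" if a: "a \<in> carrier A" "f a \<in> int_multiples X (int n)" "n \<ge> 1" for a n
  proof -
    have "f a \<in> multiples X n (carrier X) \<inter> B" using a fB by (simp add: int_multiples_of_nat)
    then have "f a \<in> multiples X n B" using pure a(3) unfolding pure_subgroup_def by blast
    then obtain y where y: "y \<in> B" "f a = y [^]\<^bsub>X\<^esub> n" by (auto simp: multiples_def)
    obtain b where b: "b \<in> carrier A" "y = f b" using surj[OF y(1)] by blast
    have "f a = f (b [^]\<^bsub>A\<^esub> n)" using y(2) b f.hom_nat_pow by simp
    then have "a = b [^]\<^bsub>A\<^esub> n" using inj a(1) b(1) by simp
    then show ?thesis using b(1) by (auto simp: int_multiples_of_nat multiples_def)
  qed
  have "height_graph X A \<Gamma>"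
    unfolding height_graph_def
  proof (intro conjI allI impI; (elim conjE)?)
    show "\<Gamma> \<subseteq> carrier X \<times> carrier A" by (auto simp: \<Gamma>_def)
    have "(f \<one>\<^bsub>A\<^esub>, \<one>\<^bsub>A\<^esub>) \<in> \<Gamma>" unfolding \<Gamma>_def by (rule imageI) simp
    then show "(\<one>\<^bsub>X\<^esub>, \<one>\<^bsub>A\<^esub>) \<in> \<Gamma>" by simp
    fix y b y' b' assume "(y, b) \<in> \<Gamma>" "(y', b') \<in> \<Gamma>"
    then have *: "y = f b" "y' = f b'" "b \<in> carrier A" "b' \<in> carrier A" by (auto simp: \<Gamma>_def)
    have "(f (b \<otimes>\<^bsub>A\<^esub> inv\<^bsub>A\<^esub> b'), b \<otimes>\<^bsub>A\<^esub> inv\<^bsub>A\<^esub> b') \<in> \<Gamma>" unfolding \<Gamma>_def by (rule imageI) (use * in simp)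
    then show "(y \<otimes>\<^bsub>X\<^esub> inv\<^bsub>X\<^esub> y', b \<otimes>\<^bsub>A\<^esub> inv\<^bsub>A\<^esub> b') \<in> \<Gamma>" using * by simp
  next
    fix y b n assume "(y, b) \<in> \<Gamma>" and n: "y \<in> int_multiples X n"
    then have *: "y = f b" "b \<in> carrier A" by (auto simp: \<Gamma>_def)
    consider "n = 0" | m where "m \<ge> 1" "n = int m" | m where "m \<ge> 1" "n = - int m"
    proof (cases n rule: int_cases2)
      case (nonneg m)
      then show ?thesis using that(1) that(2)[of m] by (cases "m = 0") auto
    next
      case (nonpos m)
      then show ?thesis using that(1) that(3)[of m] by (cases "m = 0") auto
    qed
    then show "b \<in> int_multiples A n"
    proof cases
      case 1
      then have "f b = f \<one>\<^bsub>A\<^esub>" using n * by simp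
      then have "b = \<one>\<^bsub>A\<^esub>" using inj *(2) by simp
      then show ?thesis using 1 by simp
    next
      case (2 m)
      then show ?thesis using pos *(2) n *(1) by simp
    next
      case (3 m)
      then show ?thesis using pos[OF *(2) _ 3(1)] n *(1) by simp
    qed
  qed
  from extend_height_graph[OF X A tf sat this] obtain h where
    h: "h \<in> hom X A" "\<forall>(y, b) \<in> \<Gamma>. h y = b" by blast
  have hf: "h (f a) = a" if "a \<in> carrier A" for a using h(2) that by (auto simp: \<Gamma>_def)
  interpret h: group_hom X A h using h(1) by unfold_locales
  have sC: "subgroup (kernel X A h) X" by (rule h.subgroup_kernel)
  have cap: "B \<inter> kernel X A h = {\<one>\<^bsub>X\<^esub>}"
  proof
    show "B \<inter> kernel X A h \<subseteq> {\<one>\<^bsub>X\<^esub>}"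
    proof
      fix y assume y: "y \<in> B \<inter> kernel X A h"
      then obtain a where a: "a \<in> carrier A" "y = f a" using surj by blast
      then show "y \<in> {\<one>\<^bsub>X\<^esub>}" using y hf by (simp add: kernel_def)
    qed
  qed (simp add: kernel_def)
  have "carrier X \<subseteq> B <#>\<^bsub>X\<^esub> kernel X A h"
  proof
    fix x assume x: "x \<in> carrier X"
    let ?y = "f (h x)"
    have hx: "h x \<in> carrier A" "?y \<in> carrier X" using x by simp_all
    have "inv\<^bsub>X\<^esub> ?y \<otimes>\<^bsub>X\<^esub> x \<in> kernel X A h" using x hx by (simp add: kernel_def hf)
    moreover have "x = ?y \<otimes>\<^bsub>X\<^esub> (inv\<^bsub>X\<^esub> ?y \<otimes>\<^bsub>X\<^esub> x)" using x hx by (simp flip: X.m_assoc)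
    ultimately show "x \<in> B <#>\<^bsub>X\<^esub> kernel X A h" using fB[OF hx(1)] unfolding set_mult_def by blast
  qed
  moreover have "B <#>\<^bsub>X\<^esub> kernel X A h \<subseteq> carrier X"
    using B.subset subgroup.subset[OF sC] X.set_mult_closed by blast
  ultimately have "B <#>\<^bsub>X\<^esub> kernel X A h = carrier X" by blast
  then show "direct_summand B X" unfolding direct_summand_def using sB sC cap by blast
qed

lemma comm_group_rational_group: "comm_group rational_group"
proof (rule group.group_comm_groupI)
  show "group rational_group"
    by (rule groupI) (auto simp: rational_group_def intro!: exI[of _ "- x" for x] )
qed (simp add: rational_group_def)

abbreviation rational_sum :: "(real \<Rightarrow> rat) monoid" where
  "rational_sum \<equiv> sum_group (UNIV :: real set) (\<lambda>_. rational_group)"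

lemma group_rational_group: "group rational_group"
  using comm_group_rational_group by (simp add: comm_group_def)

lemma rational_group_simps [simp]:
  "carrier rational_group = UNIV" "x \<otimes>\<^bsub>rational_group\<^esub> y = x + y" "\<one>\<^bsub>rational_group\<^esub> = 0"
  by (simp_all add: rational_group_def)

lemma carrier_rational_sum: "carrier rational_sum = {u. finite {i. u i \<noteq> 0}}"
  using carrier_sum_group[of "UNIV :: real set" "\<lambda>_. rational_group"] group_rational_group by simp

lemma comm_group_rational_sum: "comm_group rational_sum"
  by (rule group.group_comm_groupI) (simp_all add: group_rational_group add.commute)

lemma rational_sum_int_pow:
  assumes "u \<in> carrier rational_sum"
  shows "u [^]\<^bsub>rational_sum\<^esub> (n :: int) = (\<lambda>i. of_int n * u i)"
proof -
  interpret comm_group rational_sum by (rule comm_group_rational_sum)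
  have nat: "u [^]\<^bsub>rational_sum\<^esub> m = (\<lambda>i. of_nat m * u i)" for m :: nat
    by (induction m) (auto simp: algebra_simps)
  have inv_eq: "inv\<^bsub>rational_sum\<^esub> v = (\<lambda>i. - v i)" if "v \<in> carrier rational_sum" for v
    by (rule inv_equality) (use that in \<open>auto simp: carrier_rational_sum\<close>)
  have c: "(\<lambda>i. of_nat m * u i) \<in> carrier rational_sum" for m
    using nat_pow_closed[OF assms, of m] nat by simp
  show ?thesis
  proof (cases n rule: int_cases2)
    case (nonneg m)
    then show ?thesis using nat by (simp add: int_pow_int)
  next
    case (nonpos m)
    then show ?thesis using assms nat inv_eq[OF c] by (simp add: int_pow_neg int_pow_int)
  qed
qed

context saturated_group
begin

lemma torsion_subgroup_trivial: "torsion_subgroup A = {\<one>}"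
  using tf by (simp add: torsion_free_group_def)

lemma subgroup_int_multiples: "subgroup (int_multiples A n) A"
proof (rule subgroupI)
  show "int_multiples A n \<subseteq> carrier A" using int_multiples_closed by blast
  show "int_multiples A n \<noteq> {}" using int_multiples_one by blast
qed (rule int_multiples_inv int_multiples_mult; assumption)+

lemma subgroup_divisible_part: "subgroup (divisible_part A) A"
  unfolding divisible_part_def by (rule subgroups_Inter) (use subgroup_int_multiples in \<open>auto intro: exI[of _ 1]\<close>)

lemma divisible_part_divisible:
  assumes v: "v \<in> divisible_part A" and n: "n \<noteq> 0"
  shows "\<exists>w \<in> divisible_part A. v = w [^] (n::int)"
proof -
  obtain w where w: "w \<in> carrier A" "v = w [^] n"
    using divisible_partD[OF v n] by (rule int_multiplesE)
  have "w \<in> int_multiples A m" if m: "m \<noteq> 0" for m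
  proof -
    have "m * n \<noteq> 0" using m n by simp
    from divisible_partD[OF v this] have "w [^] n \<in> int_multiples A (m * n)" using w(2) by simp
    then show ?thesis by (rule int_multiples_cancel[OF tf _ w(1) n])
  qed
  then show ?thesis using w(2) unfolding divisible_part_def by blast
qed

theorem maximal_divisible_part: "maximal_divisible_subgroup (divisible_part A) A"
  unfolding maximal_divisible_subgroup_def divisible_subgroup_def
proof (intro conjI allI impI; (elim conjE)?)
  show "subgroup (divisible_part A) A" by (rule subgroup_divisible_part)
  interpret D: subgroup "divisible_part A" A by (rule subgroup_divisible_part)
  fix n :: nat assume n: "n \<ge> 1"
  show "multiples A n (divisible_part A) = divisible_part A"
  proof
    have "x [^] n \<in> divisible_part A" if x: "x \<in> divisible_part A" for x
      by (induction n) (use x in auto)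
    then show "multiples A n (divisible_part A) \<subseteq> divisible_part A" by (auto simp: multiples_def)
    show "divisible_part A \<subseteq> multiples A n (divisible_part A)"
    proof
      fix v assume "v \<in> divisible_part A"
      then obtain w where "w \<in> divisible_part A" "v = w [^] int n"
        using divisible_part_divisible[of v "int n"] n by auto
      then show "v \<in> multiples A n (divisible_part A)" by (auto simp: multiples_def int_pow_int)
    qed
  qed
next
  fix E assume E: "subgroup E A" "\<forall>n\<ge>1. multiples A n E = E"
  show "E \<subseteq> divisible_part A"
  proof
    fix v assume v: "v \<in> E"
    have "v \<in> int_multiples A n" if n: "n \<noteq> 0" for n
    proof -
      have "nat \<bar>n\<bar> \<ge> 1" using n by simp
      then have "v \<in> multiples A (nat \<bar>n\<bar>) E" using E(2) v by blast
      then have "v \<in> multiples A (nat \<bar>n\<bar>) (carrier A)"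
        using subgroup.subset[OF E(1)] by (auto simp: multiples_def)
      then have "v \<in> int_multiples A \<bar>n\<bar>" using int_multiples_of_nat[of A "nat \<bar>n\<bar>"] by simp
      then show ?thesis using int_multiples_dvd[of n "\<bar>n\<bar>"] by auto
    qed
    then show "v \<in> divisible_part A" unfolding divisible_part_def by blast
  qed
qed

text \<open>The map from finitely supported integer vectors given by a maximal independent family of the
  divisible part extends to rational vectors, because elements of the divisible part have every
  height. The image of the extension consists of divisible elements. It is injective since a
  nonzero rational vector has a nonzero integral multiple, and surjective since every element of
  the divisible part has a nonzero multiple in the span of the family.\<close>

theorem rational_sum_iso_divisible_part: "rational_sum \<cong> A\<lparr>carrier := divisible_part A\<rparr>"
proof -
  interpret Q: comm_group rational_sum by (rule comm_group_rational_sum)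
  obtain y :: "real \<Rightarrow> 'a" where y: "independent_mod A 0 y UNIV" "range y \<subseteq> divisible_part A"
    and span: "\<And>v. v \<in> divisible_part A \<Longrightarrow>
      \<exists>(e::int) c. e \<noteq> 0 \<and> finite {i. c i \<noteq> 0} \<and> v [^] e = int_comb A y c"
    using exists_divisible_basis by blast
  have yr: "range y \<subseteq> carrier A" using y(2) divisible_part_subset by blast
  have y': "y \<in> F \<rightarrow> carrier A" for F using yr by auto
  have comb: "int_comb A y c \<in> int_multiples A n" if "n \<noteq> 0" for n c
    unfolding int_comb_def using y(2) that
    by (intro finprod_int_multiples int_multiples_pow' divisible_partD) auto
  have comb_c: "int_comb A y c \<in> carrier A" for c by (rule int_comb_closed[OF y'])
  define \<Gamma> where "\<Gamma> = {(\<lambda>i. rat_of_int (c i), int_comb A y c) | c. finite {i. c i \<noteq> 0}}"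
  have \<Gamma>I: "(\<lambda>i. rat_of_int (c i), int_comb A y c) \<in> \<Gamma>" if "finite {i. c i \<noteq> 0}" for c
    using that unfolding \<Gamma>_def by blast
  have \<Gamma>E: "\<exists>c. finite {i. c i \<noteq> 0} \<and> u = (\<lambda>i. rat_of_int (c i)) \<and> b = int_comb A y c"
    if "(u, b) \<in> \<Gamma>" for u b using that unfolding \<Gamma>_def by simp metis
  have Q_c: "(\<lambda>i. rat_of_int (c i)) \<in> carrier rational_sum" if "finite {i. c i \<noteq> 0}" for c
    using that by (simp add: carrier_rational_sum)
  have Q_inv: "inv\<^bsub>rational_sum\<^esub> v = (\<lambda>i. - v i)" if "v \<in> carrier rational_sum" for v
    by (rule Q.inv_equality) (use that in \<open>auto simp: carrier_rational_sum\<close>)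
  have "height_graph rational_sum A \<Gamma>"
    unfolding height_graph_def
  proof (intro conjI allI impI; (elim conjE)?)
    show "\<Gamma> \<subseteq> carrier rational_sum \<times> carrier A"
      using Q_c comb_c unfolding \<Gamma>_def by blast
    show "(\<one>\<^bsub>rational_sum\<^esub>, \<one>) \<in> \<Gamma>" using \<Gamma>I[of "\<lambda>_. 0"] by (simp add: restrict_def)
    fix u b u' b' assume ub: "(u, b) \<in> \<Gamma>" "(u', b') \<in> \<Gamma>"
    obtain c where c: "finite {i. c i \<noteq> 0}" "u = (\<lambda>i. rat_of_int (c i))" "b = int_comb A y c"
      using \<Gamma>E[OF ub(1)] by (elim exE conjE)
    obtain c' where c': "finite {i. c' i \<noteq> 0}" "u' = (\<lambda>i. rat_of_int (c' i))" "b' = int_comb A y c'"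
      using \<Gamma>E[OF ub(2)] by (elim exE conjE)
    have fin: "finite {i. c i - c' i \<noteq> 0}"
      by (rule finite_support_diff[OF c(1) c'(1)])
    have "u \<otimes>\<^bsub>rational_sum\<^esub> inv\<^bsub>rational_sum\<^esub> u' = (\<lambda>i. rat_of_int (c i - c' i))"
      using c(2) c'(2) Q_inv[OF Q_c[OF c'(1)]] by auto
    moreover have "b \<otimes> inv b' = int_comb A y (\<lambda>i. c i - c' i)"
      using c c' int_comb_diff[OF c(1) c'(1) yr] by simp
    ultimately show "(u \<otimes>\<^bsub>rational_sum\<^esub> inv\<^bsub>rational_sum\<^esub> u', b \<otimes> inv b') \<in> \<Gamma>" using \<Gamma>I[OF fin] by simp
  next
    fix u b n assume ub: "(u, b) \<in> \<Gamma>" and n: "u \<in> int_multiples rational_sum n"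
    obtain c where c: "finite {i. c i \<noteq> 0}" "u = (\<lambda>i. rat_of_int (c i))" "b = int_comb A y c"
      using \<Gamma>E[OF ub] by (elim exE conjE)
    show "b \<in> int_multiples A n"
    proof (cases "n = 0")
      case True
      then have "c = (\<lambda>_. 0)" using n c(2) by (simp add: fun_eq_iff restrict_def)
      then show ?thesis using c(3) int_multiples_one by simp
    qed (use comb c in simp)
  qed
  from extend_height_graph[OF comm_group_rational_sum comm_group_axioms tf sat this] obtain h where
    h: "h \<in> hom rational_sum A" "\<forall>(u, b) \<in> \<Gamma>. h u = b" by blast
  interpret h: group_hom rational_sum A h using h(1) by unfold_locales
  have h_comb: "h (\<lambda>i. rat_of_int (c i)) = int_comb A y c" if "finite {i. c i \<noteq> 0}" for c
    using h(2) \<Gamma>I[OF that] by auto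
  have h_div: "h u \<in> divisible_part A" if u: "u \<in> carrier rational_sum" for u
    unfolding divisible_part_def
  proof (rule INT_I)
    fix n :: int assume "n \<in> {n. n \<noteq> 0}"
    then have n: "n \<noteq> 0" by simp
    let ?w = "\<lambda>i. u i / rat_of_int n"
    have w: "?w \<in> carrier rational_sum" using u by (simp add: carrier_rational_sum n)
    have "?w [^]\<^bsub>rational_sum\<^esub> n = u" using n by (simp add: rational_sum_int_pow[OF w])
    then have "h u = h ?w [^] n" using h.hom_int_pow[OF w, of n] by simp
    then show "h u \<in> int_multiples A n" using int_multiplesI[of "h ?w" n] w by simp
  qed
  have inj: "inj_on h (carrier rational_sum)"
    unfolding h.inj_on_one_iff
  proof (intro allI impI)
    fix u assume u: "u \<in> carrier rational_sum" "h u = \<one>"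
    define S where "S = {i. u i \<noteq> 0}"
    have S: "finite S" using u(1) by (simp add: carrier_rational_sum S_def)
    \<comment> \<open>a common denominator\<close>
    define N where "N = (\<Prod>i\<in>S. snd (quotient_of (u i)))"
    have N0: "N \<noteq> 0" using S quotient_of_denom_pos' by (auto simp: N_def) (metis less_irrefl)
    have "\<exists>k::int. of_int N * u i = of_int k" for i
    proof (cases "i \<in> S")
      case True
      then have "snd (quotient_of (u i)) dvd N" unfolding N_def using S by (intro dvd_prodI)
      then obtain l where l: "N = snd (quotient_of (u i)) * l" by (auto elim: dvdE)
      have "u i = of_int (fst (quotient_of (u i))) / of_int (snd (quotient_of (u i)))"
        by (rule quotient_of_div) simp
      moreover have "rat_of_int (snd (quotient_of (u i))) \<noteq> 0" using quotient_of_denom_pos'[of "u i"] by simp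
      ultimately have "of_int N * u i = of_int (l * fst (quotient_of (u i)))"
        unfolding l by (simp add: field_simps)
      then show ?thesis by blast
    qed (auto simp: S_def intro: exI[of _ 0])
    then obtain c where c: "\<And>i. of_int N * u i = of_int (c i)" by metis
    have fin: "finite {i. c i \<noteq> 0}"
    proof (rule finite_subset[OF _ S])
      show "{i. c i \<noteq> 0} \<subseteq> S" using c N0 by (auto simp: S_def) (metis mult_zero_right of_int_eq_0_iff)
    qed
    have "u [^]\<^bsub>rational_sum\<^esub> N = (\<lambda>i. rat_of_int (c i))" by (simp add: rational_sum_int_pow[OF u(1)] c)
    then have "int_comb A y c = h u [^] N" using h_comb[OF fin] h.hom_int_pow[OF u(1), of N] by simp
    then have "int_comb A y c \<in> int_multiples A 0" using u(2) by simp
    then have "0 dvd c i" for i using independent_modD[OF y(1) fin] by simp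
    then have "u i = 0" for i using c[of i] N0 by simp
    then show "u = \<one>\<^bsub>rational_sum\<^esub>" by (simp add: fun_eq_iff restrict_def)
  qed
  have surj: "h ` carrier rational_sum = divisible_part A"
  proof
    show "h ` carrier rational_sum \<subseteq> divisible_part A" using h_div by blast
    show "divisible_part A \<subseteq> h ` carrier rational_sum"
    proof
      fix v assume v: "v \<in> divisible_part A"
      then obtain e :: int and c where c: "e \<noteq> 0" "finite {i. c i \<noteq> 0}" "v [^] e = int_comb A y c"
        using span by blast
      let ?u = "\<lambda>i. rat_of_int (c i) / rat_of_int e"
      have u: "?u \<in> carrier rational_sum" using c(1,2) by (simp add: carrier_rational_sum)
      have "?u [^]\<^bsub>rational_sum\<^esub> e = (\<lambda>i. rat_of_int (c i))" using c(1) by (simp add: rational_sum_int_pow[OF u])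
      then have "h ?u [^] e = v [^] e" using h.hom_int_pow[OF u, of e] h_comb[OF c(2)] c(3) by simp
      then have "h ?u = v" using torsion_free_pow_eq[OF tf _ _ _ c(1)] u v divisible_part_subset by auto
      then show "v \<in> h ` carrier rational_sum" using u by blast
    qed
  qed
  have "h \<in> hom rational_sum (A\<lparr>carrier := divisible_part A\<rparr>)"
    by (rule homI) (use h_div h.hom_mult in auto)
  then have "h \<in> iso rational_sum (A\<lparr>carrier := divisible_part A\<rparr>)"
    using inj surj by (simp add: iso_def bij_betw_def)
  then show ?thesis unfolding is_iso_def by blast
qed

end


section \<open>Torsion-free numbers and classification\<close>

lemma finsum_vector_space_mod: "finsum (vector_space_mod V) f F = finprod V f F"
  by (simp add: finsum_def finprod_def vector_space_mod_def)

lemma (in comm_group) inv_mult_cancel: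
  assumes "x \<in> carrier G" "y \<in> carrier G" "z \<in> carrier G"
  shows "inv (x \<otimes> z) \<otimes> (y \<otimes> z) = inv x \<otimes> y"
proof -
  have "inv (x \<otimes> z) \<otimes> (y \<otimes> z) = inv x \<otimes> (inv z \<otimes> (z \<otimes> y))"
    using assms by (simp add: inv_mult m_assoc m_comm[of y z])
  also have "inv z \<otimes> (z \<otimes> y) = y" using assms by (simp flip: m_assoc)
  finally show ?thesis .
qed

context saturated_group
begin

text \<open>As \<open>A\<close> has no torsion, the quotient in question is \<open>A/pA\<close>, and a basis modulo \<open>p\<close> that is indexed by the reals
  maps injectively to a basis of it. The coefficients have to be reduced to \<open>{0..p - 1}\<close>.\<close>

theorem torsion_free_number_continuum:
  assumes p: "prime p"
  shows "has_torsion_free_number p A (UNIV :: real set)"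
proof -
  define N where "N = multiples A p (carrier A) <#> torsion_subgroup A"
  have N_eq: "N = int_multiples A (int p)"
    using int_multiples_closed by (auto simp: N_def torsion_subgroup_trivial set_mult_def simp flip: int_multiples_of_nat)
  have sN: "subgroup N A" unfolding N_eq by (rule subgroup_int_multiples)
  then have nN: "N \<lhd> A" by (simp add: normal_iff_subgroup)
  let ?M = "A Mod N"
  interpret M: comm_group ?M by (rule abelian_FactGroup[OF sN])
  define q where "q a = N #> a" for a
  have q_hom: "q \<in> hom A ?M" unfolding q_def[abs_def] by (rule normal.r_coset_hom_Mod[OF nN])
  interpret q: group_hom A ?M q using q_hom by unfold_locales
  have q_one: "q a = \<one>\<^bsub>?M\<^esub> \<longleftrightarrow> a \<in> N" if "a \<in> carrier A" for a
    using coset_join1[OF _ that sN] coset_join2[OF that sN] subgroup.subset[OF sN] by (auto simp: q_def)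
  have q_surj: "\<exists>a \<in> carrier A. X = q a" if "X \<in> carrier ?M" for X
    using that by (auto simp: carrier_FactGroup q_def)
  have kill: "X [^]\<^bsub>?M\<^esub> (int p * n) = \<one>\<^bsub>?M\<^esub>" if X: "X \<in> carrier ?M" for X n
  proof -
    obtain a where a: "a \<in> carrier A" "X = q a" using q_surj[OF X] by blast
    have "X [^]\<^bsub>?M\<^esub> (int p * n) = q ((a [^] n) [^] int p)"
      using a q.hom_int_pow[OF a(1), of "int p * n"] by (simp add: int_pow_pow mult.commute)
    also have "\<dots> = \<one>\<^bsub>?M\<^esub>" using a(1) int_multiplesI[of "a [^] n" "int p"] q_one by (simp add: N_eq)
    finally show ?thesis .
  qed
  have n1: "\<not> is_unit (int p)" using p by (metis not_prime_unit prime_nat_int_transfer)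
  obtain x :: "real \<Rightarrow> 'a" where x: "independent_mod A (int p) x UNIV" "spans_mod A (int p) x"
    using exists_basis_mod_prime[of "int p"] p by auto
  have xr: "range x \<subseteq> carrier A" using x(1) by (auto simp: independent_mod_def)
  have x': "x \<in> F \<rightarrow> carrier A" for F using xr by auto
  define y where "y i = q (x i)" for i
  have yc: "y i \<in> carrier ?M" for i
    using q.hom_closed[OF range_subsetD[OF xr]] by (simp add: y_def)
  have y': "y \<in> F \<rightarrow> carrier ?M" for F using yc by auto
  have y_comb: "int_comb ?M y c = q (int_comb A x c)" for c
  proof -
    have "q (int_comb A x c) = finprod ?M (\<lambda>i. q (x i [^] c i)) {i. c i \<noteq> 0}"
      unfolding int_comb_def by (rule hom_finprod[OF q_hom M.comm_group_axioms]) (use xr in auto)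
    also have "\<dots> = finprod ?M (\<lambda>i. y i [^]\<^bsub>?M\<^esub> c i) {i. c i \<noteq> 0}"
      by (rule M.finprod_cong') (use xr yc in \<open>auto simp: y_def q.hom_int_pow image_subset_iff\<close>)
    finally show ?thesis by (simp add: int_comb_def)
  qed
  have comb_c: "int_comb A x c \<in> carrier A" for c by (rule int_comb_closed[OF x'])
  have y_ind: "int p dvd c i" if "finite {i. c i \<noteq> 0}" "int_comb ?M y c = \<one>\<^bsub>?M\<^esub>" for c i
  proof -
    have "int_comb A x c \<in> int_multiples A (int p)"
      using that(2) q_one[OF comb_c] unfolding y_comb N_eq[symmetric] by blast
    then show ?thesis using independent_modD[OF x(1) that(1)] by blast
  qed
  have M_mult: "int_multiples ?M (int p) = {\<one>\<^bsub>?M\<^esub>}"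
  proof
    show "int_multiples ?M (int p) \<subseteq> {\<one>\<^bsub>?M\<^esub>}"
    proof
      fix X assume "X \<in> int_multiples ?M (int p)"
      then obtain Y where "Y \<in> carrier ?M" "X = Y [^]\<^bsub>?M\<^esub> int p" by (rule M.int_multiplesE)
      then show "X \<in> {\<one>\<^bsub>?M\<^esub>}" using kill[of Y 1] by simp
    qed
  qed (use M.int_multiples_one[of "int p"] in blast)
  have "independent_mod ?M (int p) y UNIV"
    unfolding independent_mod_def M_mult using y' y_ind by blast
  then have y_inj: "inj y" by (rule M.independent_mod_inj[OF _ n1])
  have res: "carrier (residue_ring (int p)) = {0..int p - 1}" "\<zero>\<^bsub>residue_ring (int p)\<^esub> = 0"
    by (simp_all add: residue_ring_def)
  have "module_basis (residue_ring (int p)) (vector_space_mod ?M) (range y)"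
    unfolding module_basis_def
  proof (intro conjI ballI allI impI; (elim conjE)?)
    show "range y \<subseteq> carrier (vector_space_mod ?M)" using yc by (auto simp: vector_space_mod_def)
  next
    fix X assume "X \<in> carrier (vector_space_mod ?M)"
    then have X: "X \<in> carrier ?M" by (simp add: vector_space_mod_def)
    then obtain v where v: "v \<in> carrier A" "X = q v" using q_surj by blast
    obtain c where c: "finite {i. c i \<noteq> 0}" "v \<otimes> int_comb A x c \<in> int_multiples A (int p)"
      using x(2) v(1) unfolding spans_mod_def by blast
    have "X \<otimes>\<^bsub>?M\<^esub> int_comb ?M y c = \<one>\<^bsub>?M\<^esub>"
    proof -
      have "q (v \<otimes> int_comb A x c) = \<one>\<^bsub>?M\<^esub>"
        using c(2) q_one[OF m_closed[OF v(1) comb_c]] unfolding N_eq[symmetric] by blast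
      then show ?thesis unfolding y_comb v(2) using q.hom_mult[OF v(1) comb_c] by (simp only:)
    qed
    then have X_eq: "X = inv\<^bsub>?M\<^esub> int_comb ?M y c"
      using X M.int_comb_closed[OF y'] by (metis M.inv_equality)
    define d where "d b = (- c (inv_into UNIV y b)) mod int p" for b
    define F where "F = y ` {i. c i \<noteq> 0}"
    have "(\<Oplus>\<^bsub>vector_space_mod ?M\<^esub>b\<in>F. d b \<odot>\<^bsub>vector_space_mod ?M\<^esub> b) = finprod ?M (\<lambda>b. b [^]\<^bsub>?M\<^esub> d b) F"
      by (simp add: finsum_vector_space_mod) (simp add: vector_space_mod_def)
    also have "\<dots> = finprod ?M (\<lambda>i. y i [^]\<^bsub>?M\<^esub> d (y i)) {i. c i \<noteq> 0}"
      unfolding F_def by (rule M.finprod_reindex) (use yc y_inj in \<open>auto intro: inj_on_subset\<close>)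
    also have "\<dots> = finprod ?M (\<lambda>i. y i [^]\<^bsub>?M\<^esub> (c i * - 1)) {i. c i \<noteq> 0}"
    proof (rule M.finprod_cong'[OF refl])
      show "(\<lambda>i. y i [^]\<^bsub>?M\<^esub> (c i * - 1)) \<in> {i. c i \<noteq> 0} \<rightarrow> carrier ?M" using yc by auto
      fix i
      have "y i [^]\<^bsub>?M\<^esub> (- c i) = y i [^]\<^bsub>?M\<^esub> (int p * (- c i div int p) + (- c i) mod int p)" by simp
      also have "\<dots> = y i [^]\<^bsub>?M\<^esub> ((- c i) mod int p)"
        by (simp only: M.int_pow_mult[OF yc] kill[OF yc] M.l_one[OF M.int_pow_closed[OF yc]])
      finally show "y i [^]\<^bsub>?M\<^esub> d (y i) = y i [^]\<^bsub>?M\<^esub> (c i * - 1)"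
        using y_inj by (simp add: d_def)
    qed
    also have "\<dots> = int_comb ?M y (\<lambda>i. c i * - 1)"
      by (rule M.int_comb_superset[symmetric]) (use c(1) yc in auto)
    also have "\<dots> = inv\<^bsub>?M\<^esub> int_comb ?M y c"
      using M.int_comb_scale[OF c(1) y', of "-1"] M.int_comb_closed[OF y', of c] by (simp add: M.int_pow_neg)
    finally have "X = (\<Oplus>\<^bsub>vector_space_mod ?M\<^esub>b\<in>F. d b \<odot>\<^bsub>vector_space_mod ?M\<^esub> b)" using X_eq by simp
    moreover have "d \<in> F \<rightarrow> carrier (residue_ring (int p))"
      using prime_gt_0_nat[OF p] by (auto simp: res d_def)
    moreover have "finite F" "F \<subseteq> range y" using c(1) by (auto simp: F_def)
    ultimately show "\<exists>F a. finite F \<and> F \<subseteq> range y \<and> a \<in> F \<rightarrow> carrier (residue_ring (int p))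
       \<and> X = (\<Oplus>\<^bsub>vector_space_mod ?M\<^esub>b\<in>F. a b \<odot>\<^bsub>vector_space_mod ?M\<^esub> b)"
      by (intro exI[of _ F] exI[of _ d]) simp
  next
    fix F a b
    assume F: "finite F" "F \<subseteq> range y" "a \<in> F \<rightarrow> carrier (residue_ring (int p))"
      "(\<Oplus>\<^bsub>vector_space_mod ?M\<^esub>b\<in>F. a b \<odot>\<^bsub>vector_space_mod ?M\<^esub> b) = \<zero>\<^bsub>vector_space_mod ?M\<^esub>" and b: "b \<in> F"
    define J where "J = y -` F"
    have J: "finite J" "F = y ` J" using F(1,2) finite_vimageI[OF F(1) y_inj] by (auto simp: J_def)
    define c where "c i = (if i \<in> J then a (y i) else 0)" for i
    have supp: "{i. c i \<noteq> 0} \<subseteq> J" by (auto simp: c_def)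
    have "int_comb ?M y c = finprod ?M (\<lambda>i. y i [^]\<^bsub>?M\<^esub> c i) J"
      by (rule M.int_comb_superset[OF J(1) supp y'])
    also have "\<dots> = finprod ?M (\<lambda>i. y i [^]\<^bsub>?M\<^esub> a (y i)) J"
      by (rule M.finprod_cong') (use yc in \<open>auto simp: c_def\<close>)
    also have "\<dots> = finprod ?M (\<lambda>b. b [^]\<^bsub>?M\<^esub> a b) F"
      unfolding J(2) by (rule M.finprod_reindex[symmetric]) (use yc y_inj in \<open>auto intro: inj_on_subset\<close>)
    also have "\<dots> = \<one>\<^bsub>?M\<^esub>"
      using F(4) unfolding finsum_vector_space_mod by (simp add: vector_space_mod_def)
    finally have "int p dvd c i" for i using y_ind finite_subset[OF supp J(1)] by blast
    moreover obtain i where i: "i \<in> J" "b = y i" using b J(2) by blast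
    ultimately have "int p dvd a b" using i by (metis c_def)
    moreover have "a b \<in> {0..int p - 1}" using F(3) b res by auto
    ultimately have "a b = 0" using zdvd_imp_le[of "int p" "a b"] by (cases "a b = 0") auto
    then show "a b = \<zero>\<^bsub>residue_ring (int p)\<^esub>" by (simp add: res)
  qed
  moreover have "range y \<approx> (UNIV :: real set)"
    using y_inj by (simp add: inj_on_image_eqpoll_self)
  ultimately show ?thesis
    unfolding has_torsion_free_number_def has_dimension_def N_def[symmetric] by blast
qed

end

text \<open>The partial map \<open>\<Gamma>\<close> is defined on the sum of the divisible part of \<open>A\<close> and the span of the \<open>x i\<close>. It preserves
  divisibility by \<open>n \<noteq> 0\<close> since on both sides this means that \<open>n\<close> divides all coefficients of the
  combination. Its extension \<open>h\<close> also reflects divisibility, because modulo \<open>n\<close> every element is a combination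
  of the \<open>x i\<close>. So the kernel of \<open>h\<close> lies in the divisible part, where \<open>h\<close> is injective.
  For surjectivity, \<open>b\<close> is approximated modulo every factorial by values of \<open>h\<close>, the
  approximating arguments have a common limit \<open>z\<close>, and the remaining error is in the divisible
  part.\<close>

theorem saturated_groups_isomorphic:
  assumes A: "saturated_group A" and B: "saturated_group B"
  shows "A \<cong> B"
proof -
  interpret A: saturated_group A by fact
  interpret B: saturated_group B by fact
  let ?Q = "rational_sum"
  interpret Q: comm_group ?Q by (rule comm_group_rational_sum)
  obtain x :: "real \<Rightarrow> 'a" where xr: "range x \<subseteq> carrier A"
    and xi: "\<And>n. n \<noteq> 0 \<Longrightarrow> independent_mod A n x UNIV" and xs: "\<And>n. n \<noteq> 0 \<Longrightarrow> spans_mod A n x"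
    using A.exists_basis_mod_all by blast
  obtain y :: "real \<Rightarrow> 'c" where yr: "range y \<subseteq> carrier B"
    and yi: "\<And>n. n \<noteq> 0 \<Longrightarrow> independent_mod B n y UNIV" and ys: "\<And>n. n \<noteq> 0 \<Longrightarrow> spans_mod B n y"
    using B.exists_basis_mod_all by blast
  have x': "x \<in> F \<rightarrow> carrier A" and y': "y \<in> F \<rightarrow> carrier B" for F using xr yr by auto
  have xc: "int_comb A x c \<in> carrier A" and yc: "int_comb B y c \<in> carrier B" for c
    using A.int_comb_closed[OF x'] B.int_comb_closed[OF y'] by auto
  obtain \<alpha> where \<alpha>: "\<alpha> \<in> hom ?Q (A\<lparr>carrier := divisible_part A\<rparr>)" "bij_betw \<alpha> (carrier ?Q) (divisible_part A)"
    using A.rational_sum_iso_divisible_part by (auto simp: is_iso_def iso_def)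
  obtain \<beta> where \<beta>: "\<beta> \<in> hom ?Q (B\<lparr>carrier := divisible_part B\<rparr>)" "bij_betw \<beta> (carrier ?Q) (divisible_part B)"
    using B.rational_sum_iso_divisible_part by (auto simp: is_iso_def iso_def)
  have \<alpha>d: "\<alpha> u \<in> divisible_part A" and \<beta>d: "\<beta> u \<in> divisible_part B" if "u \<in> carrier ?Q" for u
    using \<alpha>(2) \<beta>(2) that by (auto simp: bij_betw_def)
  have \<alpha>h: "\<alpha> \<in> hom ?Q A"
    by (rule homI) (use \<alpha>d A.divisible_part_subset hom_mult[OF \<alpha>(1)] in auto)
  have \<beta>h: "\<beta> \<in> hom ?Q B"
    by (rule homI) (use \<beta>d B.divisible_part_subset hom_mult[OF \<beta>(1)] in auto)
  interpret \<alpha>: group_hom ?Q A \<alpha> using \<alpha>h by unfold_locales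
  interpret \<beta>: group_hom ?Q B \<beta> using \<beta>h by unfold_locales
  have \<alpha>1: "u = \<one>\<^bsub>?Q\<^esub>" if "u \<in> carrier ?Q" "\<alpha> u = \<one>\<^bsub>A\<^esub>" for u
    using \<alpha>(2) that \<alpha>.inj_on_one_iff unfolding bij_betw_def by blast
  have \<beta>1: "u = \<one>\<^bsub>?Q\<^esub>" if "u \<in> carrier ?Q" "\<beta> u = \<one>\<^bsub>B\<^esub>" for u
    using \<beta>(2) that \<beta>.inj_on_one_iff unfolding bij_betw_def by blast
  define \<Gamma> where "\<Gamma> = {(\<alpha> u \<otimes>\<^bsub>A\<^esub> int_comb A x c, \<beta> u \<otimes>\<^bsub>B\<^esub> int_comb B y c) | u c.
      u \<in> carrier ?Q \<and> finite {i. c i \<noteq> 0}}"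
  have \<Gamma>I: "(\<alpha> u \<otimes>\<^bsub>A\<^esub> int_comb A x c, \<beta> u \<otimes>\<^bsub>B\<^esub> int_comb B y c) \<in> \<Gamma>"
    if "u \<in> carrier ?Q" "finite {i. c i \<noteq> 0}" for u c using that unfolding \<Gamma>_def by blast
  have \<Gamma>E: "\<exists>u c. u \<in> carrier ?Q \<and> finite {i. c i \<noteq> 0} \<and> a = \<alpha> u \<otimes>\<^bsub>A\<^esub> int_comb A x c
      \<and> b = \<beta> u \<otimes>\<^bsub>B\<^esub> int_comb B y c" if "(a, b) \<in> \<Gamma>" for a b
    using that unfolding \<Gamma>_def by simp metis
  have "height_graph A B \<Gamma>"
    unfolding height_graph_def
  proof (intro conjI allI impI; (elim conjE)?)
    show "\<Gamma> \<subseteq> carrier A \<times> carrier B"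
      unfolding \<Gamma>_def using xc yc by auto
    show "(\<one>\<^bsub>A\<^esub>, \<one>\<^bsub>B\<^esub>) \<in> \<Gamma>" using \<Gamma>I[OF Q.one_closed, of "\<lambda>_. 0"]
      by (simp add: \<alpha>.hom_one \<beta>.hom_one del: one_sum_group)
    fix a b a' b' assume ab: "(a, b) \<in> \<Gamma>" "(a', b') \<in> \<Gamma>"
    obtain u c where 1: "u \<in> carrier ?Q" "finite {i. c i \<noteq> 0}" "a = \<alpha> u \<otimes>\<^bsub>A\<^esub> int_comb A x c"
      "b = \<beta> u \<otimes>\<^bsub>B\<^esub> int_comb B y c" using \<Gamma>E[OF ab(1)] by (elim exE conjE)
    obtain u' c' where 2: "u' \<in> carrier ?Q" "finite {i. c' i \<noteq> 0}" "a' = \<alpha> u' \<otimes>\<^bsub>A\<^esub> int_comb A x c'"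
      "b' = \<beta> u' \<otimes>\<^bsub>B\<^esub> int_comb B y c'" using \<Gamma>E[OF ab(2)] by (elim exE conjE)
    let ?u = "u \<otimes>\<^bsub>?Q\<^esub> inv\<^bsub>?Q\<^esub> u'" and ?c = "\<lambda>i. c i - c' i"
    have u: "?u \<in> carrier ?Q" using 1 2 Q.m_closed Q.inv_closed by blast
    have "a \<otimes>\<^bsub>A\<^esub> inv\<^bsub>A\<^esub> a' = \<alpha> ?u \<otimes>\<^bsub>A\<^esub> int_comb A x ?c"
    proof -
      have "\<alpha> ?u = \<alpha> u \<otimes>\<^bsub>A\<^esub> inv\<^bsub>A\<^esub> \<alpha> u'"
        using \<alpha>.hom_mult[OF 1(1) Q.inv_closed[OF 2(1)]] \<alpha>.hom_inv[OF 2(1)] by (simp only:)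
      then show ?thesis
        using 1 2 xc \<alpha>.hom_closed by (simp only: A.int_comb_diff[OF 1(2) 2(2) xr] A.inv_mult A.m_ac A.inv_closed A.m_closed)
    qed
    moreover have "b \<otimes>\<^bsub>B\<^esub> inv\<^bsub>B\<^esub> b' = \<beta> ?u \<otimes>\<^bsub>B\<^esub> int_comb B y ?c"
    proof -
      have "\<beta> ?u = \<beta> u \<otimes>\<^bsub>B\<^esub> inv\<^bsub>B\<^esub> \<beta> u'"
        using \<beta>.hom_mult[OF 1(1) Q.inv_closed[OF 2(1)]] \<beta>.hom_inv[OF 2(1)] by (simp only:)
      then show ?thesis
        using 1 2 yc \<beta>.hom_closed by (simp only: B.int_comb_diff[OF 1(2) 2(2) yr] B.inv_mult B.m_ac B.inv_closed B.m_closed)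
    qed
    ultimately show "(a \<otimes>\<^bsub>A\<^esub> inv\<^bsub>A\<^esub> a', b \<otimes>\<^bsub>B\<^esub> inv\<^bsub>B\<^esub> b') \<in> \<Gamma>"
      using \<Gamma>I[OF u finite_support_diff[OF 1(2) 2(2)]] by (simp only:)
  next
    fix a b n assume ab: "(a, b) \<in> \<Gamma>" and n: "a \<in> int_multiples A n"
    obtain u c where 1: "u \<in> carrier ?Q" "finite {i. c i \<noteq> 0}" "a = \<alpha> u \<otimes>\<^bsub>A\<^esub> int_comb A x c"
      "b = \<beta> u \<otimes>\<^bsub>B\<^esub> int_comb B y c" using \<Gamma>E[OF ab] by (elim exE conjE)
    have dvd: "m dvd c i" if m: "m \<noteq> 0" "a \<in> int_multiples A m" for m i
    proof -
      have "int_comb A x c \<in> int_multiples A m"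
        using A.int_multiples_div[OF _ A.divisible_partD[OF \<alpha>d[OF 1(1)] m(1)] xc] m(2) 1(3)
        by (simp add: A.m_comm xc 1(1) \<alpha>.hom_closed)
      then show ?thesis using independent_modD[OF xi[OF m(1)] 1(2)] by blast
    qed
    show "b \<in> int_multiples B n"
    proof (cases "n = 0")
      case True
      then have a1: "a = \<one>\<^bsub>A\<^esub>" using n by simp
      have "c i = 0" for i
      proof -
        \<comment> \<open>a nonzero modulus that is too large to divide a nonzero coefficient\<close>
        have "\<bar>c i\<bar> + 1 dvd c i"
          by (rule dvd) (use a1 A.int_multiples_one in auto)
        then show ?thesis using zdvd_imp_le[of "\<bar>c i\<bar> + 1" "\<bar>c i\<bar>"] by fastforce
      qed
      then have c0: "c = (\<lambda>_. 0)" by auto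
      then have "u = \<one>\<^bsub>?Q\<^esub>" using \<alpha>1[OF 1(1)] 1(1,3) a1 \<alpha>.hom_closed by simp
      then have "b = \<one>\<^bsub>B\<^esub>" using 1(4) c0 \<beta>.hom_one by simp
      then show ?thesis by (simp add: B.int_multiples_one)
    next
      case False
      then have "int_comb B y c \<in> int_multiples B n"
        using dvd n yr by (intro B.int_comb_dvd) auto
      then show ?thesis unfolding 1(4)
        using B.divisible_partD[OF \<beta>d[OF 1(1)] False] B.int_multiples_mult by blast
    qed
  qed
  from extend_height_graph[OF A.comm_group_axioms B.comm_group_axioms B.tf B.sat this] obtain h where
    h: "h \<in> hom A B" "\<forall>(a, b) \<in> \<Gamma>. h a = b" by blast
  interpret h: group_hom A B h using h(1) by unfold_locales
  have h\<Gamma>: "h a = b" if "(a, b) \<in> \<Gamma>" for a b using h(2) that by auto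
  have h_comb: "h (int_comb A x c) = int_comb B y c" if "finite {i. c i \<noteq> 0}" for c
    using h\<Gamma>[OF \<Gamma>I[OF Q.one_closed that]] xc yc by (simp add: \<alpha>.hom_one \<beta>.hom_one del: one_sum_group)
  have h_\<alpha>: "h (\<alpha> u) = \<beta> u" if "u \<in> carrier ?Q" for u
    using h\<Gamma>[OF \<Gamma>I[OF that, of "\<lambda>_. 0"]] that \<alpha>.hom_closed[OF that] \<beta>.hom_closed[OF that] by simp
  have h_mult: "h a \<in> int_multiples B n" if "a \<in> int_multiples A n" for a n
    using that B.int_multiplesI h.hom_int_pow by (auto elim!: A.int_multiplesE)
  have reflect: "a \<in> int_multiples A n" if a: "a \<in> carrier A" "h a \<in> int_multiples B n" and n: "n \<noteq> 0" for a n
  proof -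
    obtain c where c: "finite {i. c i \<noteq> 0}" "a \<otimes>\<^bsub>A\<^esub> int_comb A x c \<in> int_multiples A n"
      using xs[OF n] a(1) unfolding spans_mod_def by blast
    have "h a \<otimes>\<^bsub>B\<^esub> int_comb B y c \<in> int_multiples B n"
      using h_mult[OF c(2)] a(1) xc by (simp add: h_comb[OF c(1)])
    then have "int_comb B y c \<in> int_multiples B n"
      using B.int_multiples_div[OF _ a(2) yc] a(1) yc by (simp add: B.m_comm)
    then have "n dvd c i" for i using independent_modD[OF yi[OF n] c(1)] by blast
    then have "int_comb A x c \<in> int_multiples A n" using xr by (rule A.int_comb_dvd)
    then show ?thesis using A.int_multiples_div[OF c(2) _ a(1)] by blast
  qed
  have "inj_on h (carrier A)"
    unfolding h.inj_on_one_iff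
  proof (intro allI impI)
    fix a assume a: "a \<in> carrier A" "h a = \<one>\<^bsub>B\<^esub>"
    then have "a \<in> divisible_part A"
      unfolding divisible_part_def using reflect[OF a(1)] B.int_multiples_one by auto
    then obtain u where u: "u \<in> carrier ?Q" "a = \<alpha> u" using \<alpha>(2) by (auto simp: bij_betw_def)
    then have "\<beta> u = \<one>\<^bsub>B\<^esub>" using a(2) h_\<alpha> by simp
    then show "a = \<one>\<^bsub>A\<^esub>" using \<beta>1[OF u(1)] u(2) \<alpha>.hom_one by (simp only:)
  qed
  moreover have "h ` carrier A = carrier B"
  proof
    show "h ` carrier A \<subseteq> carrier B" using h.hom_closed by auto
    show "carrier B \<subseteq> h ` carrier A"
    proof
      fix b assume b: "b \<in> carrier B"
      have approx: "\<exists>a \<in> carrier A. h a \<otimes>\<^bsub>B\<^esub> b \<in> int_multiples B n" if n: "n \<noteq> 0" for n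
      proof -
        obtain c where c: "finite {i. c i \<noteq> 0}" "b \<otimes>\<^bsub>B\<^esub> int_comb B y c \<in> int_multiples B n"
          using ys[OF n] b unfolding spans_mod_def by blast
        then show ?thesis using xc b yc by (intro bexI[of _ "int_comb A x c"]) (auto simp: h_comb B.m_comm)
      qed
      then have "\<exists>a. a \<in> carrier A \<and> h a \<otimes>\<^bsub>B\<^esub> b \<in> int_multiples B (fact j)" for j :: nat
        using fact_nonzero by blast
      then obtain a where a: "\<And>j::nat. a j \<in> carrier A" "\<And>j. h (a j) \<otimes>\<^bsub>B\<^esub> b \<in> int_multiples B (fact j)" by metis
      have "\<exists>z \<in> carrier A. \<forall>j. inv\<^bsub>A\<^esub> a j \<otimes>\<^bsub>A\<^esub> z [^]\<^bsub>A\<^esub> (1::int) \<in> int_multiples A (fact j)"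
      proof (rule solves_congruencesD[OF A.sat])
        show "inv\<^bsub>A\<^esub> a j \<in> carrier A" for j using a(1) by simp
        show "(fact j :: int) \<noteq> 0" for j by simp
        fix N
        have "inv\<^bsub>A\<^esub> a j \<otimes>\<^bsub>A\<^esub> a N [^]\<^bsub>A\<^esub> (1::int) \<in> int_multiples A (fact j)" if "j \<le> N" for j
        proof (rule reflect)
          have "h (a N) \<otimes>\<^bsub>B\<^esub> b \<in> int_multiples B (fact j)"
            using a(2)[of N] B.int_multiples_dvd[OF fact_dvd[OF that]] by blast
          then have "inv\<^bsub>B\<^esub> (h (a j) \<otimes>\<^bsub>B\<^esub> b) \<otimes>\<^bsub>B\<^esub> (h (a N) \<otimes>\<^bsub>B\<^esub> b) \<in> int_multiples B (fact j)"
            by (rule B.int_multiples_mult[OF B.int_multiples_inv[OF a(2)[of j]]])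
          also have "inv\<^bsub>B\<^esub> (h (a j) \<otimes>\<^bsub>B\<^esub> b) \<otimes>\<^bsub>B\<^esub> (h (a N) \<otimes>\<^bsub>B\<^esub> b)
              = inv\<^bsub>B\<^esub> h (a j) \<otimes>\<^bsub>B\<^esub> h (a N)"
            by (rule B.inv_mult_cancel) (use a(1) b in auto)
          also have "\<dots> = h (inv\<^bsub>A\<^esub> a j \<otimes>\<^bsub>A\<^esub> a N [^]\<^bsub>A\<^esub> (1::int))" using a(1) b by simp
          finally show "h (inv\<^bsub>A\<^esub> a j \<otimes>\<^bsub>A\<^esub> a N [^]\<^bsub>A\<^esub> (1::int)) \<in> int_multiples B (fact j)" .
        qed (use a(1) in auto)
        then show "\<exists>z \<in> carrier A. \<forall>j\<le>N. inv\<^bsub>A\<^esub> a j \<otimes>\<^bsub>A\<^esub> z [^]\<^bsub>A\<^esub> (1::int) \<in> int_multiples A (fact j)"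
          using a(1) by blast
      qed
      then obtain z where z: "z \<in> carrier A"
        "\<And>j. inv\<^bsub>A\<^esub> a j \<otimes>\<^bsub>A\<^esub> z [^]\<^bsub>A\<^esub> (1::int) \<in> int_multiples A (fact j)" by blast
      have "h z \<otimes>\<^bsub>B\<^esub> b \<in> int_multiples B n" if n: "n \<noteq> 0" for n
      proof -
        let ?j = "nat \<bar>n\<bar>"
        have "(h (a ?j) \<otimes>\<^bsub>B\<^esub> b) \<otimes>\<^bsub>B\<^esub> h (inv\<^bsub>A\<^esub> a ?j \<otimes>\<^bsub>A\<^esub> z) \<in> int_multiples B (fact ?j)"
          by (rule B.int_multiples_mult[OF a(2) h_mult]) (use z(2)[of ?j] z(1) in simp)
        also have "(h (a ?j) \<otimes>\<^bsub>B\<^esub> b) \<otimes>\<^bsub>B\<^esub> h (inv\<^bsub>A\<^esub> a ?j \<otimes>\<^bsub>A\<^esub> z)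
            = inv\<^bsub>B\<^esub> \<one>\<^bsub>B\<^esub> \<otimes>\<^bsub>B\<^esub> (h z \<otimes>\<^bsub>B\<^esub> b)"
        proof -
          have "h (a ?j) \<otimes>\<^bsub>B\<^esub> (inv\<^bsub>B\<^esub> h (a ?j) \<otimes>\<^bsub>B\<^esub> h z) = h z"
            using a(1) z(1) by (simp flip: B.m_assoc)
          then show ?thesis using a(1) b z(1)
            by (simp add: B.m_comm[of "h (a ?j)" b] B.m_assoc B.m_comm[of "h z" b])
        qed
        also have "\<dots> = h z \<otimes>\<^bsub>B\<^esub> b" using b z(1) by simp
        finally have "h z \<otimes>\<^bsub>B\<^esub> b \<in> int_multiples B (fact ?j)" .
        moreover have "n dvd fact ?j"
        proof -
          have "?j dvd fact ?j" using n by (intro dvd_fact) auto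
          then have "int ?j dvd int (fact ?j)" by (simp only: int_dvd_int_iff)
          then show ?thesis by (simp add: of_nat_fact)
        qed
        ultimately show ?thesis using B.int_multiples_dvd by blast
      qed
      then have "h z \<otimes>\<^bsub>B\<^esub> b \<in> divisible_part B" unfolding divisible_part_def by blast
      then obtain u where u: "u \<in> carrier ?Q" "h z \<otimes>\<^bsub>B\<^esub> b = \<beta> u" using \<beta>(2) unfolding bij_betw_def by blast
      have au: "\<alpha> u \<in> carrier A" using u(1) by (rule \<alpha>.hom_closed)
      have "b = inv\<^bsub>B\<^esub> h z \<otimes>\<^bsub>B\<^esub> (h z \<otimes>\<^bsub>B\<^esub> b)" using z(1) b by (simp flip: B.m_assoc)
      also have "\<dots> = h (inv\<^bsub>A\<^esub> z \<otimes>\<^bsub>A\<^esub> \<alpha> u)" using z(1) au u h_\<alpha>[OF u(1)] by simp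
      finally have "b = h (inv\<^bsub>A\<^esub> z \<otimes>\<^bsub>A\<^esub> \<alpha> u)" .
      moreover have "inv\<^bsub>A\<^esub> z \<otimes>\<^bsub>A\<^esub> \<alpha> u \<in> carrier A" using z(1) au by simp
      ultimately show "b \<in> h ` carrier A" by blast
    qed
  qed
  ultimately have "h \<in> iso A B" using h(1) by (simp add: iso_def bij_betw_def)
  then show ?thesis unfolding is_iso_def by blast
qed


section \<open>Quotients of groups of integer-valued functions\<close>

text \<open>With the identity of \<open>nat\<close> as \<open>r\<close> these are all integer sequences; with the minimum of two indices they
  are the integer matrices with finite rows and columns.\<close>

definition proper_functions :: "('s \<Rightarrow> nat) \<Rightarrow> ('s \<Rightarrow> int) set" where
  "proper_functions r = {f. \<forall>m. finite {i. f i \<noteq> 0 \<and> r i \<le> m}}"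

lemma proper_functionsD: "f \<in> proper_functions r \<Longrightarrow> finite {i. f i \<noteq> 0 \<and> r i \<le> m}"
  by (simp add: proper_functions_def)

lemma proper_functions_zero: "(\<lambda>_. 0) \<in> proper_functions r"
  by (simp add: proper_functions_def)

lemma proper_functions_support:
  assumes "f \<in> proper_functions r" "\<And>i. g i \<noteq> 0 \<Longrightarrow> f i \<noteq> 0"
  shows "g \<in> proper_functions r"
  unfolding proper_functions_def
proof (intro CollectI allI)
  fix m show "finite {i. g i \<noteq> 0 \<and> r i \<le> m}"
    by (rule finite_subset[OF _ proper_functionsD[OF assms(1), of m]]) (use assms(2) in auto)
qed

lemma proper_functions_add:
  assumes "f \<in> proper_functions r" "g \<in> proper_functions r"
  shows "(\<lambda>i. f i + g i) \<in> proper_functions r"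
  unfolding proper_functions_def
proof (intro CollectI allI)
  fix m
  have "{i. f i + g i \<noteq> 0 \<and> r i \<le> m} \<subseteq> {i. f i \<noteq> 0 \<and> r i \<le> m} \<union> {i. g i \<noteq> 0 \<and> r i \<le> m}" by auto
  then show "finite {i. f i + g i \<noteq> 0 \<and> r i \<le> m}"
    using finite_subset proper_functionsD[OF assms(1)] proper_functionsD[OF assms(2)] by blast
qed

lemma proper_functions_scale: "f \<in> proper_functions r \<Longrightarrow> (\<lambda>i. n * f i) \<in> proper_functions r"
  by (rule proper_functions_support) auto

lemma proper_functions_minus: "f \<in> proper_functions r \<Longrightarrow> (\<lambda>i. - f i) \<in> proper_functions r"
  by (rule proper_functions_support) auto

lemma proper_functions_sum:
  assumes "\<And>t. t \<in> T \<Longrightarrow> f t \<in> proper_functions r"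
  shows "(\<lambda>i. \<Sum>t\<in>T. f t i) \<in> proper_functions r"
  using assms
  by (induction T rule: infinite_finite_induct) (auto simp: proper_functions_zero proper_functions_add)

text \<open>The codes of the initial segments of \<open>T\<close>, as seen from each level \<open>n\<close>. Different sets have different
  segments from some level on, so the ranges of \<open>branch_code T\<close> are almost disjoint.\<close>

definition branch_code :: "nat set \<Rightarrow> nat \<Rightarrow> nat" where
  "branch_code T n = prod_encode (n, set_encode (T \<inter> {..<n}))"

lemma inj_branch_code: "inj (branch_code T)"
  by (auto simp: inj_def branch_code_def)

lemma branch_code_eq:
  assumes "branch_code T n = branch_code T' n'" shows "T \<inter> {..<n} = T' \<inter> {..<n}"
proof -
  have "n = n' \<and> set_encode (T \<inter> {..<n}) = set_encode (T' \<inter> {..<n'})"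
    using assms unfolding branch_code_def prod_encode_eq prod.inject .
  then have "set_encode (T \<inter> {..<n}) = set_encode (T' \<inter> {..<n})" by (elim conjE) simp
  then show ?thesis by (rule inj_onD[OF inj_on_set_encode]) auto
qed

text \<open>A function is coded by its graph, a subset of a countable set.\<close>

lemma functions_lepoll_reals: "(UNIV :: ('s::countable \<Rightarrow> int) set) \<lesssim> (UNIV :: real set)"
proof -
  let ?g = "\<lambda>f :: 's \<Rightarrow> int. to_nat ` range (\<lambda>s. (s, f s))"
  have "inj ?g"
  proof (rule injI)
    fix f f' assume "?g f = ?g f'"
    then have "range (\<lambda>s. (s, f s)) = range (\<lambda>s. (s, f' s))" by (simp add: inj_image_eq_iff)
    then show "f = f'" by (auto simp: fun_eq_iff set_eq_iff image_iff) 
  qed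
  then have "(UNIV :: ('s \<Rightarrow> int) set) \<lesssim> (UNIV :: nat set set)" unfolding lepoll_def by blast
  then show ?thesis using nat_sets_eqpoll_reals eqpoll_imp_lepoll lepoll_trans by blast
qed

text \<open>The map \<open>\<pi>\<close> presents \<open>A\<close> as the proper functions modulo the finitely supported ones. The sequence \<open>\<iota>\<close> of indices,
  along which \<open>r\<close> tends to infinity, ensures that there are enough proper functions.\<close>

locale proper_function_quotient = comm_group A for A (structure) +
  fixes r :: "'s::countable \<Rightarrow> nat" and \<pi> :: "('s \<Rightarrow> int) \<Rightarrow> 'a" and \<iota> :: "nat \<Rightarrow> 's"
  assumes closed: "\<And>f. f \<in> proper_functions r \<Longrightarrow> \<pi> f \<in> carrier A"
    and add: "\<And>f g. f \<in> proper_functions r \<Longrightarrow> g \<in> proper_functions r \<Longrightarrow> \<pi> (\<lambda>i. f i + g i) = \<pi> f \<otimes> \<pi> g"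
    and surj: "\<And>v. v \<in> carrier A \<Longrightarrow> \<exists>f \<in> proper_functions r. v = \<pi> f"
    and eq_one: "\<And>f. f \<in> proper_functions r \<Longrightarrow> \<pi> f = \<one> \<longleftrightarrow> finite {i. f i \<noteq> 0}"
    and inj: "inj \<iota>" and proper: "\<And>m. finite {n. r (\<iota> n) \<le> m}"
begin

lemma zero: "\<pi> (\<lambda>_. 0) = \<one>"
  using eq_one[OF proper_functions_zero] by simp

lemma minus: assumes "f \<in> proper_functions r" shows "\<pi> (\<lambda>i. - f i) = inv (\<pi> f)"
proof (rule inv_equality[symmetric])
  show "\<pi> (\<lambda>i. - f i) \<otimes> \<pi> f = \<one>"
    using add[OF proper_functions_minus[OF assms] assms] zero by simp
qed (use assms closed proper_functions_minus in auto)

lemma scale: assumes f: "f \<in> proper_functions r" shows "\<pi> (\<lambda>i. n * f i) = \<pi> f [^] n"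
proof -
  have nat: "\<pi> (\<lambda>i. int m * f i) = \<pi> f [^] int m" for m
  proof (induction m)
    case (Suc m)
    have "\<pi> (\<lambda>i. int (Suc m) * f i) = \<pi> (\<lambda>i. int m * f i + f i)" by (simp add: algebra_simps)
    also have "\<dots> = \<pi> f [^] int m \<otimes> \<pi> f" using add[OF proper_functions_scale[OF f] f] Suc by simp
    also have "\<dots> = \<pi> f [^] int (Suc m)" by (simp add: int_pow_int del: of_nat_Suc)
    finally show ?case .
  qed (simp add: zero)
  show ?thesis
  proof (cases n rule: int_cases2)
    case (nonpos m)
    then show ?thesis
      using nat[of m] minus[OF proper_functions_scale[OF f], of "int m"] closed[OF f] by (simp add: int_pow_neg)
  qed (use nat in simp)
qed

text \<open>The values of \<open>f\<close> that are divisible by \<open>n\<close> have quotients that form a proper function. So divisibility in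
  \<open>A\<close> is divisibility of almost all values, and for \<open>n = 0\<close> it is the vanishing of almost all values.\<close>

lemma mem_int_multiples_iff:
  assumes f: "f \<in> proper_functions r"
  shows "\<pi> f \<in> int_multiples A n \<longleftrightarrow> finite {i. \<not> n dvd f i}"
proof
  assume "\<pi> f \<in> int_multiples A n"
  then obtain v where v: "v \<in> carrier A" "\<pi> f = v [^] n" by (rule int_multiplesE)
  obtain g where g: "g \<in> proper_functions r" "v = \<pi> g" using surj v(1) by blast
  have fg: "(\<lambda>i. f i + - (n * g i)) \<in> proper_functions r"
    by (intro proper_functions_add f proper_functions_minus proper_functions_scale g)
  have "\<pi> (\<lambda>i. f i + - (n * g i)) = \<one>"
    using add[OF f proper_functions_minus[OF proper_functions_scale[OF g(1)]], of n]
      minus[OF proper_functions_scale[OF g(1)], of n] scale[OF g(1), of n] v g closed by simp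
  then have "finite {i. f i + - (n * g i) \<noteq> 0}" using eq_one[OF fg] by simp
  moreover have "{i. \<not> n dvd f i} \<subseteq> {i. f i + - (n * g i) \<noteq> 0}" by auto
  ultimately show "finite {i. \<not> n dvd f i}" using finite_subset by blast
next
  assume fin: "finite {i. \<not> n dvd f i}"
  define g where "g i = (if n dvd f i then f i div n else 0)" for i
  have g: "g \<in> proper_functions r"
    by (rule proper_functions_support[OF f]) (auto simp: g_def split: if_splits)
  have fg: "(\<lambda>i. f i + - (n * g i)) \<in> proper_functions r"
    by (intro proper_functions_add f proper_functions_minus proper_functions_scale g)
  have "{i. f i + - (n * g i) \<noteq> 0} \<subseteq> {i. \<not> n dvd f i}" by (auto simp: g_def)
  then have "\<pi> (\<lambda>i. f i + - (n * g i)) = \<one>" using eq_one[OF fg] fin finite_subset by blast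
  moreover have "\<pi> (\<lambda>i. (f i + - (n * g i)) + n * g i) = \<pi> (\<lambda>i. f i + - (n * g i)) \<otimes> \<pi> (\<lambda>i. n * g i)"
    by (rule add[OF fg proper_functions_scale[OF g]])
  ultimately have "\<pi> f = \<pi> g [^] n" using scale[OF g, of n] closed[OF g] by simp
  then show "\<pi> f \<in> int_multiples A n" using int_multiplesI closed[OF g] by simp
qed

lemma finprod_eq:
  assumes "\<And>t. t \<in> T \<Longrightarrow> f t \<in> proper_functions r" "finite T"
  shows "finprod A (\<lambda>t. \<pi> (f t)) T = \<pi> (\<lambda>i. \<Sum>t\<in>T. f t i)"
  using assms(2,1)
proof (induction T)
  case (insert t T)
  have "finprod A (\<lambda>t. \<pi> (f t)) (insert t T) = \<pi> (f t) \<otimes> finprod A (\<lambda>t. \<pi> (f t)) T"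
    by (rule finprod_insert) (use insert closed in auto)
  also have "\<dots> = \<pi> (\<lambda>i. f t i + (\<Sum>t\<in>T. f t i))"
    using insert add[of "f t" "\<lambda>i. \<Sum>t\<in>T. f t i"] proper_functions_sum[of T f r] by simp
  finally show ?case using insert by simp
qed (simp add: zero)

lemma int_comb_eq:
  assumes "\<And>t. f t \<in> proper_functions r" "finite {t. c t \<noteq> 0}"
  shows "int_comb A (\<lambda>t. \<pi> (f t)) c = \<pi> (\<lambda>i. \<Sum>t | c t \<noteq> 0. c t * f t i)"
  unfolding int_comb_def using assms finprod_eq[of "{t. c t \<noteq> 0}" "\<lambda>t i. c t * f t i"]
  by (simp add: scale proper_functions_scale)

lemma torsion_free: "torsion_free_group A"
  unfolding torsion_free_group_def
proof
  show "torsion_subgroup A \<subseteq> {\<one>}"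
  proof
    fix x assume "x \<in> torsion_subgroup A"
    then obtain n :: nat where x: "x \<in> carrier A" "n \<ge> 1" "x [^] n = \<one>" by (auto simp: torsion_subgroup_def)
    obtain f where f: "f \<in> proper_functions r" "x = \<pi> f" using surj x(1) by blast
    have "\<pi> (\<lambda>i. int n * f i) = \<one>" using scale[OF f(1), of "int n"] f(2) x(3) by (simp add: int_pow_int)
    then have "finite {i. int n * f i \<noteq> 0}" using eq_one[OF proper_functions_scale[OF f(1)]] by blast
    then show "x \<in> {\<one>}" using eq_one[OF f(1)] f(2) x(2) by simp
  qed
qed (auto simp: torsion_subgroup_def)

text \<open>The function \<open>F N\<close> represents a solution of the first \<open>N\<close> congruences, so its values satisfy each of
  them with finitely many exceptions. At the index \<open>i\<close>, the glued function \<open>g\<close> takes the value of \<open>F s\<close> for the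
  largest \<open>s \<le> r i\<close> for which \<open>F s i\<close> satisfies the first \<open>s\<close> congruences without exception. The bound
  \<open>r i\<close> makes \<open>g\<close> proper. At an index where \<open>g\<close> violates the \<open>j\<close>-th congruence, either \<open>F j\<close> violates one of the
  first \<open>j\<close>, which happens finitely often, or \<open>r i \<le> j\<close>, where almost all values vanish.\<close>

lemma solves_congruences: "solves_congruences A"
  unfolding solves_congruences_def
proof (intro allI impI, elim conjE)
  fix m :: "nat \<Rightarrow> int" and b q
  assume bq: "\<forall>j. b j \<in> carrier A \<and> q j \<noteq> 0"
    and sol: "\<forall>N. \<exists>x \<in> carrier A. \<forall>j\<le>N. b j \<otimes> x [^] m j \<in> int_multiples A (q j)"
  have "\<forall>j. \<exists>f. f \<in> proper_functions r \<and> b j = \<pi> f" using bq surj by blast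
  then obtain B where B: "\<And>j. B j \<in> proper_functions r" "\<And>j. b j = \<pi> (B j)" by metis
  have "\<forall>N. \<exists>f. f \<in> proper_functions r \<and> (\<forall>j\<le>N. b j \<otimes> \<pi> f [^] m j \<in> int_multiples A (q j))"
    using sol surj by metis
  then obtain F where F: "\<And>N. F N \<in> proper_functions r"
    "\<And>N j. j \<le> N \<Longrightarrow> b j \<otimes> \<pi> (F N) [^] m j \<in> int_multiples A (q j)" by metis
  have crit: "b j \<otimes> \<pi> f [^] m j \<in> int_multiples A (q j) \<longleftrightarrow> finite {i. \<not> q j dvd B j i + m j * f i}"
    if f: "f \<in> proper_functions r" for f j
    using mem_int_multiples_iff[OF proper_functions_add[OF B(1) proper_functions_scale[OF f]]]
      add[OF B(1) proper_functions_scale[OF f]] scale[OF f] B(2) by simp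
  have F_fin: "finite {i. \<not> q j dvd B j i + m j * F N i}" if "j \<le> N" for j N
    using F(2)[OF that] crit[OF F(1)] by simp
  define P where "P s i \<longleftrightarrow> s \<le> r i \<and> (\<forall>j\<le>s. q j dvd B j i + m j * F s i)" for s i
  define S where "S i = Max {s. P s i}" for i
  define g where "g i = (if \<exists>s. P s i then F (S i) i else 0)" for i
  have fin_P: "finite {s. P s i}" for i
    by (rule finite_subset[of _ "{..r i}"]) (auto simp: P_def)
  have S_P: "P (S i) i" if "P s i" for s i
    using Max_in[OF fin_P[of i]] that unfolding S_def by blast
  have S_max: "s \<le> S i" if "P s i" for s i
    unfolding S_def using that by (intro Max_ge[OF fin_P]) simp
  have g_supp: "\<exists>s\<le>r i. F s i \<noteq> 0" if "g i \<noteq> 0" for i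
  proof -
    obtain s where s: "P s i" "F (S i) i \<noteq> 0" using \<open>g i \<noteq> 0\<close> by (auto simp: g_def split: if_splits)
    then show ?thesis using S_P[OF s(1)] by (auto simp: P_def)
  qed
  have g_fin: "finite {i. g i \<noteq> 0 \<and> r i \<le> M}" for M
  proof (rule finite_subset)
    show "{i. g i \<noteq> 0 \<and> r i \<le> M} \<subseteq> (\<Union>s\<in>{..M}. {i. F s i \<noteq> 0 \<and> r i \<le> M})"
    proof
      fix i assume i: "i \<in> {i. g i \<noteq> 0 \<and> r i \<le> M}"
      then obtain s where "s \<le> r i" "F s i \<noteq> 0" using g_supp by blast
      then show "i \<in> (\<Union>s\<in>{..M}. {i. F s i \<noteq> 0 \<and> r i \<le> M})" using i by auto
    qed
    show "finite (\<Union>s\<in>{..M}. {i. F s i \<noteq> 0 \<and> r i \<le> M})"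
      using proper_functionsD[OF F(1)] by blast
  qed
  then have g: "g \<in> proper_functions r" by (simp add: proper_functions_def)
  have "b j \<otimes> \<pi> g [^] m j \<in> int_multiples A (q j)" for j
    unfolding crit[OF g]
  proof (rule finite_subset)
    let ?E = "(\<Union>j'\<in>{..j}. {i. \<not> q j' dvd B j' i + m j' * F j i})
        \<union> {i. g i \<noteq> 0 \<and> r i \<le> j} \<union> {i. B j i \<noteq> 0 \<and> r i \<le> j}"
    show "{i. \<not> q j dvd B j i + m j * g i} \<subseteq> ?E"
    proof
      fix i assume i: "i \<in> {i. \<not> q j dvd B j i + m j * g i}"
      have "\<not> P j i"
      proof
        assume "P j i"
        then have "g i = F (S i) i" "j \<le> S i" "P (S i) i" using S_max S_P by (auto simp: g_def)
        then show False using i by (auto simp: P_def)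
      qed
      then consider "r i \<le> j" | j' where "j' \<le> j" "\<not> q j' dvd B j' i + m j' * F j i"
        unfolding P_def by (meson nat_le_linear)
      then show "i \<in> ?E"
      proof cases
        case 1
        have "B j i \<noteq> 0 \<or> g i \<noteq> 0" using i by auto
        then show ?thesis using 1 by blast
      next
        case (2 j')
        then have "i \<in> (\<Union>j'\<in>{..j}. {i. \<not> q j' dvd B j' i + m j' * F j i})" by blast
        then show ?thesis by blast
      qed
    qed
    show "finite ?E" using F_fin g_fin proper_functionsD[OF B(1)] by blast
  qed
  then show "\<exists>x \<in> carrier A. \<forall>j. b j \<otimes> x [^] m j \<in> int_multiples A (q j)" using closed[OF g] by blast
qed

lemma carrier_lepoll_reals: "carrier A \<lesssim> (UNIV :: real set)"
proof -
  have "carrier A \<subseteq> range \<pi>" using surj by blast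
  then have "carrier A \<lesssim> range \<pi>" by (rule subset_imp_lepoll)
  also have "range \<pi> \<lesssim> (UNIV :: ('s \<Rightarrow> int) set)" by (rule image_lepoll)
  also have "(UNIV :: ('s \<Rightarrow> int) set) \<lesssim> (UNIV :: real set)" by (rule functions_lepoll_reals)
  finally (lepoll_trans) show ?thesis .
qed

definition branch :: "nat set \<Rightarrow> 's \<Rightarrow> int" where
  "branch T s = (if s \<in> range (\<lambda>n. \<iota> (branch_code T n)) then 1 else 0)"

lemma branch_proper: "branch T \<in> proper_functions r"
  unfolding proper_functions_def
proof (intro CollectI allI)
  fix m
  have "{i. branch T i \<noteq> 0 \<and> r i \<le> m} \<subseteq> \<iota> ` {n. r (\<iota> n) \<le> m}" by (auto simp: branch_def)
  then show "finite {i. branch T i \<noteq> 0 \<and> r i \<le> m}" using finite_subset proper by blast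
qed

text \<open>Sufficiently far along the branch of \<open>e t0\<close>, no other branch of the combination is met, and the value of
  the combination is the coefficient \<open>c t0\<close>.\<close>

lemma branch_combination_dvd:
  assumes e: "inj e" and c: "finite {t. c t \<noteq> 0}" and fin: "finite {s. \<not> n dvd (\<Sum>t | c t \<noteq> 0. c t * branch (e t) s)}"
  shows "n dvd c t0"
proof (rule ccontr)
  assume nd: "\<not> n dvd c t0"
  then have t0: "c t0 \<noteq> 0" by auto
  define T where "T = {t. c t \<noteq> 0} - {t0}"
  have T: "finite T" using c by (simp add: T_def)
  have "\<exists>l. \<forall>k>l. e t0 \<inter> {..<k} \<noteq> e t \<inter> {..<k}" if "t \<in> T" for t
  proof -
    have "e t0 \<noteq> e t" using e that by (auto simp: T_def inj_def)
    then obtain l where "l \<in> e t0 \<longleftrightarrow> l \<notin> e t" by blast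
    then show ?thesis by (intro exI[of _ l]) blast
  qed
  then obtain l where l: "\<And>t k. t \<in> T \<Longrightarrow> k > l t \<Longrightarrow> e t0 \<inter> {..<k} \<noteq> e t \<inter> {..<k}" by metis
  obtain L where L: "\<And>t. t \<in> T \<Longrightarrow> l t \<le> L"
    using T by (metis finite_imageI finite_nat_set_iff_bounded_le imageI)
  let ?s = "\<lambda>k. \<iota> (branch_code (e t0) k)"
  have "(\<Sum>t | c t \<noteq> 0. c t * branch (e t) (?s k)) = c t0" if k: "k > L" for k
  proof -
    have "branch (e t) (?s k) = 0" if t: "t \<in> T" for t
    proof -
      have "?s k \<noteq> \<iota> (branch_code (e t) k')" for k'
      proof
        assume "?s k = \<iota> (branch_code (e t) k')"
        then have "branch_code (e t0) k = branch_code (e t) k'" using inj by (simp add: inj_eq)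
        then have "e t0 \<inter> {..<k} = e t \<inter> {..<k}" by (rule branch_code_eq)
        then show False using l[OF t, of k] L[OF t] k by simp
      qed
      then show ?thesis by (auto simp: branch_def)
    qed
    then have "(\<Sum>t\<in>T. c t * branch (e t) (?s k)) = 0" by simp
    moreover have "branch (e t0) (?s k) = 1" by (simp add: branch_def)
    ultimately show ?thesis using sum.remove[OF c, of t0 "\<lambda>t. c t * branch (e t) (?s k)"] t0
      by (simp add: T_def)
  qed
  then have "?s ` {L<..} \<subseteq> {s. \<not> n dvd (\<Sum>t | c t \<noteq> 0. c t * branch (e t) s)}" using nd by auto
  then have "finite (?s ` {L<..})" using fin finite_subset by blast
  moreover have "inj_on ?s {L<..}"
    using inj inj_branch_code[of "e t0"] by (auto simp: inj_on_def inj_def)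
  ultimately have "finite {L<..}" using finite_imageD by blast
  then show False using infinite_Ioi by blast
qed

text \<open>The witnesses are the indicator functions of the almost disjoint branches.\<close>

lemma exists_independent_family_mod_all:
  "\<exists>x :: real \<Rightarrow> 'a. \<forall>n. independent_mod A n x UNIV"
proof -
  obtain e :: "real \<Rightarrow> nat set" where e: "inj e"
    using nat_sets_eqpoll_reals eqpoll_sym unfolding eqpoll_def bij_betw_def by metis
  have "independent_mod A n (\<lambda>t. \<pi> (branch (e t))) UNIV" for n
    unfolding independent_mod_def
  proof (intro conjI allI impI; (elim conjE)?)
    show "(\<lambda>t. \<pi> (branch (e t))) \<in> UNIV \<rightarrow> carrier A" using closed branch_proper by auto
    fix c t0 assume c: "finite {t. c t \<noteq> 0}" "int_comb A (\<lambda>t. \<pi> (branch (e t))) c \<in> int_multiples A n"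
    have "(\<lambda>s. \<Sum>t | c t \<noteq> 0. c t * branch (e t) s) \<in> proper_functions r"
      by (intro proper_functions_sum proper_functions_scale branch_proper)
    then have "finite {s. \<not> n dvd (\<Sum>t | c t \<noteq> 0. c t * branch (e t) s)}"
      using c(2) unfolding int_comb_eq[OF branch_proper c(1)] by (simp only: mem_int_multiples_iff)
    then show "n dvd c t0" by (rule branch_combination_dvd[OF e c(1)])
  qed
  then show ?thesis by blast
qed

text \<open>Multiplying a branch function by \<open>fact (r s)\<close> makes almost all of its values divisible by any given \<open>n \<noteq> 0\<close>, and
  the factor does not affect independence over the integers.\<close>

lemma exists_divisible_independent_family:
  "\<exists>y :: real \<Rightarrow> 'a. range y \<subseteq> divisible_part A \<and> independent_mod A 0 y UNIV"
proof -
  obtain e :: "real \<Rightarrow> nat set" where e: "inj e"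
    using nat_sets_eqpoll_reals eqpoll_sym unfolding eqpoll_def bij_betw_def by metis
  define f where "f t s = fact (r s) * branch (e t) s" for t s
  have f: "f t \<in> proper_functions r" for t
    by (rule proper_functions_support[OF branch_proper]) (auto simp: f_def)
  have "\<pi> (f t) \<in> int_multiples A n" if n: "n \<noteq> 0" for n t
    unfolding mem_int_multiples_iff[OF f]
  proof (rule finite_subset)
    show "{s. \<not> n dvd f t s} \<subseteq> {s. branch (e t) s \<noteq> 0 \<and> r s \<le> nat \<bar>n\<bar>}"
    proof
      fix s assume s: "s \<in> {s. \<not> n dvd f t s}"
      have "r s \<le> nat \<bar>n\<bar>"
      proof (rule ccontr)
        assume "\<not> r s \<le> nat \<bar>n\<bar>"
        then have "nat \<bar>n\<bar> dvd fact (r s)" using n by (intro dvd_fact) auto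
        then have "int (nat \<bar>n\<bar>) dvd int (fact (r s))" by (simp only: int_dvd_int_iff)
        then have "n dvd fact (r s)" by simp
        then show False using s by (simp add: f_def)
      qed
      then show "s \<in> {s. branch (e t) s \<noteq> 0 \<and> r s \<le> nat \<bar>n\<bar>}" using s by (auto simp: f_def)
    qed
  qed (rule proper_functionsD[OF branch_proper])
  then have "range (\<lambda>t. \<pi> (f t)) \<subseteq> divisible_part A" unfolding divisible_part_def by blast
  moreover have "independent_mod A 0 (\<lambda>t. \<pi> (f t)) UNIV"
    unfolding independent_mod_def
  proof (intro conjI allI impI; (elim conjE)?)
    show "(\<lambda>t. \<pi> (f t)) \<in> UNIV \<rightarrow> carrier A" using closed f by auto
    fix c t0 assume c: "finite {t. c t \<noteq> 0}" "int_comb A (\<lambda>t. \<pi> (f t)) c \<in> int_multiples A 0"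
    have "(\<lambda>s. \<Sum>t | c t \<noteq> 0. c t * f t s) \<in> proper_functions r"
      by (intro proper_functions_sum proper_functions_scale f)
    then have "finite {s. \<not> 0 dvd (\<Sum>t | c t \<noteq> 0. c t * f t s)}"
      using c(2) unfolding int_comb_eq[OF f c(1)] by (simp only: mem_int_multiples_iff)
    moreover have "(\<Sum>t | c t \<noteq> 0. c t * f t s) = fact (r s) * (\<Sum>t | c t \<noteq> 0. c t * branch (e t) s)" for s
      by (simp add: f_def sum_distrib_left algebra_simps)
    ultimately have "finite {s. \<not> 0 dvd (\<Sum>t | c t \<noteq> 0. c t * branch (e t) s)}" by simp
    then show "0 dvd c t0" by (rule branch_combination_dvd[OF e c(1)])
  qed
  ultimately show ?thesis by blast
qed

theorem saturated: "saturated_group A"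
  by unfold_locales
     (rule torsion_free solves_congruences carrier_lepoll_reals exists_independent_family_mod_all
        exists_divisible_independent_family)+

end


section \<open>Cycles on spheres and in contractible spaces\<close>

lemma homotopic_imp_homologous_cycle:
  assumes "homotopic_with (\<lambda>_. True) S U f g" "singular_relcycle p S {} c"
  shows "homologous_rel p U {} (chain_map p f c) (chain_map p g c)"
  by (rule homotopic_imp_homologous_rel_chain_maps[OF _ assms(2)])
     (rule homotopic_with_mono[OF assms(1)], simp)

text \<open>The image lives in a one-point space, whose homology vanishes in positive dimensions.\<close>

lemma chain_map_const_cycle_boundary:
  assumes c: "singular_relcycle p X {} c" and a: "a \<in> topspace Y" and p: "1 \<le> p"
  shows "singular_relboundary p Y {} (chain_map p (\<lambda>_. a) c)"
proof -
  have cont: "continuous_map X (subtopology Y {a}) (\<lambda>_. a)" using a by simp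
  have "singular_relcycle p (subtopology Y {a}) {} (chain_map p (\<lambda>_. a) c)"
    by (rule singular_relcycle_chain_map[OF c cont]) simp
  then have "singular_relboundary p (subtopology Y {a}) {} (chain_map p (\<lambda>_. a) c)"
    using singular_boundary_eq_cycle_singleton[of "subtopology Y {a}" a p] a p by simp
  then show ?thesis using singular_boundary_mono[of "{a}" "topspace Y" p Y] a by simp
qed

lemma contractible_cycle_boundary:
  assumes N: "contractible_space X" and c: "singular_relcycle p X {} c" and p: "1 \<le> p"
  shows "singular_relboundary p X {} c"
proof (cases "topspace X = {}")
  case True
  then have "c = 0" using c singular_chain_empty by (auto simp: singular_cycle)
  then show ?thesis by simp
next
  case False
  obtain a where a: "homotopic_with (\<lambda>_. True) X X id (\<lambda>_. a)"
    using N by (auto simp: contractible_space_def)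
  have aX: "a \<in> topspace X"
    using homotopic_with_imp_continuous_maps[OF a] False by (auto simp: continuous_map_const)
  have "chain_map p id c = c" using c by (intro chain_map_ident) (auto simp: singular_cycle)
  then have "singular_relboundary p X {} (c - chain_map p (\<lambda>_. a) c)"
    using homotopic_imp_homologous_cycle[OF a c] by (simp add: homologous_rel_def)
  from singular_relboundary_add[OF this chain_map_const_cycle_boundary[OF c aX p]]
  show ?thesis by simp
qed

text \<open>The boundary of \<open>c\<close> is homologous in \<open>C\<close> to its image under a constant map, and that image is
  the boundary of the constant image of \<open>c\<close>, which is a chain in \<open>C\<close> even if \<open>c\<close> is not. This covers
  the boundaries of paths, where the homology of a contractible space does not vanish.\<close>

lemma boundary_bounds_in_contractible:
  assumes C: "contractible_space (subtopology X C)"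
    and c: "singular_chain (Suc p) X c" and e: "singular_chain p (subtopology X C) (chain_boundary (Suc p) c)"
  shows "\<exists>d. singular_chain (Suc p) (subtopology X C) d \<and> chain_boundary (Suc p) d = chain_boundary (Suc p) c"
proof (cases "topspace (subtopology X C) = {}")
  case True
  then have "chain_boundary (Suc p) c = 0" using e singular_chain_empty by blast
  then show ?thesis by (intro exI[of _ 0]) simp
next
  case False
  let ?Y = "subtopology X C" and ?e = "chain_boundary (Suc p) c"
  obtain a where a: "homotopic_with (\<lambda>_. True) ?Y ?Y id (\<lambda>_. a)"
    using C by (auto simp: contractible_space_def)
  have "?Y \<noteq> trivial_topology" using False by (metis null_topspace_iff_trivial)
  then have aY: "a \<in> topspace ?Y"
    using homotopic_with_imp_continuous_maps[OF a] unfolding continuous_map_const by blast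
  have cyc: "singular_relcycle p ?Y {} ?e"
    using e chain_boundary_boundary[OF c] by (simp add: singular_cycle)
  have "chain_map p id ?e = ?e" using e by (rule chain_map_ident)
  then obtain d where d: "singular_chain (Suc p) ?Y d" "chain_boundary (Suc p) d = ?e - chain_map p (\<lambda>_. a) ?e"
    using homotopic_imp_homologous_cycle[OF a cyc] by (auto simp: homologous_rel_def singular_boundary)
  have "singular_chain (Suc p) ?Y (chain_map (Suc p) (\<lambda>_. a) c)"
    by (rule singular_chain_chain_map[OF c]) (use aY in simp)
  moreover have "chain_boundary (Suc p) (chain_map (Suc p) (\<lambda>_. a) c) = chain_map p (\<lambda>_. a) ?e"
    using chain_boundary_chain_map[OF c] by simp
  ultimately show ?thesis using d
    by (intro exI[of _ "d + chain_map (Suc p) (\<lambda>_. a) c"])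
       (simp add: singular_chain_add chain_boundary_add)
qed

lemma additive_frag_cmul:
  fixes \<theta> :: "'a chain \<Rightarrow> int"
  assumes add: "\<And>c d. P c \<Longrightarrow> P d \<Longrightarrow> \<theta> (c + d) = \<theta> c + \<theta> d"
    and P: "\<And>a. P (frag_cmul a c)"
  shows "\<theta> (frag_cmul a c) = a * \<theta> c"
proof -
  have P0: "P 0" using P[of 0] by simp
  have zero: "\<theta> 0 = 0" using add[OF P0 P0] by simp
  have nat: "\<theta> (frag_cmul (int n) c) = int n * \<theta> c" for n
  proof (induction n)
    case (Suc n)
    have "frag_cmul (int (Suc n)) c = frag_cmul (int n) c + frag_cmul 1 c"
      by (subst frag_cmul_distrib[symmetric]) (simp add: algebra_simps)
    then show ?case using add[OF P[of "int n"] P[of 1]] Suc by (simp add: algebra_simps)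
  qed (simp add: zero)
  show ?thesis
  proof (cases a rule: int_cases2)
    case (nonpos n)
    have "frag_cmul (- int n) c + frag_cmul (int n) c = 0"
      by (subst frag_cmul_distrib[symmetric]) simp
    then have "\<theta> (frag_cmul (- int n) c) + \<theta> (frag_cmul (int n) c) = 0"
      using add[OF P[of "- int n"] P[of "int n"]] zero by simp
    then show ?thesis using nat[of n] nonpos by simp
  qed (use nat in simp)
qed

text \<open>The infinite cyclic homology group of the sphere, in terms of chains.\<close>

theorem nsphere_homology_generator:
  assumes k: "1 \<le> k"
  shows "\<exists>\<zeta>. singular_relcycle k (nsphere k) {} \<zeta>
     \<and> (\<forall>c. singular_relcycle k (nsphere k) {} c \<longrightarrow> (\<exists>a. homologous_rel k (nsphere k) {} c (frag_cmul a \<zeta>)))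
     \<and> (\<forall>a. singular_relboundary k (nsphere k) {} (frag_cmul a \<zeta>) \<longrightarrow> a = 0)"
proof -
  let ?X = "nsphere k"
  let ?G = "homology_group (int k) ?X"
  have "?G \<cong> integer_group"
    using reduced_homology_group_nsphere(1)[of k] un_reduced_homology_group[of "int k" ?X] k by simp
  then obtain \<theta> where \<theta>: "\<theta> \<in> hom ?G integer_group" "bij_betw \<theta> (carrier ?G) UNIV"
    by (auto simp: is_iso_def iso_def)
  let ?cyc = "singular_relcycle k ?X {}"
  define cls where "cls c = homologous_rel_set k ?X {} c" for c
  define \<theta>' where "\<theta>' c = \<theta> (cls c)" for c
  have cls_G: "cls c \<in> carrier ?G" if "?cyc c" for c
    using that by (simp add: carrier_relative_homology_group cls_def)
  have cls_add: "cls (c + d) = cls c \<otimes>\<^bsub>?G\<^esub> cls d" if "?cyc c" "?cyc d" for c d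
  proof -
    interpret N: normal "singular_relboundary_set k ?X {}" "relcycle_group k ?X {}"
      by (rule normal_subgroup_singular_relboundary_relcycle)
    show ?thesis
      using hom_mult[OF N.r_coset_hom_Mod, of c d] that
      by (simp add: right_coset_singular_relboundary nontrivial_relative_homology_group cls_def)
  qed
  have \<theta>'_add: "\<theta>' (c + d) = \<theta>' c + \<theta>' d" if "?cyc c" "?cyc d" for c d
    using hom_mult[OF \<theta>(1) cls_G[OF that(1)] cls_G[OF that(2)]] cls_add[OF that] by (simp add: \<theta>'_def)
  have \<theta>'_cmul: "\<theta>' (frag_cmul a c) = a * \<theta>' c" if "?cyc c" for a c
    by (rule additive_frag_cmul[of ?cyc]) (use that \<theta>'_add singular_relcycle_cmul in auto)
  have "\<exists>x \<in> carrier ?G. \<theta> x = 1" using \<theta>(2) unfolding bij_betw_def by (metis UNIV_I imageE)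
  then obtain \<zeta> where \<zeta>: "?cyc \<zeta>" "\<theta>' \<zeta> = 1"
    by (auto simp: carrier_relative_homology_group \<theta>'_def cls_def)
  have "homologous_rel k ?X {} c (frag_cmul (\<theta>' c) \<zeta>)" if c: "?cyc c" for c
  proof -
    have "\<theta> (cls c) = \<theta> (cls (frag_cmul (\<theta>' c) \<zeta>))"
      using \<theta>'_cmul[OF \<zeta>(1), of "\<theta>' c"] \<zeta>(2) by (simp add: \<theta>'_def)
    then have "cls c = cls (frag_cmul (\<theta>' c) \<zeta>)"
      using \<theta>(2) cls_G[OF c] cls_G[OF singular_relcycle_cmul[OF \<zeta>(1)]] unfolding bij_betw_def inj_on_def by blast
    then show ?thesis by (simp add: cls_def homologous_rel_set_eq)
  qed
  moreover have "a = 0" if "singular_relboundary k ?X {} (frag_cmul a \<zeta>)" for a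
  proof -
    have "cls (frag_cmul a \<zeta>) = cls 0"
      using that homologous_rel_set_eq_relboundary[of k ?X "{}" "frag_cmul a \<zeta>"]
        homologous_rel_set_eq_relboundary[of k ?X "{}" 0] by (simp add: cls_def)
    then have "\<theta>' (frag_cmul a \<zeta>) = \<theta>' (frag_cmul 0 \<zeta>)" by (simp add: \<theta>'_def)
    then show ?thesis unfolding \<theta>'_cmul[OF \<zeta>(1)] using \<zeta>(2) by simp
  qed
  ultimately show ?thesis using \<zeta>(1) by blast
qed


section \<open>Homotopies in the string of spheres\<close>

lemma topspace_nsphere_iff:
  "y \<in> topspace (nsphere k) \<longleftrightarrow> (\<Sum>i\<le>k. y i ^ 2) = 1 \<and> (\<forall>i>k. y i = 0)"
  by (simp add: nsphere)

lemma sphere_basepoint_in_nsphere: "sphere_basepoint \<in> topspace (nsphere k)"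
  using in_topspace_nsphere[of k] by (simp add: sphere_basepoint_def)

lemma in_string_iff:
  "(x, y) \<in> topspace (string_of_spheres k) \<longleftrightarrow>
     (x \<ge> 0 \<and> y = sphere_basepoint) \<or> (\<exists>n::nat. x = real n \<and> y \<in> topspace (nsphere k))"
  unfolding topspace_string_of_spheres by auto

text \<open>A subspace of a product of lines, so continuity can be checked coordinatewise.\<close>

lemma string_of_spheres_eq:
  "string_of_spheres k = subtopology (prod_topology euclideanreal (powertop_real UNIV)) (topspace (string_of_spheres k))"
proof -
  let ?S = "{x. (\<Sum>i\<le>k. x i ^ 2) = 1 \<and> (\<forall>i>k. x i = 0)} :: (nat \<Rightarrow> real) set"
  let ?T = "{0..} \<times> {sphere_basepoint} \<union> (\<Union>n::nat. {real n} \<times> topspace (nsphere k))"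
  have "prod_topology euclideanreal (nsphere k)
      = subtopology (prod_topology euclideanreal (powertop_real UNIV)) (UNIV \<times> ?S)"
    using prod_topology_subtopology(2)[of euclideanreal "powertop_real UNIV" ?S] by (simp add: nsphere)
  then have "string_of_spheres k
      = subtopology (prod_topology euclideanreal (powertop_real UNIV)) ((UNIV \<times> ?S) \<inter> ?T)"
    by (simp add: string_of_spheres_def subtopology_subtopology)
  also have "(UNIV \<times> ?S) \<inter> ?T = topspace (string_of_spheres k)"
    using sphere_basepoint_in_nsphere[of k] unfolding topspace_string_of_spheres nsphere by auto
  finally show ?thesis .
qed

lemma continuous_map_into_string:
  assumes "continuous_map Z euclideanreal f" "\<And>i. continuous_map Z euclideanreal (\<lambda>z. g z i)"
    "\<And>z. z \<in> topspace Z \<Longrightarrow> (f z, g z) \<in> topspace (string_of_spheres k) \<inter> S"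
  shows "continuous_map Z (subtopology (string_of_spheres k) S) (\<lambda>z. (f z, g z))"
proof -
  have "continuous_map Z (prod_topology euclideanreal (powertop_real UNIV)) (\<lambda>z. (f z, g z))"
    using assms(1,2) by (simp add: continuous_map_paired continuous_map_componentwise_UNIV)
  then show ?thesis
    by (subst string_of_spheres_eq) (use assms(3) in \<open>auto simp: continuous_map_in_subtopology subtopology_subtopology\<close>)
qed

lemma continuous_map_string_coordinate:
  "continuous_map (string_of_spheres k) euclideanreal (\<lambda>z. snd z i)"
proof -
  have "continuous_map (prod_topology euclideanreal (powertop_real UNIV)) euclideanreal (\<lambda>z. snd z i)"
    using continuous_map_compose[OF continuous_map_snd continuous_map_product_projection[of i UNIV "\<lambda>_. euclideanreal"]]
    by (simp add: o_def)
  then show ?thesis by (subst string_of_spheres_eq) (rule continuous_map_from_subtopology)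
qed

text \<open>The ray with the open hemispheres around the basepoints.\<close>

abbreviation near_ray :: "nat \<Rightarrow> real set \<Rightarrow> (real \<times> (nat \<Rightarrow> real)) set" where
  "near_ray k I \<equiv> {z \<in> string_part k I. snd z 0 > 0}"

lemma string_homotopy:
  assumes f: "continuous_map (prod_topology (top_of_set {0..1::real}) (subtopology (string_of_spheres k) S)) euclideanreal f"
    and g: "\<And>i. continuous_map (prod_topology (top_of_set {0..1::real}) (subtopology (string_of_spheres k) S)) euclideanreal (\<lambda>w. g w i)"
    and mem: "\<And>t x y. 0 \<le> t \<Longrightarrow> t \<le> 1 \<Longrightarrow> (x, y) \<in> topspace (string_of_spheres k) \<Longrightarrow> (x, y) \<in> S
       \<Longrightarrow> (f (t, (x, y)), g (t, (x, y))) \<in> topspace (string_of_spheres k) \<inter> S"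
    and start: "\<And>x y. (x, y) \<in> topspace (string_of_spheres k) \<Longrightarrow> (x, y) \<in> S
       \<Longrightarrow> (f (0, (x, y)), g (0, (x, y))) = p (x, y)"
    and stop: "\<And>x y. (x, y) \<in> topspace (string_of_spheres k) \<Longrightarrow> (x, y) \<in> S
       \<Longrightarrow> (f (1, (x, y)), g (1, (x, y))) = q (x, y)"
  shows "homotopic_with (\<lambda>_. True) (subtopology (string_of_spheres k) S) (subtopology (string_of_spheres k) S) p q"
proof -
  let ?X = "subtopology (string_of_spheres k) S"
  let ?h = "\<lambda>w. (f w, g w)"
  have "continuous_map (prod_topology (top_of_set {0..1::real}) ?X) ?X ?h"
  proof (rule continuous_map_into_string[OF f g])
    fix w assume "w \<in> topspace (prod_topology (top_of_set {0..1::real}) ?X)"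
    then show "(f w, g w) \<in> topspace (string_of_spheres k) \<inter> S"
      using mem[of "fst w" "fst (snd w)" "snd (snd w)"] by (cases w) auto
  qed
  then show ?thesis
    by (subst homotopic_with) (use start stop in \<open>auto intro!: exI[of _ ?h]\<close>)
qed

lemma continuous_map_homotopy_coordinates:
  fixes S :: "(real \<times> (nat \<Rightarrow> real)) set" and k :: nat
  defines "Z \<equiv> prod_topology (top_of_set {0..1::real}) (subtopology (string_of_spheres k) S)"
  shows "continuous_map Z euclideanreal (\<lambda>w. fst w)"
    and "continuous_map Z euclideanreal (\<lambda>w. fst (snd w))"
    and "continuous_map Z euclideanreal (\<lambda>w. snd (snd w) i)"
proof -
  have 1: "continuous_map Z (top_of_set {0..1::real}) fst"
    and 2: "continuous_map Z (subtopology (string_of_spheres k) S) snd"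
    unfolding Z_def by (rule continuous_map_fst, rule continuous_map_snd)
  show "continuous_map Z euclideanreal (\<lambda>w. fst w)"
    using 1 by (simp add: continuous_map_in_subtopology eta_contract_eq)
  have 3: "continuous_map Z (string_of_spheres k) snd"
    using 2 by (simp add: continuous_map_in_subtopology)
  show "continuous_map Z euclideanreal (\<lambda>w. fst (snd w))"
    using continuous_map_compose[OF 3 continuous_map_string_fst] by (simp add: o_def)
  show "continuous_map Z euclideanreal (\<lambda>w. snd (snd w) i)"
    using continuous_map_compose[OF 3 continuous_map_string_coordinate] by (simp add: o_def)
qed

text \<open>Scaling all coordinates but the first by \<open>1 - t\<close> and restoring the norm in the first contracts the open
  hemisphere. The formula fixes the basepoint, so it applies to the points of the ray as well.\<close>

lemma shrink_towards_basepoint: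
  assumes y: "y \<in> topspace (nsphere k)" and pos: "y 0 > 0" and t: "0 \<le> t" "t \<le> 1"
  defines "y' \<equiv> (\<lambda>i. if i = 0 then sqrt (1 - (1 - t)^2 * (1 - (y 0)^2)) else (1 - t) * y i)"
  shows "y' \<in> topspace (nsphere k)" "y' 0 > 0"
proof -
  have split: "(\<Sum>i\<le>k. u i) = u 0 + (\<Sum>i\<in>{1..k}. u i)" for u :: "nat \<Rightarrow> real"
    by (simp add: sum.atMost_shift sum.atLeast1_atMost_eq lessThan_Suc_atMost)
  have s: "(\<Sum>i\<in>{1..k}. y i ^ 2) = 1 - (y 0)^2"
    using y split[of "\<lambda>i. y i ^ 2"] by (simp add: topspace_nsphere_iff)
  have "0 \<le> (\<Sum>i\<in>{1..k}. y i ^ 2)" by (intro sum_nonneg) simp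
  then have le: "0 \<le> 1 - (y 0)^2" using s by simp
  have "(1 - t)^2 \<le> 1" using t by (simp add: power_le_one)
  have "(1 - t)^2 \<le> 1" using t by (simp add: power_le_one)
  then have "(1 - t)^2 * (1 - (y 0)^2) \<le> 1 * (1 - (y 0)^2)" by (rule mult_right_mono[OF _ le])
  also have "\<dots> < 1" using pos by simp
  finally have gt: "1 - (1 - t)^2 * (1 - (y 0)^2) > 0" by (simp only: diff_gt_0_iff_gt)
  then show "y' 0 > 0" by (simp add: y'_def)
  have "(\<Sum>i\<in>{1..k}. y' i ^ 2) = (\<Sum>i\<in>{1..k}. (1 - t)^2 * y i ^ 2)"
    by (rule sum.cong) (auto simp: y'_def power_mult_distrib)
  also have "\<dots> = (1 - t)^2 * (1 - (y 0)^2)" using s by (simp add: sum_distrib_left[symmetric])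
  finally have "(\<Sum>i\<le>k. y' i ^ 2) = 1"
    using gt split[of "\<lambda>i. y' i ^ 2"] by (simp add: y'_def)
  then show "y' \<in> topspace (nsphere k)" using y by (auto simp: topspace_nsphere_iff y'_def)
qed

text \<open>The hemispheres contract to the ray, and the ray to a point of it.\<close>

lemma contractible_near_ray:
  assumes I: "is_interval I" and x0: "x0 \<in> I" "x0 \<ge> 0"
  shows "contractible_space (subtopology (string_of_spheres k) (near_ray k I))"
proof -
  let ?X = "string_of_spheres k" and ?S = "near_ray k I"
  let ?b = "sphere_basepoint"
  let ?Z = "prod_topology (top_of_set {0..1::real}) (subtopology ?X ?S)"
  note coords = continuous_map_homotopy_coordinates[where k = k and S = ?S]
  have b0: "?b 0 = 1" and bi: "i \<noteq> 0 \<Longrightarrow> ?b i = 0" for i by (auto simp: sphere_basepoint_def)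
  have I_seg: "(1 - t) * x + t * x' \<in> I" if "x \<in> I" "x' \<in> I" "0 \<le> t" "t \<le> 1" for x x' t
  proof -
    have "convex I" using I is_interval_convex by blast
    from convexD[OF this that(1,2), of "1 - t" t] that(3,4) show ?thesis by simp
  qed
  let ?g = "\<lambda>w i. if i = 0 then sqrt (1 - (1 - fst w)^2 * (1 - (snd (snd w) 0)^2)) else (1 - fst w) * snd (snd w) i"
  have 1: "homotopic_with (\<lambda>_. True) (subtopology ?X ?S) (subtopology ?X ?S) id (\<lambda>z. (fst z, ?b))"
  proof (rule string_homotopy[where f = "\<lambda>w. fst (snd w)" and g = ?g])
    show "continuous_map ?Z euclideanreal (\<lambda>w. fst (snd w))" by (rule coords)
    show "continuous_map ?Z euclideanreal (\<lambda>w. ?g w i)" for i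
    proof (cases "i = 0")
      case True
      have "continuous_map ?Z euclideanreal (\<lambda>w. sqrt (1 - (1 - fst w)^2 * (1 - (snd (snd w) 0)^2)))"
        by (intro continuous_intros coords) auto
      then show ?thesis using True by simp
    next
      case False
      have "continuous_map ?Z euclideanreal (\<lambda>w. (1 - fst w) * snd (snd w) i)"
        by (intro continuous_intros coords) auto
      then show ?thesis using False by simp
    qed
  next
    fix t :: real and x y assume t: "0 \<le> t" "t \<le> 1" and xy: "(x, y) \<in> topspace ?X" "(x, y) \<in> ?S"
    let ?y = "\<lambda>i. if i = 0 then sqrt (1 - (1 - t)^2 * (1 - (y 0)^2)) else (1 - t) * y i"
    have pos: "y 0 > 0" "x \<in> I" using xy by auto
    have sph: "y \<in> topspace (nsphere k)" using xy(1) sphere_basepoint_in_nsphere unfolding in_string_iff by blast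
    note s = shrink_towards_basepoint[OF sph pos(1) t]
    have "(x, ?y) \<in> topspace ?X"
      using xy(1) unfolding in_string_iff
    proof (elim disjE)
      assume A: "0 \<le> x \<and> y = ?b"
      then have "?y = ?b" using b0 bi by auto
      then show "(0 \<le> x \<and> ?y = ?b) \<or> (\<exists>n. x = real n \<and> ?y \<in> topspace (nsphere k))" using A by blast
    qed (use s in blast)
    then show "(fst (snd (t, x, y)), ?g (t, x, y)) \<in> topspace ?X \<inter> ?S"
      unfolding fst_conv snd_conv using s(2) pos by simp
  next
    fix x y assume xy: "(x, y) \<in> topspace ?X" "(x, y) \<in> ?S"
    have pos: "y 0 > 0" using xy by auto
    show "(fst (snd (0::real, x, y)), ?g (0, x, y)) = id (x, y)" using pos by (auto simp: fun_eq_iff)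
    show "(fst (snd (1::real, x, y)), ?g (1, x, y)) = (fst (x, y), ?b)" using b0 bi by (auto simp: fun_eq_iff)
  qed
  have 2: "homotopic_with (\<lambda>_. True) (subtopology ?X ?S) (subtopology ?X ?S) (\<lambda>z. (fst z, ?b)) (\<lambda>_. (x0, ?b))"
  proof (rule string_homotopy[where f = "\<lambda>w. (1 - fst w) * fst (snd w) + fst w * x0" and g = "\<lambda>_. ?b"])
    show "continuous_map ?Z euclideanreal (\<lambda>w. (1 - fst w) * fst (snd w) + fst w * x0)"
      by (intro continuous_intros coords) auto
    fix t :: real and x y assume t: "0 \<le> t" "t \<le> 1" and xy: "(x, y) \<in> topspace ?X" "(x, y) \<in> ?S"
    then have "x \<ge> 0" "x \<in> I" by (auto simp: in_string_iff)
    then show "((1 - fst (t, x, y)) * fst (snd (t, x, y)) + fst (t, x, y) * x0, ?b) \<in> topspace ?X \<inter> ?S"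
      using I_seg[of x x0 t] t x0 b0 by (auto simp: in_string_iff)
  qed auto
  show ?thesis unfolding contractible_space_def using homotopic_with_trans[OF 1 2] by blast
qed

text \<open>Only the points of the ray near the sphere move, along the ray.\<close>

lemma sphere_neighbourhood_retraction:
  assumes I: "is_interval I" and j: "real j \<in> I"
    and only: "\<And>n::nat. real n \<in> I \<Longrightarrow> n = j"
  shows "homotopic_with (\<lambda>_. True) (subtopology (string_of_spheres k) (string_part k I))
     (subtopology (string_of_spheres k) (string_part k I)) id (\<lambda>z. (real j, snd z))"
proof (rule string_homotopy[where f = "\<lambda>w. (1 - fst w) * fst (snd w) + fst w * real j" and g = "\<lambda>w. snd (snd w)"])
  let ?X = "string_of_spheres k" and ?S = "string_part k I"
  let ?Z = "prod_topology (top_of_set {0..1::real}) (subtopology ?X ?S)"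
  note coords = continuous_map_homotopy_coordinates[where k = k and S = ?S]
  show "continuous_map ?Z euclideanreal (\<lambda>w. (1 - fst w) * fst (snd w) + fst w * real j)"
    by (intro continuous_intros coords) auto
  show "continuous_map ?Z euclideanreal (\<lambda>w. snd (snd w) i)" for i by (rule coords)
  fix t x y assume t: "(0::real) \<le> t" "t \<le> 1" and xy: "(x, y) \<in> topspace ?X" "(x, y) \<in> ?S"
  have xI: "x \<in> I" using xy by auto
  have "convex I" using I is_interval_convex by blast
  then have seg: "(1 - t) * x + t * real j \<in> I" using convexD[OF _ xI j, of "1 - t" t] t by simp
  have "((1 - t) * x + t * real j, y) \<in> topspace ?X"
    using xy(1) unfolding in_string_iff
  proof (elim disjE)
    assume "0 \<le> x \<and> y = sphere_basepoint"
    then show "(0 \<le> (1 - t) * x + t * real j \<and> y = sphere_basepoint)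
        \<or> (\<exists>n. (1 - t) * x + t * real j = real n \<and> y \<in> topspace (nsphere k))" using t by simp
  next
    assume "\<exists>n. x = real n \<and> y \<in> topspace (nsphere k)"
    then have "x = real j" "y \<in> topspace (nsphere k)" using only xI by auto
    then show "(0 \<le> (1 - t) * x + t * real j \<and> y = sphere_basepoint)
        \<or> (\<exists>n. (1 - t) * x + t * real j = real n \<and> y \<in> topspace (nsphere k))"
      by (intro disjI2 exI[of _ j]) (simp add: algebra_simps)
  qed
  then show "((1 - fst (t, x, y)) * fst (snd (t, x, y)) + fst (t, x, y) * real j, snd (snd (t, x, y)))
      \<in> topspace ?X \<inter> ?S" using seg by simp
qed auto

lemma continuous_map_sphere_inclusion:
  assumes "real j \<in> I"
  shows "continuous_map (nsphere k) (subtopology (string_of_spheres k) (string_part k I)) (\<lambda>y. (real j, y))"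
proof (rule continuous_map_into_string)
  show "continuous_map (nsphere k) euclideanreal (\<lambda>z. z i)" for i
    unfolding nsphere by (intro continuous_map_from_subtopology continuous_map_product_projection) simp
qed (use assms in \<open>auto simp: in_string_iff\<close>)

lemma continuous_map_string_snd: "continuous_map (string_of_spheres k) (nsphere k) snd"
  unfolding string_of_spheres_def by (intro continuous_map_from_subtopology continuous_map_snd)

definition sphere_projection :: "nat \<Rightarrow> real \<times> (nat \<Rightarrow> real) \<Rightarrow> (nat \<Rightarrow> real)" where
  "sphere_projection j z = (if fst z = real j then snd z else sphere_basepoint)"

text \<open>Near the \<open>j\<close>-th sphere the collapse is the second coordinate, because the nearby points of the ray have
  the basepoint as second coordinate; away from the sphere it is constant.\<close>

lemma continuous_map_sphere_projection:
  "continuous_map (string_of_spheres k) (nsphere k) (sphere_projection j)"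
proof (rule pasting_lemma[where I = UNIV and T = "\<lambda>near. if near then string_part k {real j - 1<..<real j + 1} else string_part k (- {real j})"
      and f = "\<lambda>near z. if near then snd z else sphere_basepoint"])
  let ?X = "string_of_spheres k"
  have op: "openin ?X (string_part k U)" if "open U" for U
    by (rule openin_continuous_map_preimage[OF continuous_map_string_fst]) (use that in simp)
  have op1: "openin ?X (string_part k {real j - 1<..<real j + 1})" by (rule op) simp
  have op2: "openin ?X (string_part k (- {real j}))" by (rule op) (simp add: open_Compl)
  show "openin ?X (if near then string_part k {real j - 1<..<real j + 1} else string_part k (- {real j}))" for near
    by (cases near) (simp_all only: op1 op2 if_True if_False)
  show "continuous_map (subtopology ?X (if near then string_part k {real j - 1<..<real j + 1} else string_part k (- {real j})))
     (nsphere k) (\<lambda>z. if near then snd z else sphere_basepoint)" for near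
    using continuous_map_from_subtopology[OF continuous_map_string_snd[of k], of "string_part k {real j - 1<..<real j + 1}"]
      sphere_basepoint_in_nsphere[of k] by (cases near) auto
  have ray: "snd z = sphere_basepoint"
    if "z \<in> topspace ?X" "fst z \<in> {real j - 1<..<real j + 1}" "fst z \<noteq> real j" for z
  proof -
    have "fst z \<noteq> real n" for n using that(2,3) by auto
    then show ?thesis using that(1) in_string_iff[of "fst z" "snd z" k] by auto
  qed
  show "(if i then snd x else sphere_basepoint) = (if i' then snd x else sphere_basepoint)"
    if "i \<in> UNIV" "i' \<in> UNIV" "x \<in> topspace ?X \<inter> (if i then string_part k {real j - 1<..<real j + 1} else string_part k (- {real j}))
        \<inter> (if i' then string_part k {real j - 1<..<real j + 1} else string_part k (- {real j}))" for i i' x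
    using that ray[of x] by (auto split: if_splits)
  show "\<exists>i. i \<in> UNIV \<and> x \<in> (if i then string_part k {real j - 1<..<real j + 1} else string_part k (- {real j}))
     \<and> sphere_projection j x = (if i then snd x else sphere_basepoint)" if "x \<in> topspace ?X" for x
    using that by (cases "fst x = real j") (auto simp: sphere_projection_def intro: exI[of _ True] exI[of _ False])
qed


section \<open>Cycles in the tails of the string\<close>

lemma singular_relboundary_sum:
  assumes "\<And>i. i \<in> I \<Longrightarrow> singular_relboundary p X S (f i)"
  shows "singular_relboundary p X S (sum f I)"
  using assms by (induction I rule: infinite_finite_induct) (auto intro: singular_relboundary_add)

lemma openin_string_part: "open U \<Longrightarrow> openin (string_of_spheres k) (string_part k U)"
  by (rule openin_continuous_map_preimage[OF continuous_map_string_fst]) simp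

lemma openin_near_ray: assumes "open U" shows "openin (string_of_spheres k) (near_ray k U)"
proof -
  have "openin (string_of_spheres k) {z \<in> topspace (string_of_spheres k). snd z 0 \<in> {0<..}}"
    by (rule openin_continuous_map_preimage[OF continuous_map_string_coordinate]) simp
  with openin_string_part[OF assms] have "openin (string_of_spheres k)
      (string_part k U \<inter> {z \<in> topspace (string_of_spheres k). snd z 0 \<in> {0<..}})"
    by (rule openin_Int)
  moreover have "string_part k U \<inter> {z \<in> topspace (string_of_spheres k). snd z 0 \<in> {0<..}} = near_ray k U"
    by auto
  ultimately show ?thesis by simp
qed

abbreviation string_tail :: "nat \<Rightarrow> real \<Rightarrow> (real \<times> (nat \<Rightarrow> real)) topology" where
  "string_tail k t \<equiv> subtopology (string_of_spheres k) (string_part k {t<..})"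

lemma singular_chain_tail_mono:
  "singular_chain p (string_tail k t) c \<Longrightarrow> s \<le> t \<Longrightarrow> singular_chain p (string_tail k s) c"
  by (erule singular_chain_mono) auto

lemma singular_chain_tail_whole: "singular_chain p (string_tail k t) c \<Longrightarrow> singular_chain p (string_of_spheres k) c"
  by (simp add: singular_chain_subtopology)

text \<open>The cycle \<open>\<zeta>\<close> represents a generator of the infinite cyclic group of \<open>k\<close>-dimensional homology of the
  sphere.\<close>

locale sphere_generator =
  fixes k :: nat and \<zeta> :: "(nat \<Rightarrow> real) chain"
  assumes k: "1 \<le> k" and cycle: "singular_relcycle k (nsphere k) {} \<zeta>"
    and generates: "\<And>c. singular_relcycle k (nsphere k) {} c \<Longrightarrow> \<exists>a. homologous_rel k (nsphere k) {} c (frag_cmul a \<zeta>)"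
    and free: "\<And>a. singular_relboundary k (nsphere k) {} (frag_cmul a \<zeta>) \<Longrightarrow> a = 0"
begin

abbreviation X where "X \<equiv> string_of_spheres k"

definition sphere_cycle :: "nat \<Rightarrow> (real \<times> (nat \<Rightarrow> real)) chain" where
  "sphere_cycle j = chain_map k (\<lambda>y. (real j, y)) \<zeta>"

definition string_cycle :: "(nat \<Rightarrow> int) \<Rightarrow> (real \<times> (nat \<Rightarrow> real)) chain" where
  "string_cycle a = (\<Sum>j | a j \<noteq> 0. frag_cmul (a j) (sphere_cycle j))"

lemma string_cycle_superset:
  assumes "finite J" "{j. a j \<noteq> 0} \<subseteq> J"
  shows "string_cycle a = (\<Sum>j\<in>J. frag_cmul (a j) (sphere_cycle j))"
  unfolding string_cycle_def by (rule sum.mono_neutral_left) (use assms in auto)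

lemma string_cycle_zero [simp]: "string_cycle (\<lambda>_. 0) = 0"
  by (simp add: string_cycle_def)

lemma string_cycle_add:
  assumes "finite {j. a j \<noteq> 0}" "finite {j. b j \<noteq> 0}"
  shows "string_cycle (\<lambda>j. a j + b j) = string_cycle a + string_cycle b"
proof -
  let ?J = "{j. a j \<noteq> 0} \<union> {j. b j \<noteq> 0}"
  have J: "finite ?J" using assms by simp
  have "string_cycle (\<lambda>j. a j + b j) = (\<Sum>j\<in>?J. frag_cmul (a j + b j) (sphere_cycle j))"
    by (rule string_cycle_superset[OF J]) auto
  also have "\<dots> = (\<Sum>j\<in>?J. frag_cmul (a j) (sphere_cycle j)) + (\<Sum>j\<in>?J. frag_cmul (b j) (sphere_cycle j))"
    by (simp add: frag_cmul_distrib sum.distrib)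
  also have "\<dots> = string_cycle a + string_cycle b"
    using string_cycle_superset[OF J, of a] string_cycle_superset[OF J, of b] by simp
  finally show ?thesis .
qed

lemma sphere_cycle_cycle:
  assumes "real j \<in> I"
  shows "singular_relcycle k (subtopology X (string_part k I)) {} (sphere_cycle j)"
  unfolding sphere_cycle_def
  by (rule singular_relcycle_chain_map[OF cycle continuous_map_sphere_inclusion[OF assms]]) simp

lemma string_cycle_cycle:
  assumes "\<And>j. a j \<noteq> 0 \<Longrightarrow> t < real j"
  shows "singular_relcycle k (string_tail k t) {} (string_cycle a)"
  unfolding string_cycle_def
proof (rule singular_relcycle_sum)
  fix j assume "j \<in> {j. a j \<noteq> 0}"
  then have "real j \<in> {t<..}" using assms by simp
  then show "singular_relcycle k (string_tail k t) {} (frag_cmul (a j) (sphere_cycle j))"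
    by (intro singular_relcycle_cmul sphere_cycle_cycle)
qed

text \<open>The neighbourhood deforms to the sphere, where all cycles are multiples of \<open>\<zeta>\<close> up to boundaries.\<close>

lemma cycle_near_sphere:
  assumes I: "is_interval I" and j: "real j \<in> I" and only: "\<And>n::nat. real n \<in> I \<Longrightarrow> n = j"
    and c: "singular_relcycle k (subtopology X (string_part k I)) {} c"
  shows "\<exists>a. homologous_rel k (subtopology X (string_part k I)) {} c (frag_cmul a (sphere_cycle j))"
proof -
  let ?W = "subtopology X (string_part k I)"
  let ?i = "\<lambda>y :: nat \<Rightarrow> real. (real j, y)"
  let ?c = "chain_map k snd c"
  have snd: "continuous_map ?W (nsphere k) snd"
    by (rule continuous_map_from_subtopology[OF continuous_map_string_snd])
  have incl: "continuous_map (nsphere k) ?W ?i" by (rule continuous_map_sphere_inclusion[OF j])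
  have "singular_relcycle k (nsphere k) {} ?c"
    by (rule singular_relcycle_chain_map[OF c snd]) simp
  then obtain a where a: "homologous_rel k (nsphere k) {} ?c (frag_cmul a \<zeta>)" using generates by blast
  have "singular_relboundary k ?W {} (chain_map k ?i (?c - frag_cmul a \<zeta>))"
    by (rule singular_relboundary_chain_map[OF a[unfolded homologous_rel_def] incl]) auto
  then have "homologous_rel k ?W {} (chain_map k ?i ?c) (frag_cmul a (sphere_cycle j))"
    by (simp add: homologous_rel_def chain_map_diff sphere_cycle_def)
  moreover have "chain_map k ?i ?c = chain_map k (\<lambda>z. (real j, snd z)) c"
    using fun_cong[OF chain_map_compose[of k ?i snd], of c] by (simp add: o_def)
  moreover have "homologous_rel k ?W {} (chain_map k id c) (chain_map k (\<lambda>z. (real j, snd z)) c)"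
    by (rule homotopic_imp_homologous_cycle[OF sphere_neighbourhood_retraction[OF I j only] c])
  moreover have "chain_map k id c = c" using c by (intro chain_map_ident) (auto simp: singular_cycle)
  ultimately show ?thesis using homologous_rel_trans by (metis (no_types, lifting))
qed

abbreviation nbhd :: "real \<Rightarrow> nat \<Rightarrow> real set" where
  "nbhd t j \<equiv> {t<..} \<inter> {real j - 1/2<..<real j + 1/2}"

lemma is_interval_nbhd: "is_interval (nbhd t j)"
  by (intro is_interval_Int) (auto simp: is_interval_1)

text \<open>Induction on the number of spheres whose neighbourhoods are used, as in a Mayer-Vietoris argument. Let
  \<open>e\<close> be the part of the cycle near the sphere \<open>j\<close> and \<open>d\<close> the rest. Their boundaries agree up to sign and lie in the
  intersection of the neighbourhood of \<open>j\<close> with the near-ray part, which is contractible, so a chain \<open>b\<close> there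
  has the same boundary as \<open>e\<close>. Then \<open>e - b\<close> is a cycle near the sphere \<open>j\<close>, and \<open>d + b\<close> is a cycle that
  uses fewer spheres.\<close>

lemma small_cycle_homologous_to_string_cycle:
  assumes "finite J" "\<And>j. j \<in> J \<Longrightarrow> t < real j"
    and "singular_relcycle k (string_tail k t) {} c"
    and "\<And>f. f \<in> Poly_Mapping.keys c \<Longrightarrow> f ` standard_simplex k \<subseteq> near_ray k {t<..}
       \<or> (\<exists>j\<in>J. f ` standard_simplex k \<subseteq> string_part k (nbhd t j))"
  shows "\<exists>a. {j. a j \<noteq> 0} \<subseteq> J \<and> homologous_rel k (string_tail k t) {} c (string_cycle a)"
  using assms
proof (induction J arbitrary: c)
  case empty
  have "singular_relcycle k (subtopology X (near_ray k {t<..})) {} c"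
    using empty.prems(2,3) by (auto simp: singular_cycle singular_chain_subtopology)
  moreover have "contractible_space (subtopology X (near_ray k {t<..}))"
    by (rule contractible_near_ray[where ?x0.0 = "\<bar>t\<bar> + 1"]) (auto simp: is_interval_1)
  ultimately have "singular_relboundary k (subtopology X (near_ray k {t<..})) {} c"
    using contractible_cycle_boundary k by blast
  then have "singular_relboundary k (string_tail k t) {} c"
    by (rule singular_boundary_mono[rotated]) auto
  then show ?case by (intro exI[of _ "\<lambda>_. 0"]) (simp add: homologous_rel_def)
next
  case (insert j J)
  let ?\<Delta> = "standard_simplex k" and ?N = "near_ray k {t<..}" and ?W = "\<lambda>i. string_part k (nbhd t i)"
  let ?C = "near_ray k (nbhd t j)"
  have cX: "singular_chain k X c" "chain_boundary k c = 0"
    using insert.prems(2) by (auto simp: singular_cycle singular_chain_subtopology)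
  have tj: "t < real j" using insert.prems(1) by simp
  define S1 where "S1 = {f. singular_simplex k X f \<and> (f ` ?\<Delta> \<subseteq> ?N \<or> (\<exists>i\<in>J. f ` ?\<Delta> \<subseteq> ?W i))}"
  define S2 where "S2 = {f. singular_simplex k X f \<and> f ` ?\<Delta> \<subseteq> ?W j}"
  have "Poly_Mapping.keys c \<subseteq> S1 \<union> S2"
  proof
    fix f assume f: "f \<in> Poly_Mapping.keys c"
    then have "singular_simplex k X f" using cX(1) by (auto simp: singular_chain_def)
    then show "f \<in> S1 \<union> S2" using insert.prems(3)[OF f] by (auto simp only: S1_def S2_def)
  qed
  then obtain d e where de: "Poly_Mapping.keys d \<subseteq> S1" "Poly_Mapping.keys e \<subseteq> S2" "d + e = c"
    by (rule frag_split)
  let ?V = "?N \<union> (\<Union>i\<in>J. ?W i)"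
  have d: "singular_chain k (subtopology X ?V) d"
    using de(1) by (fastforce simp: singular_chain_def singular_simplex_subtopology S1_def)
  have e: "singular_chain k (subtopology X (?W j)) e"
    using de(2) by (auto simp: singular_chain_def singular_simplex_subtopology S2_def)
  have sum0: "chain_boundary k d + chain_boundary k e = 0"
    using cX(2) de(3) by (simp flip: chain_boundary_add)
  then have neg: "chain_boundary k e = - chain_boundary k d" by (simp add: eq_neg_iff_add_eq_0 add.commute)
  have "singular_chain (k - Suc 0) (subtopology X ?V) (chain_boundary k e)"
    unfolding neg singular_chain_minus by (rule singular_chain_boundary[OF d])
  moreover have "singular_chain (k - Suc 0) (subtopology X (?W j)) (chain_boundary k e)"
    by (rule singular_chain_boundary[OF e])
  moreover have "?V \<inter> ?W j \<subseteq> ?C"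
  proof
    fix z assume z: "z \<in> ?V \<inter> ?W j"
    have "z \<notin> ?W i" if i: "i \<in> J" for i
    proof
      assume "z \<in> ?W i"
      then have "\<bar>real i - real j\<bar> < 1" using z by auto
      then have "i = j" by linarith
      then show False using i insert.hyps by simp
    qed
    then show "z \<in> ?C" using z by auto
  qed
  ultimately have "singular_chain (k - Suc 0) (subtopology X ?C) (chain_boundary k e)"
    unfolding singular_chain_subtopology by blast
  moreover obtain p where p: "k = Suc p" using k by (cases k) auto
  moreover have "contractible_space (subtopology X ?C)"
    by (rule contractible_near_ray[where ?x0.0 = "real j"]) (use is_interval_nbhd tj in auto)
  ultimately obtain b where b: "singular_chain k (subtopology X ?C) b" "chain_boundary k b = chain_boundary k e"
    using boundary_bounds_in_contractible[of X ?C p e] e by (auto simp: singular_chain_subtopology)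
  have "singular_chain k (subtopology X (?W j)) b" using b(1) by (rule singular_chain_mono) auto
  then have "singular_relcycle k (subtopology X (?W j)) {} (e - b)"
    using e b(2) by (simp add: singular_cycle singular_chain_diff chain_boundary_diff)
  moreover have "n = j" if "real n \<in> nbhd t j" for n
  proof -
    have "\<bar>real n - real j\<bar> < 1" using that by auto
    then show ?thesis by linarith
  qed
  moreover have "real j \<in> nbhd t j" using tj by simp
  ultimately obtain a0 where "homologous_rel k (subtopology X (?W j)) {} (e - b) (frag_cmul a0 (sphere_cycle j))"
    using cycle_near_sphere[where c = "e - b" and I = "nbhd t j", OF is_interval_nbhd] by meson
  then have "singular_relboundary k (string_tail k t) {} (e - b - frag_cmul a0 (sphere_cycle j))"
    unfolding homologous_rel_def by (rule singular_boundary_mono[rotated]) auto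
  then have a0: "homologous_rel k (string_tail k t) {} (e - b) (frag_cmul a0 (sphere_cycle j))"
    by (simp add: homologous_rel_def)
  have "singular_chain k (string_tail k t) d" using d by (rule singular_chain_mono) auto
  moreover have "singular_chain k (string_tail k t) b" using b(1) by (rule singular_chain_mono) auto
  ultimately have "singular_relcycle k (string_tail k t) {} (d + b)"
    using sum0 b(2) by (simp add: singular_cycle singular_chain_add chain_boundary_add)
  moreover have "f ` ?\<Delta> \<subseteq> ?N \<or> (\<exists>i\<in>J. f ` ?\<Delta> \<subseteq> ?W i)" if f: "f \<in> Poly_Mapping.keys (d + b)" for f
  proof (cases "f \<in> Poly_Mapping.keys b")
    case True
    have "?C \<subseteq> ?N" by auto
    moreover have "f ` ?\<Delta> \<subseteq> ?C" using b(1) True unfolding singular_chain_subtopology by blast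
    ultimately show ?thesis by (meson subset_trans)
  next
    case False
    then have "f \<in> Poly_Mapping.keys d" using f keys_add[of d b] by blast
    then have "f \<in> S1" using de(1) by blast
    then show ?thesis unfolding S1_def by (simp only: mem_Collect_eq)
  qed
  ultimately obtain a where a: "{j. a j \<noteq> 0} \<subseteq> J" "homologous_rel k (string_tail k t) {} (d + b) (string_cycle a)"
    using insert.IH[of "d + b"] insert.prems(1) by auto
  define a' where "a' = a(j := a0)"
  have a'_eq: "a' j = a0" "\<And>i. i \<noteq> j \<Longrightarrow> a' i = a i" by (simp_all add: a'_def)
  have supp: "{i. a' i \<noteq> 0} \<subseteq> insert j J"
  proof
    fix i assume i: "i \<in> {i. a' i \<noteq> 0}"
    show "i \<in> insert j J" using i a'_eq(2)[of i] a(1) by (cases "i = j") auto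
  qed
  have "string_cycle a' = (\<Sum>i\<in>insert j J. frag_cmul (a' i) (sphere_cycle i))"
    by (rule string_cycle_superset[OF _ supp]) (simp add: insert.hyps(1))
  also have "\<dots> = frag_cmul a0 (sphere_cycle j) + (\<Sum>i\<in>J. frag_cmul (a' i) (sphere_cycle i))"
    using insert.hyps by (simp add: a'_eq(1))
  also have "(\<Sum>i\<in>J. frag_cmul (a' i) (sphere_cycle i)) = (\<Sum>i\<in>J. frag_cmul (a i) (sphere_cycle i))"
  proof (rule sum.cong[OF refl])
    fix i assume "i \<in> J"
    then have "i \<noteq> j" using insert.hyps(2) by blast
    then show "frag_cmul (a' i) (sphere_cycle i) = frag_cmul (a i) (sphere_cycle i)" by (simp add: a'_eq(2))
  qed
  also have "\<dots> = string_cycle a" by (rule string_cycle_superset[OF insert.hyps(1) a(1), symmetric])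
  finally have "string_cycle a' = string_cycle a + frag_cmul a0 (sphere_cycle j)" by (simp only: add.commute)
  moreover have "c = (d + b) + (e - b)" using de(3) by simp
  ultimately have "homologous_rel k (string_tail k t) {} c (string_cycle a')"
    using homologous_rel_add[OF a(2) a0] by (simp only:)
  then show ?case using supp by blast
qed

text \<open>The near-ray part and the neighbourhoods of the spheres form an open cover of the tail, and subdivision
  makes every simplex subordinate to it.\<close>

theorem cycle_homologous_to_string_cycle:
  assumes c: "singular_relcycle k (string_tail k t) {} c"
  shows "\<exists>a. finite {j. a j \<noteq> 0} \<and> (\<forall>j. a j \<noteq> 0 \<longrightarrow> t < real j)
     \<and> homologous_rel k (string_tail k t) {} c (string_cycle a)"
proof -
  let ?\<Delta> = "standard_simplex k" and ?N = "near_ray k {t<..}" and ?W = "\<lambda>i. string_part k (nbhd t i)"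
  let ?Y = "string_tail k t"
  define \<C> where "\<C> = insert ?N (?W ` {j. t < real j})"
  have "openin ?Y U" if U: "U \<in> \<C>" for U
  proof -
    have "openin X U" using U openin_near_ray[of "{t<..}" k] openin_string_part[of "nbhd t _" k]
      by (auto simp only: \<C>_def insert_iff image_iff open_greaterThan open_greaterThanLessThan open_Int)
    moreover have "U \<subseteq> string_part k {t<..}" using U by (auto simp: \<C>_def)
    ultimately show ?thesis by (simp add: openin_subtopology) blast
  qed
  moreover have "topspace ?Y \<subseteq> \<Union>\<C>"
  proof
    fix z assume z: "z \<in> topspace ?Y"
    show "z \<in> \<Union>\<C>"
    proof (cases "snd z = sphere_basepoint")
      case True
      then have "z \<in> ?N" using z by (auto simp: sphere_basepoint_def)
      then show ?thesis unfolding \<C>_def by blast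
    next
      case False
      then obtain j where "fst z = real j" using z in_string_iff[of "fst z" "snd z" k] by auto
      then have "z \<in> ?W j" "t < real j" using z by auto
      then show ?thesis unfolding \<C>_def by blast
    qed
  qed
  ultimately obtain c' where c': "singular_relcycle k ?Y {} c'" "homologous_rel k ?Y {} c c'"
    and small: "\<And>f. f \<in> Poly_Mapping.keys c' \<Longrightarrow> \<exists>V\<in>\<C>. f \<in> ?\<Delta> \<rightarrow> V"
    using small_homologous_rel_relcycle_exists[OF _ _ c, of \<C>] by blast
  define g where "g f = (SOME j. t < real j \<and> f ` ?\<Delta> \<subseteq> ?W j)" for f
  define J where "J = {j \<in> g ` Poly_Mapping.keys c'. t < real j}"
  have J: "finite J" "\<And>j. j \<in> J \<Longrightarrow> t < real j" by (auto simp: J_def)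
  have "f ` ?\<Delta> \<subseteq> ?N \<or> (\<exists>j\<in>J. f ` ?\<Delta> \<subseteq> ?W j)" if f: "f \<in> Poly_Mapping.keys c'" for f
  proof -
    obtain V where V: "V \<in> \<C>" "f ` ?\<Delta> \<subseteq> V" using small[OF f] by (auto simp: image_subset_iff_funcset)
    then consider "f ` ?\<Delta> \<subseteq> ?N" | "\<exists>j. t < real j \<and> f ` ?\<Delta> \<subseteq> ?W j" by (auto simp only: \<C>_def insert_iff image_iff mem_Collect_eq)
    then show ?thesis
    proof cases
      case 2
      then have "t < real (g f) \<and> f ` ?\<Delta> \<subseteq> ?W (g f)" unfolding g_def by (rule someI_ex)
      then show ?thesis using f unfolding J_def by blast
    qed simp
  qed
  then obtain a where a: "{j. a j \<noteq> 0} \<subseteq> J" "homologous_rel k ?Y {} c' (string_cycle a)"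
    using small_cycle_homologous_to_string_cycle[OF J c'(1)] by blast
  moreover have "homologous_rel k ?Y {} c (string_cycle a)"
    by (rule homologous_rel_trans[OF a(2) c'(2)])
  ultimately show ?thesis using J finite_subset[OF a(1) J(1)] by blast
qed

text \<open>Collapsing everything but the \<open>j\<close>-th sphere to the basepoint keeps the \<open>j\<close>-th summand and turns the others
  into boundaries.\<close>

theorem string_cycle_boundary_imp_zero:
  assumes a: "finite {j. a j \<noteq> 0}" and bd: "singular_relboundary k X {} (string_cycle a)"
  shows "a j = 0"
proof -
  let ?p = "sphere_projection j"
  let ?w = "\<lambda>i. chain_map k ?p (sphere_cycle i)"
  have w: "?w i = chain_map k (\<lambda>y. ?p (real i, y)) \<zeta>" for i
    using fun_cong[OF chain_map_compose[of k ?p "\<lambda>y. (real i, y)"], of \<zeta>] by (simp add: o_def sphere_cycle_def)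
  have wj: "?w j = \<zeta>"
    unfolding w by (rule chain_map_id_gen[of k "nsphere k"]) (use cycle in \<open>auto simp: sphere_projection_def singular_cycle\<close>)
  have wi: "singular_relboundary k (nsphere k) {} (?w i)" if "i \<noteq> j" for i
    unfolding w using chain_map_const_cycle_boundary[OF cycle sphere_basepoint_in_nsphere k] that
    by (simp add: sphere_projection_def)
  let ?J = "insert j {j. a j \<noteq> 0}"
  have J: "finite ?J" using a by simp
  have "chain_map k ?p (string_cycle a) = (\<Sum>i\<in>?J. frag_cmul (a i) (?w i))"
    unfolding string_cycle_superset[OF J subset_insertI] by (subst chain_map_sum[OF J]) (simp add: o_def)
  also have "\<dots> = frag_cmul (a j) \<zeta> + (\<Sum>i\<in>?J - {j}. frag_cmul (a i) (?w i))"
    using sum.remove[OF J, of j "\<lambda>i. frag_cmul (a i) (?w i)"] wj by simp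
  finally have eq: "frag_cmul (a j) \<zeta> = chain_map k ?p (string_cycle a) - (\<Sum>i\<in>?J - {j}. frag_cmul (a i) (?w i))" by simp
  have "singular_relboundary k (nsphere k) {} (chain_map k ?p (string_cycle a))"
    by (rule singular_relboundary_chain_map[OF bd continuous_map_sphere_projection]) simp
  moreover have "singular_relboundary k (nsphere k) {} (\<Sum>i\<in>?J - {j}. frag_cmul (a i) (?w i))"
    by (rule singular_relboundary_sum) (auto intro: singular_relboundary_cmul wi)
  ultimately have "singular_relboundary k (nsphere k) {} (frag_cmul (a j) \<zeta>)"
    unfolding eq by (rule singular_relboundary_diff)
  then show ?thesis by (rule free)
qed

end


section \<open>The proper homology of the string of spheres\<close>

text \<open>The sets \<open>e i\<close> of the end and the tails of the string are cofinal in each other. A tail disjoint from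
  \<open>K i\<close> is connected, so a component of the complement of \<open>K i\<close> contains the tail or is disjoint from it, and
  in the latter case its closure would be compact. Conversely, a bounded part of the string is
  compact and so contained in some \<open>K i\<close>.\<close>

lemma converges_to_end_string_iff:
  assumes k: "k \<ge> 1" and K: "efficient_exhaustion (string_of_spheres k) K"
    and e: "is_end (string_of_spheres k) K e"
  shows "converges_to_end Z e \<longleftrightarrow> (\<forall>t::nat. \<exists>m. \<forall>n\<ge>m. Z n \<subseteq> string_part k {real t<..})"
proof -
  let ?X = "string_of_spheres k"
  let ?Y = "\<lambda>i. subtopology ?X (topspace ?X - K i)"
  have comp: "compactin ?X (K i)" and sub: "K i \<subseteq> K (Suc i)" and int: "K i \<subseteq> ?X interior_of K (Suc i)"
    and nc: "\<And>C. C \<in> connected_components_of (?Y i) \<Longrightarrow> \<not> compactin ?X (?X closure_of C)" for i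
    using K by (auto simp: efficient_exhaustion_def)
  have cover: "(\<Union>i. K i) = topspace ?X" using K by (simp add: efficient_exhaustion_def)
  have mono: "i \<le> j \<Longrightarrow> K i \<subseteq> K j" for i j using sub by (rule lift_Suc_mono_le)
  have comp_e: "e i \<in> connected_components_of (?Y i)" for i using e by (simp add: is_end_def)
  have e_disj: "e i \<subseteq> topspace ?X - K i" for i
    using connected_components_of_subset[OF comp_e] by auto
  have inner: "\<exists>t::nat. string_part k {real t<..} \<subseteq> e i" for i
  proof -
    obtain c where c: "c \<ge> 0" "K i \<subseteq> string_part k {..c}" using compactin_string_bounded[OF comp] by blast
    obtain t :: nat where t: "c \<le> real t" using real_arch_simple by blast
    let ?T = "string_part k {real t<..}"
    have "connectedin (?Y i) ?T"
      unfolding connectedin_subtopology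
    proof
      show "connectedin ?X ?T" by (rule connectedin_string_part[OF k]) (auto simp: is_interval_1)
      show "?T \<subseteq> topspace ?X - K i" using c(2) t by force
    qed
    moreover have "\<not> disjnt (e i) ?T"
    proof
      assume "disjnt (e i) ?T"
      then have "e i \<subseteq> string_part k {..real t}" using e_disj[of i] by (fastforce simp: disjnt_def)
      moreover have "closedin ?X (string_part k {..real t})"
        by (rule closedin_continuous_map_preimage[OF continuous_map_string_fst]) auto
      ultimately have "?X closure_of e i \<subseteq> string_part k {..real t}" by (simp add: closure_of_minimal)
      then have "compactin ?X (?X closure_of e i)"
        by (rule closed_compactin[OF compactin_string_part _ closedin_closure_of])
      with nc[OF comp_e] show False by (rule notE)
    qed
    ultimately have "?T \<subseteq> e i" by (rule connected_components_of_maximal[OF comp_e])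
    then show ?thesis by blast
  qed
  have outer: "\<exists>i. e i \<subseteq> string_part k {real t<..}" for t :: nat
  proof -
    let ?B = "string_part k {..real t}"
    have "\<exists>\<F>. finite \<F> \<and> \<F> \<subseteq> range (\<lambda>i. ?X interior_of K i) \<and> ?B \<subseteq> \<Union>\<F>"
    proof -
      have "openin ?X U" if "U \<in> range (\<lambda>i. ?X interior_of K i)" for U using that by auto
      moreover have "?B \<subseteq> \<Union>(range (\<lambda>i. ?X interior_of K i))" using cover int by blast
      ultimately show ?thesis using compactin_string_part[of k "real t"] unfolding compactin_def by meson
    qed
    then obtain \<F> where F: "finite \<F>" "\<F> \<subseteq> range (\<lambda>i. ?X interior_of K i)" "?B \<subseteq> \<Union>\<F>" by blast
    then obtain I where I: "finite I" "\<F> = (\<lambda>i. ?X interior_of K i) ` I" by (meson finite_subset_image)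
    have "?B \<subseteq> K (Max (insert 0 I))"
    proof
      fix z assume "z \<in> ?B"
      then obtain i where i: "i \<in> I" "z \<in> ?X interior_of K i" using F(3) I(2) by blast
      then have "z \<in> K i" using interior_of_subset[of ?X "K i"] by blast
      moreover have "i \<le> Max (insert 0 I)" using i(1) I(1) by simp
      ultimately show "z \<in> K (Max (insert 0 I))" using mono by blast
    qed
    then have "e (Max (insert 0 I)) \<subseteq> string_part k {real t<..}" using e_disj by fastforce
    then show ?thesis by blast
  qed
  show ?thesis
    unfolding converges_to_end_def using inner outer by (meson subset_trans)
qed

context sphere_generator
begin

lemma chain_supp_subset_iff:
  "singular_chain p X c \<and> chain_supp p c \<subseteq> S \<longleftrightarrow> singular_chain p (subtopology X S) c"
  by (auto simp: singular_chain_subtopology chain_supp_def)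

end

locale string_end = sphere_generator +
  fixes K e
  assumes exh: "efficient_exhaustion X K" and end_e: "is_end X K e"
begin

text \<open>In this form the choice of the exhaustion has disappeared.\<close>

lemma proper_chains_iff:
  "c \<in> proper_chains p X e \<longleftrightarrow> (\<forall>n. singular_chain p X (c n))
     \<and> (\<forall>t::nat. \<exists>m. \<forall>n\<ge>m. singular_chain p (string_tail k (real t)) (c n))"
proof -
  have supp: "chain_supp p d \<subseteq> S \<longleftrightarrow> singular_chain p (subtopology X S) d"
    if "singular_chain p X d" for d S
    using chain_supp_subset_iff[of p d S] that by blast
  show ?thesis
    unfolding proper_chains_def converges_to_end_string_iff[OF k exh end_e] mem_Collect_eq
    by (rule conj_cong[OF refl]) (simp add: supp)
qed

abbreviation "Cycles \<equiv> proper_cycles k X e"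
abbreviation "Boundaries \<equiv> proper_boundaries k X e"

lemma proper_chains_diff:
  assumes "c \<in> proper_chains p X e" "d \<in> proper_chains p X e"
  shows "(\<lambda>n. c n - d n) \<in> proper_chains p X e"
  unfolding proper_chains_iff
proof (intro conjI allI)
  show "singular_chain p X (c n - d n)" for n
    using assms singular_chain_diff unfolding proper_chains_iff by blast
  fix t :: nat
  obtain m1 m2 where "\<And>n. n \<ge> m1 \<Longrightarrow> singular_chain p (string_tail k (real t)) (c n)"
    "\<And>n. n \<ge> m2 \<Longrightarrow> singular_chain p (string_tail k (real t)) (d n)"
    using assms unfolding proper_chains_iff by meson
  then show "\<exists>m. \<forall>n\<ge>m. singular_chain p (string_tail k (real t)) (c n - d n)"
    by (intro exI[of _ "max m1 m2"] allI impI singular_chain_diff) auto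
qed

lemma proper_chains_zero: "(\<lambda>_. 0) \<in> proper_chains p X e"
  by (simp add: proper_chains_iff)

lemma cycles_iff: "c \<in> Cycles \<longleftrightarrow> c \<in> proper_chains k X e \<and> (\<exists>m. \<forall>n\<ge>m. chain_boundary k (c n) = 0)"
  by (simp add: proper_cycles_def)

lemma cycles_zero: "(\<lambda>_. 0) \<in> Cycles"
  by (simp add: cycles_iff proper_chains_zero)

lemma cycles_diff:
  assumes "c \<in> Cycles" "d \<in> Cycles" shows "(\<lambda>n. c n - d n) \<in> Cycles"
proof -
  obtain m1 m2 where "\<And>n. n \<ge> m1 \<Longrightarrow> chain_boundary k (c n) = 0" "\<And>n. n \<ge> m2 \<Longrightarrow> chain_boundary k (d n) = 0"
    using assms unfolding cycles_iff by meson
  then have "\<exists>m. \<forall>n\<ge>m. chain_boundary k (c n - d n) = 0"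
    by (intro exI[of _ "max m1 m2"]) (auto simp: chain_boundary_diff)
  then show ?thesis using assms proper_chains_diff unfolding cycles_iff by blast
qed

lemma boundaries_iff: "c \<in> Boundaries \<longleftrightarrow> c \<in> proper_chains k X e
    \<and> (\<exists>b \<in> proper_chains (Suc k) X e. \<exists>m. \<forall>n\<ge>m. c n = chain_boundary (Suc k) (b n))"
  by (simp add: proper_boundaries_def)

lemma boundariesI:
  assumes "c \<in> proper_chains k X e" "b \<in> proper_chains (Suc k) X e"
    "\<And>n. n \<ge> m \<Longrightarrow> c n = chain_boundary (Suc k) (b n)"
  shows "c \<in> Boundaries"
  unfolding boundaries_iff by (intro conjI bexI[of _ b] exI[of _ m]) (use assms in auto)

lemma boundaries_subset_chains: "c \<in> Boundaries \<Longrightarrow> c \<in> proper_chains k X e"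
  by (simp add: boundaries_iff)

lemma boundaries_zero: "(\<lambda>_. 0) \<in> Boundaries"
  by (rule boundariesI[of _ "\<lambda>_. 0"]) (simp_all add: proper_chains_zero)

lemma boundaries_diff:
  assumes "c \<in> Boundaries" "d \<in> Boundaries" shows "(\<lambda>n. c n - d n) \<in> Boundaries"
proof -
  obtain b1 m1 where 1: "b1 \<in> proper_chains (Suc k) X e" "\<And>n. n \<ge> m1 \<Longrightarrow> c n = chain_boundary (Suc k) (b1 n)"
    using assms(1) unfolding boundaries_iff by meson
  obtain b2 m2 where 2: "b2 \<in> proper_chains (Suc k) X e" "\<And>n. n \<ge> m2 \<Longrightarrow> d n = chain_boundary (Suc k) (b2 n)"
    using assms(2) unfolding boundaries_iff by meson
  show ?thesis
  proof (rule boundariesI)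
    show "(\<lambda>n. c n - d n) \<in> proper_chains k X e"
      using assms by (intro proper_chains_diff boundaries_subset_chains)
    show "(\<lambda>n. b1 n - b2 n) \<in> proper_chains (Suc k) X e" by (rule proper_chains_diff[OF 1(1) 2(1)])
    show "c n - d n = chain_boundary (Suc k) (b1 n - b2 n)" if "n \<ge> max m1 m2" for n
      using 1(2) 2(2) that by (simp add: chain_boundary_diff)
  qed
qed

lemma boundaries_subset_cycles: "Boundaries \<subseteq> Cycles"
proof
  fix c assume c: "c \<in> Boundaries"
  then obtain b m where b: "b \<in> proper_chains (Suc k) X e" "\<And>n. n \<ge> m \<Longrightarrow> c n = chain_boundary (Suc k) (b n)"
    unfolding boundaries_iff by meson
  have "chain_boundary k (c n) = 0" if "n \<ge> m" for n
    using chain_boundary_boundary[of "Suc k" X "b n"] b that by (simp add: proper_chains_iff)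
  then show "c \<in> Cycles" using c unfolding cycles_iff boundaries_iff by blast
qed

definition sequence_group :: "(nat \<Rightarrow> (real \<times> (nat \<Rightarrow> real)) chain) monoid" where
  "sequence_group = (product_group UNIV (\<lambda>n::nat. chain_group k X))\<lparr>carrier := Cycles\<rparr>"

lemma sequence_group_simps [simp]:
  "carrier sequence_group = Cycles" "\<one>\<^bsub>sequence_group\<^esub> = (\<lambda>_. 0)"
  "c \<otimes>\<^bsub>sequence_group\<^esub> d = (\<lambda>n. c n + d n)"
  by (simp_all add: sequence_group_def restrict_def)

lemma cycles_uminus: "c \<in> Cycles \<Longrightarrow> (\<lambda>n. - c n) \<in> Cycles"
  using cycles_diff[OF cycles_zero, of c] by simp

lemma cycles_add: "c \<in> Cycles \<Longrightarrow> d \<in> Cycles \<Longrightarrow> (\<lambda>n. c n + d n) \<in> Cycles"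
  using cycles_diff[OF _ cycles_uminus, of c d] by simp

lemma comm_group_sequence_group: "comm_group sequence_group"
proof (rule comm_groupI)
  show "\<exists>d\<in>carrier sequence_group. d \<otimes>\<^bsub>sequence_group\<^esub> c = \<one>\<^bsub>sequence_group\<^esub>"
    if "c \<in> carrier sequence_group" for c
    using that cycles_uminus by (intro bexI[of _ "\<lambda>n. - c n"]) auto
qed (auto simp: cycles_add cycles_zero add_ac)

lemma group_sequence_group: "group sequence_group"
  using comm_group_sequence_group by (simp add: comm_group_def)

lemma inv_sequence_group: "c \<in> Cycles \<Longrightarrow> inv\<^bsub>sequence_group\<^esub> c = (\<lambda>n. - c n)"
  by (rule group.inv_equality[OF group_sequence_group]) (auto simp: cycles_uminus)

lemma subgroup_boundaries: "subgroup Boundaries sequence_group"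
proof (rule group.subgroupI[OF group_sequence_group])
  show "Boundaries \<subseteq> carrier sequence_group" using boundaries_subset_cycles by simp
  show "Boundaries \<noteq> {}" using boundaries_zero by blast
  have neg: "(\<lambda>n. - c n) \<in> Boundaries" if "c \<in> Boundaries" for c
    using boundaries_diff[OF boundaries_zero that] by simp
  show "inv\<^bsub>sequence_group\<^esub> c \<in> Boundaries" if "c \<in> Boundaries" for c
    using neg[OF that] that boundaries_subset_cycles by (subst inv_sequence_group) auto
  show "c \<otimes>\<^bsub>sequence_group\<^esub> d \<in> Boundaries" if "c \<in> Boundaries" "d \<in> Boundaries" for c d
    using boundaries_diff[OF that(1) neg[OF that(2)]] by simp
qed

abbreviation "H \<equiv> proper_homology_group k X e"

lemma H_eq: "H = sequence_group Mod Boundaries"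
  by (simp add: proper_homology_group_def sequence_group_def)

lemma comm_group_H: "comm_group H"
  unfolding H_eq by (rule comm_group.abelian_FactGroup[OF comm_group_sequence_group subgroup_boundaries])

definition homology_class :: "(nat \<Rightarrow> (real \<times> (nat \<Rightarrow> real)) chain) \<Rightarrow> (nat \<Rightarrow> (real \<times> (nat \<Rightarrow> real)) chain) set" where
  "homology_class c = r_coset sequence_group Boundaries c"

lemma homology_class_hom: "homology_class \<in> hom sequence_group H"
  unfolding H_eq homology_class_def[abs_def]
  by (rule normal.r_coset_hom_Mod) (simp add: comm_group.normal_iff_subgroup comm_group_sequence_group subgroup_boundaries)

lemma homology_class_eq_one:
  assumes "c \<in> Cycles" shows "homology_class c = \<one>\<^bsub>H\<^esub> \<longleftrightarrow> c \<in> Boundaries"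
proof -
  interpret S: comm_group sequence_group by (rule comm_group_sequence_group)
  show ?thesis
  using assms S.coset_join1[OF _ _ subgroup_boundaries, of c] S.coset_join2[OF _ subgroup_boundaries, of c]
    subgroup.subset[OF subgroup_boundaries]
  by (auto simp: homology_class_def H_eq)
qed

lemma homology_class_eqI:
  assumes "c \<in> Cycles" "d \<in> Cycles" "(\<lambda>n. c n - d n) \<in> Boundaries"
  shows "homology_class c = homology_class d"
proof -
  interpret H: comm_group H by (rule comm_group_H)
  have "homology_class (\<lambda>n. (c n - d n) + d n) = homology_class (\<lambda>n. c n - d n) \<otimes>\<^bsub>H\<^esub> homology_class d"
    using hom_mult[OF homology_class_hom, of "\<lambda>n. c n - d n" d] cycles_diff assms by simp
  also have "homology_class (\<lambda>n. c n - d n) = \<one>\<^bsub>H\<^esub>" using homology_class_eq_one[OF cycles_diff] assms by simp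
  finally show ?thesis using hom_carrier[OF homology_class_hom] assms(2) by (simp add: image_subset_iff del: one_FactGroup)
qed

text \<open>Sets on which this is finite-to-one are those that meet every row and every column in a finite set.\<close>

definition tail_rank :: "nat \<times> nat \<Rightarrow> nat" where "tail_rank = (\<lambda>(n, j). min n j)"

text \<open>The row index counts the cycles of the sequence, the column index the spheres.\<close>

definition matrix_sequence :: "(nat \<times> nat \<Rightarrow> int) \<Rightarrow> nat \<Rightarrow> (real \<times> (nat \<Rightarrow> real)) chain" where
  "matrix_sequence f n = string_cycle (\<lambda>j. f (n, j))"

lemma proper_matrix_row_finite:
  assumes "f \<in> proper_functions tail_rank" shows "finite {j. f (n, j) \<noteq> 0}"
proof (rule finite_subset)
  show "{j. f (n, j) \<noteq> 0} \<subseteq> snd ` {i. f i \<noteq> 0 \<and> tail_rank i \<le> n}"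
  proof
    fix j assume "j \<in> {j. f (n, j) \<noteq> 0}"
    then have "(n, j) \<in> {i. f i \<noteq> 0 \<and> tail_rank i \<le> n}" by (simp add: tail_rank_def)
    then show "j \<in> snd ` {i. f i \<noteq> 0 \<and> tail_rank i \<le> n}" by force
  qed
qed (use proper_functionsD[OF assms] in blast)

lemma proper_matrix_columns_vanish:
  assumes "f \<in> proper_functions tail_rank" shows "\<exists>m. \<forall>n\<ge>m. \<forall>j. f (n, j) \<noteq> 0 \<longrightarrow> t < j"
proof -
  let ?F = "{i. f i \<noteq> 0 \<and> tail_rank i \<le> t}"
  have "finite (fst ` ?F)" using proper_functionsD[OF assms] by blast
  then obtain m where m: "\<forall>n \<in> fst ` ?F. n < m" unfolding finite_nat_set_iff_bounded ..
  have "t < j" if "n \<ge> m" "f (n, j) \<noteq> 0" for n j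
  proof (rule ccontr)
    assume "\<not> t < j"
    then have "(n, j) \<in> ?F" using that by (simp add: tail_rank_def)
    then have "fst (n, j) < m" using m by (rule bspec[OF _ imageI, rotated])
    then show False using that by simp
  qed
  then show ?thesis by (intro exI[of _ m]) simp
qed

lemma matrix_sequence_cycles:
  assumes f: "f \<in> proper_functions tail_rank" shows "matrix_sequence f \<in> Cycles"
proof -
  have cyc: "singular_relcycle k (string_tail k (- 1)) {} (matrix_sequence f n)" for n
    unfolding matrix_sequence_def by (rule string_cycle_cycle) simp
  have "\<exists>m. \<forall>n\<ge>m. singular_chain k (string_tail k (real t)) (matrix_sequence f n)" for t :: nat
  proof -
    obtain m where m: "\<And>n j. n \<ge> m \<Longrightarrow> f (n, j) \<noteq> 0 \<Longrightarrow> t < j"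
      using proper_matrix_columns_vanish[OF f] by blast
    have "singular_relcycle k (string_tail k (real t)) {} (matrix_sequence f n)" if "n \<ge> m" for n
      unfolding matrix_sequence_def by (rule string_cycle_cycle) (use m[OF that] in auto)
    then show ?thesis unfolding singular_cycle by blast
  qed
  then show ?thesis
    using cyc singular_chain_tail_whole unfolding cycles_iff proper_chains_iff singular_cycle by blast
qed

lemma matrix_sequence_boundary_iff:
  assumes f: "f \<in> proper_functions tail_rank"
  shows "matrix_sequence f \<in> Boundaries \<longleftrightarrow> finite {i. f i \<noteq> 0}"
proof
  assume "matrix_sequence f \<in> Boundaries"
  then obtain b m where b: "b \<in> proper_chains (Suc k) X e"
      "\<And>n. n \<ge> m \<Longrightarrow> matrix_sequence f n = chain_boundary (Suc k) (b n)"
    unfolding boundaries_iff by meson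
  have zero: "f (n, j) = 0" if "n \<ge> m" for n j
  proof (rule string_cycle_boundary_imp_zero[where a = "\<lambda>j. f (n, j)"])
    show "finite {j. f (n, j) \<noteq> 0}" by (rule proper_matrix_row_finite[OF f])
    show "singular_relboundary k X {} (string_cycle (\<lambda>j. f (n, j)))"
      using b(1) b(2)[OF that] unfolding singular_boundary matrix_sequence_def proper_chains_iff by metis
  qed
  have "{i. f i \<noteq> 0} \<subseteq> Sigma {..<m} (\<lambda>n. {j. f (n, j) \<noteq> 0})"
    using zero by (auto simp: not_le[symmetric])
  then show "finite {i. f i \<noteq> 0}" using proper_matrix_row_finite[OF f] by (auto intro: finite_subset)
next
  assume "finite {i. f i \<noteq> 0}"
  then have "finite (fst ` {i. f i \<noteq> 0})" by blast
  then obtain m where m: "\<forall>n \<in> fst ` {i. f i \<noteq> 0}. n < m" unfolding finite_nat_set_iff_bounded ..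
  have "matrix_sequence f n = chain_boundary (Suc k) 0" if "n \<ge> m" for n
  proof -
    have "f (n, j) = 0" for j
    proof (rule ccontr)
      assume "f (n, j) \<noteq> 0"
      then have "n \<in> fst ` {i. f i \<noteq> 0}" by (intro image_eqI[of _ _ "(n, j)"]) simp_all
      then show False using m that by auto
    qed
    then show ?thesis by (simp add: matrix_sequence_def)
  qed
  then show "matrix_sequence f \<in> Boundaries"
    using matrix_sequence_cycles[OF f] proper_chains_zero[of "Suc k"]
    by (intro boundariesI[of _ "\<lambda>_. 0"]) (auto simp: cycles_iff)
qed

text \<open>For the sequence of the bounding chains to converge to the end, \<open>b\<close> must lie as far out as \<open>c\<close> does. The
  bound \<open>n\<close> makes this finitely many conditions, of which the last implies the others.\<close>

lemma cycle_homologous_in_tails: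
  assumes c: "singular_relcycle k X {} c"
  shows "\<exists>a b. finite {j. a j \<noteq> 0} \<and> singular_chain (Suc k) X b \<and> c - string_cycle a = chain_boundary (Suc k) b
    \<and> (\<forall>t::nat\<le>n. singular_chain k (string_tail k (real t)) c \<longrightarrow>
          singular_chain (Suc k) (string_tail k (real t)) b \<and> (\<forall>j. a j \<noteq> 0 \<longrightarrow> t < j))"
proof -
  let ?T = "{t. t \<le> n \<and> singular_chain k (string_tail k (real t)) c}"
  have cycle_tail: "singular_relcycle k (string_tail k s) {} c" if "singular_chain k (string_tail k s) c" for s
    using c that by (simp add: singular_cycle)
  have solve: "\<exists>a b. finite {j. a j \<noteq> 0} \<and> (\<forall>j. a j \<noteq> 0 \<longrightarrow> s < real j)
      \<and> singular_chain (Suc k) (string_tail k s) b \<and> c - string_cycle a = chain_boundary (Suc k) b"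
    if s: "singular_chain k (string_tail k s) c" for s
  proof -
    obtain a where a: "finite {j. a j \<noteq> 0}" "\<forall>j. a j \<noteq> 0 \<longrightarrow> s < real j"
      "homologous_rel k (string_tail k s) {} c (string_cycle a)"
      using cycle_homologous_to_string_cycle[OF cycle_tail[OF s]] by (elim exE conjE)
    obtain b where "singular_chain (Suc k) (string_tail k s) b" "chain_boundary (Suc k) b = c - string_cycle a"
      using a(3) unfolding homologous_rel_def singular_boundary by (elim exE conjE)
    then show ?thesis using a(1,2) by (intro exI[of _ a] exI[of _ b]) simp
  qed
  show ?thesis
  proof (cases "?T = {}")
    case True
    \<comment> \<open>the tail beyond \<open>-1\<close> is the whole string\<close>
    have whole: "string_part k {- 1<..} = topspace X" by (auto simp: topspace_string_of_spheres)
    have "singular_chain k (string_tail k (- 1)) c" using c unfolding whole by (simp add: singular_cycle)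
    from solve[OF this] obtain a b where ab: "finite {j. a j \<noteq> 0}" "singular_chain (Suc k) (string_tail k (-1)) b"
      "c - string_cycle a = chain_boundary (Suc k) b" by (elim exE conjE)
    show ?thesis
      using ab(1,3) singular_chain_tail_whole[OF ab(2)] True by (intro exI[of _ a] exI[of _ b]) blast
  next
    case False
    define T where "T = Max ?T"
    have fin: "finite ?T" by simp
    have T: "T \<in> ?T" unfolding T_def by (rule Max_in[OF fin False])
    have T_max: "t \<le> T" if "t \<in> ?T" for t unfolding T_def by (rule Max_ge[OF fin that])
    have "singular_chain k (string_tail k (real T)) c" using T by simp
    from solve[OF this] obtain a b where ab: "finite {j. a j \<noteq> 0}" "\<forall>j. a j \<noteq> 0 \<longrightarrow> real T < real j"
      "singular_chain (Suc k) (string_tail k (real T)) b" "c - string_cycle a = chain_boundary (Suc k) b"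
      by (elim exE conjE)
    have "singular_chain (Suc k) (string_tail k (real t)) b \<and> (\<forall>j. a j \<noteq> 0 \<longrightarrow> t < j)"
      if "t \<le> n" "singular_chain k (string_tail k (real t)) c" for t :: nat
    proof -
      have t: "t \<le> T" using T_max that by blast
      then have "t < j" if "a j \<noteq> 0" for j using ab(2) that by fastforce
      then show ?thesis using singular_chain_tail_mono[OF ab(3)] t by simp
    qed
    then show ?thesis
      using ab(1,4) singular_chain_tail_whole[OF ab(3)] by (intro exI[of _ a] exI[of _ b]) blast
  qed
qed

text \<open>The terms before \<open>n0\<close> need not be cycles. They are replaced by \<open>0\<close>, which does not change the class.\<close>

lemma homology_class_matrix_sequence_surj:
  assumes c: "c \<in> Cycles"
  shows "\<exists>f \<in> proper_functions tail_rank. homology_class c = homology_class (matrix_sequence f)"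
proof -
  have cX: "singular_chain k X (c n)" for n using c by (simp add: cycles_iff proper_chains_iff)
  obtain n0 where n0: "\<And>n. n \<ge> n0 \<Longrightarrow> chain_boundary k (c n) = 0" using c by (auto simp: cycles_iff)
  define good where "good n a b \<longleftrightarrow> finite {j. a j \<noteq> 0} \<and> singular_chain (Suc k) X b
    \<and> c n - string_cycle a = chain_boundary (Suc k) b
    \<and> (\<forall>t::nat\<le>n. singular_chain k (string_tail k (real t)) (c n) \<longrightarrow>
          singular_chain (Suc k) (string_tail k (real t)) b \<and> (\<forall>j. a j \<noteq> 0 \<longrightarrow> t < j))"
    for n and a :: "nat \<Rightarrow> int" and b
  have "\<exists>a b. n \<ge> n0 \<longrightarrow> good n a b" for n
  proof (cases "n \<ge> n0")
    case True
    have "singular_relcycle k X {} (c n)" using cX n0[OF True] by (simp add: singular_cycle)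
    from cycle_homologous_in_tails[OF this, of n] have "\<exists>a b. good n a b" unfolding good_def .
    then show ?thesis by blast
  qed blast
  then obtain a b where ab: "\<And>n. n \<ge> n0 \<Longrightarrow> good n (a n) (b n)" by metis
  have fin: "finite {j. a n j \<noteq> 0}" and bX: "singular_chain (Suc k) X (b n)"
    and eq: "c n - string_cycle (a n) = chain_boundary (Suc k) (b n)" if "n \<ge> n0" for n
    using ab[OF that] by (simp_all add: good_def)
  have b_tail: "singular_chain (Suc k) (string_tail k (real t)) (b n)"
    and a_tail: "\<And>j. a n j \<noteq> 0 \<Longrightarrow> t < j"
    if "n \<ge> n0" "t \<le> n" "singular_chain k (string_tail k (real t)) (c n)" for n t
    using ab[OF that(1)] that(2,3) by (simp_all add: good_def)
  define f where "f = (\<lambda>(n, j). if n \<ge> n0 then a n j else 0)"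
  have conv: "\<exists>m\<ge>max n0 t. \<forall>n\<ge>m. singular_chain k (string_tail k (real t)) (c n)" for t :: nat
  proof -
    obtain m where "\<forall>n\<ge>m. singular_chain k (string_tail k (real t)) (c n)"
      using c unfolding cycles_iff proper_chains_iff by blast
    then show ?thesis by (intro exI[of _ "max m (max n0 t)"]) auto
  qed
  have row: "finite {j. f (n, j) \<noteq> 0}" for n using fin[of n] by (cases "n \<ge> n0") (simp_all add: f_def)
  have f: "f \<in> proper_functions tail_rank"
    unfolding proper_functions_def
  proof (intro CollectI allI)
    fix t
    obtain m where m: "m \<ge> max n0 t" "\<And>n. n \<ge> m \<Longrightarrow> singular_chain k (string_tail k (real t)) (c n)"
      using conv[of t] by blast
    have "{i. f i \<noteq> 0 \<and> tail_rank i \<le> t} \<subseteq> Sigma {..m} (\<lambda>n. {j. f (n, j) \<noteq> 0})"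
    proof
      fix i assume i: "i \<in> {i. f i \<noteq> 0 \<and> tail_rank i \<le> t}"
      obtain n j where nj: "i = (n, j)" by (cases i)
      have "n \<le> m"
      proof (rule ccontr)
        assume "\<not> n \<le> m"
        then have n: "n \<ge> m" "n \<ge> n0" "t \<le> n" "t < n" using m(1) by auto
        then have "a n j \<noteq> 0" using i nj by (simp add: f_def)
        then have "t < j" using a_tail[OF n(2,3) m(2)[OF n(1)]] by blast
        then show False using i nj n(4) by (simp add: tail_rank_def min_le_iff_disj)
      qed
      then show "i \<in> Sigma {..m} (\<lambda>n. {j. f (n, j) \<noteq> 0})" using i nj by simp
    qed
    then show "finite {i. f i \<noteq> 0 \<and> tail_rank i \<le> t}" using row by (auto intro: finite_subset)
  qed
  define b' where "b' n = (if n \<ge> n0 then b n else 0)" for n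
  have b': "b' \<in> proper_chains (Suc k) X e"
    unfolding proper_chains_iff
  proof (intro conjI allI)
    show "singular_chain (Suc k) X (b' n)" for n using bX by (simp add: b'_def)
    fix t :: nat
    obtain m where m: "m \<ge> max n0 t" "\<And>n. n \<ge> m \<Longrightarrow> singular_chain k (string_tail k (real t)) (c n)"
      using conv[of t] by blast
    have "singular_chain (Suc k) (string_tail k (real t)) (b' n)" if "n \<ge> m" for n
      using b_tail[of n t] m(1) m(2)[OF that] that by (simp add: b'_def)
    then show "\<exists>m. \<forall>n\<ge>m. singular_chain (Suc k) (string_tail k (real t)) (b' n)" by blast
  qed
  have eq': "c n - matrix_sequence f n = chain_boundary (Suc k) (b' n)" if "n \<ge> n0" for n
    using eq[OF that] that by (simp add: matrix_sequence_def f_def b'_def)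
  have "(\<lambda>n. c n - matrix_sequence f n) \<in> proper_chains k X e"
    using cycles_diff[OF c matrix_sequence_cycles[OF f]] by (simp add: cycles_iff)
  then have "(\<lambda>n. c n - matrix_sequence f n) \<in> Boundaries" by (rule boundariesI[OF _ b' eq'])
  then show ?thesis using homology_class_eqI[OF c matrix_sequence_cycles[OF f]] f by blast
qed

theorem saturated_H: "saturated_group H"
proof -
  interpret H: comm_group H by (rule comm_group_H)
  interpret proper_function_quotient H tail_rank "\<lambda>f. homology_class (matrix_sequence f)" "\<lambda>n. (n, n)"
  proof
    fix f assume f: "f \<in> proper_functions tail_rank"
    show "homology_class (matrix_sequence f) \<in> carrier H"
      using hom_carrier[OF homology_class_hom] matrix_sequence_cycles[OF f] by auto
    show "homology_class (matrix_sequence f) = \<one>\<^bsub>H\<^esub> \<longleftrightarrow> finite {i. f i \<noteq> 0}"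
      using homology_class_eq_one[OF matrix_sequence_cycles[OF f]] matrix_sequence_boundary_iff[OF f] by blast
    fix g assume g: "g \<in> proper_functions tail_rank"
    have "matrix_sequence (\<lambda>i. f i + g i) = (\<lambda>n. matrix_sequence f n + matrix_sequence g n)"
      using string_cycle_add[OF proper_matrix_row_finite[OF f] proper_matrix_row_finite[OF g]]
      by (simp add: matrix_sequence_def fun_eq_iff)
    then show "homology_class (matrix_sequence (\<lambda>i. f i + g i)) = homology_class (matrix_sequence f) \<otimes>\<^bsub>H\<^esub> homology_class (matrix_sequence g)"
      using hom_mult[OF homology_class_hom, of "matrix_sequence f" "matrix_sequence g"]
        matrix_sequence_cycles f g by simp
  next
    fix v assume "v \<in> carrier H"
    then obtain c where "c \<in> Cycles" "v = homology_class c" by (auto simp: H_eq carrier_FactGroup homology_class_def)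
    then show "\<exists>f \<in> proper_functions tail_rank. v = homology_class (matrix_sequence f)"
      using homology_class_matrix_sequence_surj by blast
  qed (auto simp: tail_rank_def inj_def)
  show ?thesis by (rule saturated)
qed

end

text \<open>All sequences are proper for the identity, as initial segments of \<open>nat\<close> are finite.\<close>

theorem saturated_integer_sequences:
  "saturated_group (product_group (UNIV :: nat set) (\<lambda>_. integer_group)
            Mod carrier (sum_group (UNIV :: nat set) (\<lambda>_. integer_group)))"
proof -
  let ?P = "product_group (UNIV :: nat set) (\<lambda>_. integer_group)"
  define N where "N = carrier (sum_group (UNIV :: nat set) (\<lambda>_. integer_group))"
  have N: "N = {f. finite {i. f i \<noteq> 0}}"
    unfolding N_def by (subst carrier_sum_group) auto
  have P_simps: "carrier ?P = UNIV" "\<And>f g. f \<otimes>\<^bsub>?P\<^esub> g = (\<lambda>i. f i + g i)" by (auto simp: restrict_def)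
  interpret P: comm_group ?P
    by (rule group.group_comm_groupI) (simp_all add: add.commute)
  have sN: "subgroup N ?P"
    using subgroup_sum_group[of "UNIV :: nat set" "\<lambda>_. integer_group"] by (simp add: N)
  let ?A = "?P Mod N"
  interpret A: comm_group ?A by (rule P.abelian_FactGroup[OF sN])
  define \<pi> where "\<pi> f = r_coset ?P N f" for f
  have \<pi>: "\<pi> \<in> hom ?P ?A"
    unfolding \<pi>_def[abs_def] by (rule normal.r_coset_hom_Mod) (simp add: P.normal_iff_subgroup sN)
  have all: "f \<in> proper_functions (\<lambda>n. n)" for f
    by (auto simp: proper_functions_def intro: finite_subset[of _ "{..m}" for m])
  interpret proper_function_quotient ?A "\<lambda>n. n" \<pi> "\<lambda>n. n"
  proof
    fix f :: "nat \<Rightarrow> int"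
    have f: "f \<in> carrier ?P" unfolding P_simps by simp
    show "\<pi> f \<in> carrier ?A" using hom_carrier[OF \<pi>] f by blast
    show "\<pi> f = \<one>\<^bsub>?A\<^esub> \<longleftrightarrow> finite {i. f i \<noteq> 0}"
      using P.coset_join1[OF _ f sN] P.coset_join2[OF f sN] subgroup.subset[OF sN]
      by (auto simp: \<pi>_def N)
    fix g :: "nat \<Rightarrow> int"
    have g: "g \<in> carrier ?P" unfolding P_simps by simp
    show "\<pi> (\<lambda>i. f i + g i) = \<pi> f \<otimes>\<^bsub>?A\<^esub> \<pi> g"
      using hom_mult[OF \<pi> f g] unfolding P_simps(2) .
  next
    fix v assume "v \<in> carrier ?A"
    then show "\<exists>f \<in> proper_functions (\<lambda>n. n). v = \<pi> f"
      using all by (auto simp: carrier_FactGroup \<pi>_def)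
  qed auto
  show ?thesis using saturated by (simp add: N_def)
qed

theorem theorem1p5:
  fixes k :: nat
    and K e :: "nat \<Rightarrow> (real \<times> (nat \<Rightarrow> real)) set"
    and H :: "(nat \<Rightarrow> (real \<times> (nat \<Rightarrow> real)) chain) set monoid"
  assumes "k \<ge> 1"
    and "efficient_exhaustion (string_of_spheres k) K"
    and "is_end (string_of_spheres k) K e"
    and "H = proper_homology_group k (string_of_spheres k) e"
  shows "comm_group H \<and> torsion_free_group H \<and> algebraically_compact TYPE('b) H
    \<and> (\<exists>D. maximal_divisible_subgroup D H
          \<and> H\<lparr>carrier := D\<rparr> \<cong> sum_group (UNIV :: real set) (\<lambda>_. rational_group))
    \<and> (\<forall>p. prime p \<longrightarrow> has_torsion_free_number p H (UNIV :: real set))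
    \<and> H \<cong> product_group (UNIV :: nat set) (\<lambda>_. integer_group)
            Mod carrier (sum_group (UNIV :: nat set) (\<lambda>_. integer_group))"
proof -
  obtain \<zeta> where "singular_relcycle k (nsphere k) {} \<zeta>"
    "\<And>c. singular_relcycle k (nsphere k) {} c \<Longrightarrow> \<exists>a. homologous_rel k (nsphere k) {} c (frag_cmul a \<zeta>)"
    "\<And>a. singular_relboundary k (nsphere k) {} (frag_cmul a \<zeta>) \<Longrightarrow> a = 0"
    using nsphere_homology_generator[OF assms(1)] by blast
  then interpret string_end k \<zeta> K e
    by unfold_locales (use assms in auto)
  interpret H: saturated_group H unfolding assms(4) by (rule saturated_H)
  interpret Q: comm_group rational_sum by (rule comm_group_rational_sum)
  show ?thesis
  proof (intro conjI allI impI)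
    show "comm_group H" by (rule H.comm_group_axioms)
    show "torsion_free_group H" by (rule H.tf)
    show "algebraically_compact TYPE('b) H"
      by (rule algebraically_compactI[OF H.comm_group_axioms H.tf H.sat])
    show "\<exists>D. maximal_divisible_subgroup D H
          \<and> H\<lparr>carrier := D\<rparr> \<cong> sum_group (UNIV :: real set) (\<lambda>_. rational_group)"
      using H.maximal_divisible_part Q.iso_sym[OF H.rational_sum_iso_divisible_part] by blast
    show "has_torsion_free_number p H (UNIV :: real set)" if "prime p" for p
      by (rule H.torsion_free_number_continuum[OF that])
    show "H \<cong> product_group (UNIV :: nat set) (\<lambda>_. integer_group)
            Mod carrier (sum_group (UNIV :: nat set) (\<lambda>_. integer_group))"
      by (rule saturated_groups_isomorphic[OF H.saturated_group_axioms saturated_integer_sequences])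
  qed
qed

end
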